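(* Let $H$ be a commutative bialgebra over a commutative ring $k$, let $A$ be a commutative right $H$-comodule algebra, and let $B=A^{\mathrm{co}H}$. Then the maps $$j:\ \mathrm{Pic}(B)\to\mathrm{Pic}^H(A),\quad j([N])=\{N\otimes_BA\},$$ and $$i:\ K_1\underline{\phi G}\to G^i(A\otimes H)$$ are injective.
   Context: Notation: $\rho(a)=a_{[0]}\otimes a_{[1]}\in A\otimes H$ is the coaction on $A$ (an algebra map), $\Delta(h)=h_{(1)}\otimes h_{(2)}$, $\varepsilon$ are the comultiplication and counit of $H$, and $A^{\mathrm{co}H}=\{a\in A\mid\rho(a)=a\otimes 1\}$. $\mathrm{Pic}(R)$ is the Picard group of a commutative ring $R$. A relative Hopf module is an $A$-module $M$ with a right $H$-coaction $\rho_M(m)=m_{[0]}\otimes m_{[1]}$ such that $\rho_M(ma)=m_{[0]}a_{[0]}\otimes m_{[1]}a_{[1]}$. Relative Hopf modules with $A$-linear $H$-colinear maps form a category $\mathcal{M}^H_A$. It is symmetric monoidal under $\otimes_A$ with unit object $A$, where the coaction on $M\otimes_A N$ is $m\otimes_A n\mapsto m_{[0]}\otimes_A n_{[0]}\otimes m_{[1]}n_{[1]}$. $\mathrm{Pic}^H(A)$ is the group of isomorphism classes $\{M\}$ of invertible objects of $(\mathcal{M}^H_A,\otimes_A,A)$. For a $B$-module $N$, $N\otimes_BA$ is a relative Hopf module with coaction $N\otimes_B\rho$. View $A\otimes H$ as a commutative algebra with product $(a\otimes h)(b\otimes k)=ab\otimes hk$. An element $X=\sum_i a_i\otimes h_i\in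 A\otimes H$ is grouplike if $$\sum_i a_i\otimes h_{i(1)}\otimes h_{i(2)}=\sum_{i,j}a_i a_{j[0]}\otimes h_i a_{j[1]}\otimes h_j\quad\text{and}\quad \sum_i a_i\varepsilon(h_i)=1.$$ $G^i(A\otimes H)$ is the abelian group (under multiplication in $A\otimes H$) of grouplike elements that are invertible in $A\otimes H$. $K_1\underline{\phi G}$ (attached to the functor $G=-\otimes_BA$ from invertible $B$-modules to invertible $A$-modules) is the abelian group of isomorphism classes $[(N,\alpha)]$ of pairs consisting of an invertible $B$-module $N$ and an $A$-linear isomorphism $\alpha:N\otimes_BA\to A$. Here $(N,\alpha)\cong(N',\alpha')$ if there is a $B$-linear isomorphism $f:N\to N'$ with $\alpha=\alpha'\circ(f\otimes_BA)$, and the product is induced by the tensor product over $B$ (of modules) and over $A$ (of isomorphisms). The map $i$ sends $[(N,\alpha)]$ to $X=(\alpha\otimes H)\bigl((N\otimes_B\rho)(\alpha^{-1}(1))\bigr)$; i.e. $X$ is the grouplike element such that $\alpha$ is $H$-colinear when $N\otimes_BA$ has coaction $N\otimes_B\rho$ and $A$ has coaction $a\mapsto X\rho(a)$. *)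

theory Defs
  imports "HOL-Algebra.Module"
begin

section \<open>Modules and their tensor products\<close>

definition mod_hom ::
  "('r, 'x) ring_scheme \<Rightarrow> ('r, 'm, 'y) module_scheme \<Rightarrow> ('r, 'n, 'z) module_scheme \<Rightarrow> ('m \<Rightarrow> 'n) set"
  where "mod_hom R M N =
    {f \<in> carrier M \<rightarrow> carrier N.
      (\<forall>x\<in>carrier M. \<forall>y\<in>carrier M. f (x \<oplus>\<^bsub>M\<^esub> y) = f x \<oplus>\<^bsub>N\<^esub> f y) \<and>
      (\<forall>r\<in>carrier R. \<forall>x\<in>carrier M. f (r \<odot>\<^bsub>M\<^esub> x) = r \<odot>\<^bsub>N\<^esub> f x)}"

definition mod_iso ::
  "('r, 'x) ring_scheme \<Rightarrow> ('r, 'm, 'y) module_scheme \<Rightarrow> ('r, 'n, 'z) module_scheme \<Rightarrow> ('m \<Rightarrow> 'n) set"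
  where "mod_iso R M N = {f \<in> mod_hom R M N. bij_betw f (carrier M) (carrier N)}"

definition regular :: "('r, 'x) ring_scheme \<Rightarrow> ('r, 'r) module"
  where "regular R = \<lparr>carrier = carrier R, mult = mult R, one = one R,
    zero = zero R, add = add R, smult = mult R\<rparr>"

text \<open>Restriction of scalars of an \<open>A\<close>-module along the structure map \<open>c \<mapsto> c \<odot> \<one>\<close>
  of an algebra \<open>A\<close>.\<close>

definition restrict_scalars :: "('k, 'a) module \<Rightarrow> ('a, 'm) module \<Rightarrow> ('k, 'm) module"
  where "restrict_scalars A M = \<lparr>carrier = carrier M, mult = mult M, one = one M,
    zero = zero M, add = add M, smult = (\<lambda>c m. (c \<odot>\<^bsub>A\<^esub> \<one>\<^bsub>A\<^esub>) \<odot>\<^bsub>M\<^esub> m)\<rparr>"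

text \<open>A list \<open>[(m\<^sub>1, n\<^sub>1), \<dots>, (m\<^sub>l, n\<^sub>l)]\<close> stands for the formal sum of the \<open>m\<^sub>i \<otimes> n\<^sub>i\<close>; two lists
  represent the same tensor iff they are related by the least congruence (for concatenation)
  that makes the sum commutative and \<open>\<otimes>\<close> biadditive and \<open>R\<close>-balanced.  Inverses need no
  generators: \<open>zero\<close> makes \<open>(\<ominus> m) \<otimes> n\<close> the negative of \<open>m \<otimes> n\<close>.\<close>

inductive_set tensor_rel ::
  "('r, 'x) ring_scheme \<Rightarrow> ('r, 'm, 'y) module_scheme \<Rightarrow> ('r, 'n, 'z) module_scheme \<Rightarrow>
    (('m \<times> 'n) list \<times> ('m \<times> 'n) list) set"
  for R and M and N where
  refl: "xs \<in> lists (carrier M \<times> carrier N) \<Longrightarrow> (xs, xs) \<in> tensor_rel R M N"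
| sym: "(xs, ys) \<in> tensor_rel R M N \<Longrightarrow> (ys, xs) \<in> tensor_rel R M N"
| trans: "(xs, ys) \<in> tensor_rel R M N \<Longrightarrow> (ys, zs) \<in> tensor_rel R M N \<Longrightarrow> (xs, zs) \<in> tensor_rel R M N"
| append: "(xs, ys) \<in> tensor_rel R M N \<Longrightarrow> (us, vs) \<in> tensor_rel R M N \<Longrightarrow>
    (xs @ us, ys @ vs) \<in> tensor_rel R M N"
| commute: "xs \<in> lists (carrier M \<times> carrier N) \<Longrightarrow> ys \<in> lists (carrier M \<times> carrier N) \<Longrightarrow>
    (xs @ ys, ys @ xs) \<in> tensor_rel R M N"
| zero: "n \<in> carrier N \<Longrightarrow> ([(\<zero>\<^bsub>M\<^esub>, n)], []) \<in> tensor_rel R M N"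
| add_left: "m \<in> carrier M \<Longrightarrow> m' \<in> carrier M \<Longrightarrow> n \<in> carrier N \<Longrightarrow>
    ([(m \<oplus>\<^bsub>M\<^esub> m', n)], [(m, n), (m', n)]) \<in> tensor_rel R M N"
| add_right: "m \<in> carrier M \<Longrightarrow> n \<in> carrier N \<Longrightarrow> n' \<in> carrier N \<Longrightarrow>
    ([(m, n \<oplus>\<^bsub>N\<^esub> n')], [(m, n), (m, n')]) \<in> tensor_rel R M N"
| balanced: "r \<in> carrier R \<Longrightarrow> m \<in> carrier M \<Longrightarrow> n \<in> carrier N \<Longrightarrow>
    ([(r \<odot>\<^bsub>M\<^esub> m, n)], [(m, r \<odot>\<^bsub>N\<^esub> n)]) \<in> tensor_rel R M N"

type_synonym ('m, 'n) tens = "('m \<times> 'n) list set"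

definition pure ::
  "('r, 'x) ring_scheme \<Rightarrow> ('r, 'm, 'y) module_scheme \<Rightarrow> ('r, 'n, 'z) module_scheme \<Rightarrow>
    'm \<Rightarrow> 'n \<Rightarrow> ('m, 'n) tens"
  where "pure R M N m n = tensor_rel R M N `` {[(m, n)]}"

definition tensor ::
  "('r, 'x) ring_scheme \<Rightarrow> ('r, 'm, 'y) module_scheme \<Rightarrow> ('r, 'n, 'z) module_scheme \<Rightarrow>
    ('r, ('m, 'n) tens) module"
  where "tensor R M N =
    \<lparr>carrier = lists (carrier M \<times> carrier N) // tensor_rel R M N,
     mult = undefined, one = undefined,
     zero = tensor_rel R M N `` {[]},
     add = (\<lambda>X Y. \<Union>xs\<in>X. \<Union>ys\<in>Y. tensor_rel R M N `` {xs @ ys}),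
     smult = (\<lambda>r X. \<Union>xs\<in>X. tensor_rel R M N `` {map (\<lambda>(m, n). (r \<odot>\<^bsub>M\<^esub> m, n)) xs})\<rparr>"

text \<open>\<open>tensor_lift P f\<close> is the additive map \<open>m \<otimes> n \<mapsto> f m n\<close> into \<open>P\<close>, for \<open>f\<close> biadditive and
  balanced, so that the choice of the representing list is immaterial.\<close>

definition tensor_lift :: "('p, 'y) ring_scheme \<Rightarrow> ('m \<Rightarrow> 'n \<Rightarrow> 'p) \<Rightarrow> ('m, 'n) tens \<Rightarrow> 'p"
  where "tensor_lift P f X =
    foldr (\<lambda>(m, n) p. f m n \<oplus>\<^bsub>P\<^esub> p) (SOME xs. xs \<in> X) \<zero>\<^bsub>P\<^esub>"

text \<open>The map \<open>f \<otimes> g\<close> into \<open>M' \<otimes> N'\<close>.\<close>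

definition tensor_map ::
  "('r, 'x) ring_scheme \<Rightarrow> ('r, 'm1, 'y) module_scheme \<Rightarrow> ('r, 'n1, 'z) module_scheme \<Rightarrow>
    ('m \<Rightarrow> 'm1) \<Rightarrow> ('n \<Rightarrow> 'n1) \<Rightarrow> ('m, 'n) tens \<Rightarrow> ('m1, 'n1) tens"
  where "tensor_map R M' N' f g =
    tensor_lift (tensor R M' N') (\<lambda>m n. pure R M' N' (f m) (g n))"

text \<open>The canonical map \<open>(M \<otimes> N) \<otimes> P \<rightarrow> M \<otimes> (N \<otimes> P)\<close>.\<close>

definition tensor_assoc ::
  "('r, 'x) ring_scheme \<Rightarrow> ('r, 'm, 'y) module_scheme \<Rightarrow> ('r, 'n, 'z) module_scheme \<Rightarrow>
    ('r, 'p, 'w) module_scheme \<Rightarrow> (('m, 'n) tens, 'p) tens \<Rightarrow> ('m, ('n, 'p) tens) tens"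
  where "tensor_assoc R M N P =
    (let T = tensor R M (tensor R N P) in
      tensor_lift T (\<lambda>X p. tensor_lift T (\<lambda>m n. pure R M (tensor R N P) m (pure R N P n p)) X))"

text \<open>The tensor product of two algebras, with product \<open>(a \<otimes> h)(b \<otimes> g) = ab \<otimes> hg\<close>.\<close>

definition tensor_alg ::
  "('r, 'x) ring_scheme \<Rightarrow> ('r, 'm) module \<Rightarrow> ('r, 'n) module \<Rightarrow> ('r, ('m, 'n) tens) module"
  where "tensor_alg R M N = (tensor R M N)
    \<lparr>mult := (\<lambda>X Y. tensor_lift (tensor R M N) (\<lambda>a h. tensor_lift (tensor R M N)
        (\<lambda>b g. pure R M N (a \<otimes>\<^bsub>M\<^esub> b) (h \<otimes>\<^bsub>N\<^esub> g)) Y) X),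
     one := pure R M N \<one>\<^bsub>M\<^esub> \<one>\<^bsub>N\<^esub>\<rparr>"


section \<open>Bialgebras, comodule algebras and relative Hopf modules\<close>

definition comodule ::
  "'k ring \<Rightarrow> ('k, 'h) module \<Rightarrow> ('h \<Rightarrow> ('h, 'h) tens) \<Rightarrow> ('h \<Rightarrow> 'k) \<Rightarrow>
    ('k, 'm) module \<Rightarrow> ('m \<Rightarrow> ('m, 'h) tens) \<Rightarrow> bool"
  where "comodule K H \<Delta> \<epsilon> M \<rho> \<longleftrightarrow>
    module K M \<and> \<rho> \<in> mod_hom K M (tensor K M H) \<and>
    (\<forall>m\<in>carrier M.
      tensor_assoc K M H H (tensor_map K (tensor K M H) H \<rho> id (\<rho> m)) =
        tensor_map K M (tensor K H H) id \<Delta> (\<rho> m) \<and>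
      tensor_lift M (\<lambda>m' h. \<epsilon> h \<odot>\<^bsub>M\<^esub> m') (\<rho> m) = m)"

locale comm_bialgebra = H: algebra K H
  for K :: "'k ring" and H :: "('k, 'h) module" +
  fixes \<Delta> :: "'h \<Rightarrow> ('h, 'h) tens" and \<epsilon> :: "'h \<Rightarrow> 'k"
  assumes comult_comodule: "comodule K H \<Delta> \<epsilon> H \<Delta>"
    and counit_left: "h \<in> carrier H \<Longrightarrow> tensor_lift H (\<lambda>h' h''. \<epsilon> h' \<odot>\<^bsub>H\<^esub> h'') (\<Delta> h) = h"
    and comult_ring_hom: "\<Delta> \<in> ring_hom H (tensor_alg K H H)"
    and counit_linear: "\<epsilon> \<in> mod_hom K H (regular K)"
    and counit_ring_hom: "\<epsilon> \<in> ring_hom H K"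

locale comm_comodule_algebra = comm_bialgebra K H \<Delta> \<epsilon> + A: algebra K A
  for K :: "'k ring" and H :: "('k, 'h) module"
    and \<Delta> :: "'h \<Rightarrow> ('h, 'h) tens" and \<epsilon> :: "'h \<Rightarrow> 'k" and A :: "('k, 'a) module" +
  fixes \<rho> :: "'a \<Rightarrow> ('a, 'h) tens"
  assumes coaction_comodule: "comodule K H \<Delta> \<epsilon> A \<rho>"
    and coaction_ring_hom: "\<rho> \<in> ring_hom A (tensor_alg K A H)"

text \<open>The ring \<open>B\<close> of coinvariants of \<open>A\<close>.\<close>

definition coinvariants ::
  "'k ring \<Rightarrow> ('k, 'h) module \<Rightarrow> ('k, 'a) module \<Rightarrow> ('a \<Rightarrow> ('a, 'h) tens) \<Rightarrow> ('k, 'a) module"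
  where "coinvariants K H A \<rho> = A\<lparr>carrier := {a \<in> carrier A. \<rho> a = pure K A H a \<one>\<^bsub>H\<^esub>}\<rparr>"

text \<open>The action of \<open>A \<otimes> H\<close> on \<open>M \<otimes> H\<close>, written with the scalar on the left; as \<open>A\<close> and \<open>H\<close> are
  commutative the compatibility condition below is
  \<open>\<rho>\<^sub>M (m a) = m\<^sub>[\<^sub>0\<^sub>] a\<^sub>[\<^sub>0\<^sub>] \<otimes> m\<^sub>[\<^sub>1\<^sub>] a\<^sub>[\<^sub>1\<^sub>]\<close>.\<close>

definition tensor_act ::
  "'k ring \<Rightarrow> ('k, 'h) module \<Rightarrow> ('k, 'a) module \<Rightarrow> ('a, 'm) module \<Rightarrow>
    ('a, 'h) tens \<Rightarrow> ('m, 'h) tens \<Rightarrow> ('m, 'h) tens"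
  where "tensor_act K H A M X Y =
    (let M\<^sub>K = restrict_scalars A M; T = tensor K M\<^sub>K H in
      tensor_lift T (\<lambda>a g. tensor_lift T (\<lambda>m h. pure K M\<^sub>K H (a \<odot>\<^bsub>M\<^esub> m) (h \<otimes>\<^bsub>H\<^esub> g)) Y) X)"

definition rel_hopf_module ::
  "'k ring \<Rightarrow> ('k, 'h) module \<Rightarrow> ('h \<Rightarrow> ('h, 'h) tens) \<Rightarrow> ('h \<Rightarrow> 'k) \<Rightarrow>
    ('k, 'a) module \<Rightarrow> ('a \<Rightarrow> ('a, 'h) tens) \<Rightarrow>
    ('a, 'm) module \<times> ('m \<Rightarrow> ('m, 'h) tens) \<Rightarrow> bool"
  where "rel_hopf_module K H \<Delta> \<epsilon> A \<rho> = (\<lambda>(M, \<rho>M).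
    module A M \<and> comodule K H \<Delta> \<epsilon> (restrict_scalars A M) \<rho>M \<and>
    (\<forall>a\<in>carrier A. \<forall>m\<in>carrier M. \<rho>M (a \<odot>\<^bsub>M\<^esub> m) = tensor_act K H A M (\<rho> a) (\<rho>M m)))"

definition rel_hopf_iso ::
  "'k ring \<Rightarrow> ('k, 'h) module \<Rightarrow> ('k, 'a) module \<Rightarrow>
    ('a, 'm) module \<times> ('m \<Rightarrow> ('m, 'h) tens) \<Rightarrow>
    ('a, 'n) module \<times> ('n \<Rightarrow> ('n, 'h) tens) \<Rightarrow> ('m \<Rightarrow> 'n) set"
  where "rel_hopf_iso K H A = (\<lambda>(M, \<rho>M) (N, \<rho>N).
    {f \<in> mod_iso A M N. \<forall>m\<in>carrier M.
      \<rho>N (f m) = tensor_map K (restrict_scalars A N) H f id (\<rho>M m)})"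

definition rel_hopf_unit ::
  "('k, 'a) module \<Rightarrow> ('a \<Rightarrow> ('a, 'h) tens) \<Rightarrow> ('a, 'a) module \<times> ('a \<Rightarrow> ('a, 'h) tens)"
  where "rel_hopf_unit A \<rho> = (regular A, \<rho>)"

text \<open>\<open>M \<otimes>\<^sub>A N\<close> with coaction \<open>m \<otimes> n \<mapsto> (m\<^sub>[\<^sub>0\<^sub>] \<otimes> n\<^sub>[\<^sub>0\<^sub>]) \<otimes> m\<^sub>[\<^sub>1\<^sub>] n\<^sub>[\<^sub>1\<^sub>]\<close>.\<close>

definition rel_hopf_tensor ::
  "'k ring \<Rightarrow> ('k, 'h) module \<Rightarrow> ('k, 'a) module \<Rightarrow>
    ('a, 'm) module \<times> ('m \<Rightarrow> ('m, 'h) tens) \<Rightarrow>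
    ('a, 'n) module \<times> ('n \<Rightarrow> ('n, 'h) tens) \<Rightarrow>
    ('a, ('m, 'n) tens) module \<times> (('m, 'n) tens \<Rightarrow> (('m, 'n) tens, 'h) tens)"
  where "rel_hopf_tensor K H A = (\<lambda>(M, \<rho>M) (N, \<rho>N).
    (let P = restrict_scalars A (tensor A M N); T = tensor K P H in
      (tensor A M N,
       tensor_lift T (\<lambda>m n.
         tensor_lift T (\<lambda>m' h. tensor_lift T
           (\<lambda>n' g. pure K P H (pure A M N m' n') (h \<otimes>\<^bsub>H\<^esub> g)) (\<rho>N n)) (\<rho>M m)))))"


section \<open>Picard groups\<close>

text \<open>An invertible module over \<open>R\<close> is finitely generated, hence isomorphic to one whose elements are
  cosets in some \<open>R\<^sup>n\<close>, the vectors being functions \<open>nat \<Rightarrow> 'r\<close> that vanish from \<open>n\<close> on.  Isomorphism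
  classes are therefore formed among modules carried by \<open>'r coset\<close>, without losing any class, while
  the module whose class is taken may live on any type.  The same applies to inverses, and to
  relative Hopf modules, since an invertible one is an invertible \<open>A\<close>-module.\<close>

type_synonym 'r coset = "(nat \<Rightarrow> 'r) set"

definition mod_class ::
  "('r, 'x) ring_scheme \<Rightarrow> ('r, 'm) module \<Rightarrow> ('r, 'r coset) module set"
  where "mod_class R M = {N. module R N \<and> mod_iso R M N \<noteq> {}}"

definition invertible_module :: "('r, 'x) ring_scheme \<Rightarrow> ('r, 'm) module \<Rightarrow> bool"
  where "invertible_module R M \<longleftrightarrow> module R M \<and>
    (\<exists>N :: ('r, 'r coset) module. module R N \<and> mod_iso R (tensor R M N) (regular R) \<noteq> {})"

definition Pic :: "('r, 'x) ring_scheme \<Rightarrow> ('r, 'r coset) module set monoid"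
  where "Pic R =
    \<lparr>carrier = {mod_class R N | N :: ('r, 'r coset) module. invertible_module R N},
     mult = (\<lambda>C D. the_elem {mod_class R (tensor R N N') | N N'. N \<in> C \<and> N' \<in> D}),
     one = mod_class R (regular R)\<rparr>"

type_synonym ('a, 'h) hopf_coset =
  "('a, 'a coset) module \<times> ('a coset \<Rightarrow> ('a coset, 'h) tens)"

definition rel_hopf_class ::
  "'k ring \<Rightarrow> ('k, 'h) module \<Rightarrow> ('h \<Rightarrow> ('h, 'h) tens) \<Rightarrow> ('h \<Rightarrow> 'k) \<Rightarrow>
    ('k, 'a) module \<Rightarrow> ('a \<Rightarrow> ('a, 'h) tens) \<Rightarrow>
    ('a, 'm) module \<times> ('m \<Rightarrow> ('m, 'h) tens) \<Rightarrow> ('a, 'h) hopf_coset set"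
  where "rel_hopf_class K H \<Delta> \<epsilon> A \<rho> M =
    {N. rel_hopf_module K H \<Delta> \<epsilon> A \<rho> N \<and> rel_hopf_iso K H A M N \<noteq> {}}"

definition invertible_rel_hopf ::
  "'k ring \<Rightarrow> ('k, 'h) module \<Rightarrow> ('h \<Rightarrow> ('h, 'h) tens) \<Rightarrow> ('h \<Rightarrow> 'k) \<Rightarrow>
    ('k, 'a) module \<Rightarrow> ('a \<Rightarrow> ('a, 'h) tens) \<Rightarrow>
    ('a, 'm) module \<times> ('m \<Rightarrow> ('m, 'h) tens) \<Rightarrow> bool"
  where "invertible_rel_hopf K H \<Delta> \<epsilon> A \<rho> M \<longleftrightarrow> rel_hopf_module K H \<Delta> \<epsilon> A \<rho> M \<and>
    (\<exists>N :: ('a, 'h) hopf_coset. rel_hopf_module K H \<Delta> \<epsilon> A \<rho> N \<and>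
      rel_hopf_iso K H A (rel_hopf_tensor K H A M N) (rel_hopf_unit A \<rho>) \<noteq> {})"

definition PicH ::
  "'k ring \<Rightarrow> ('k, 'h) module \<Rightarrow> ('h \<Rightarrow> ('h, 'h) tens) \<Rightarrow> ('h \<Rightarrow> 'k) \<Rightarrow>
    ('k, 'a) module \<Rightarrow> ('a \<Rightarrow> ('a, 'h) tens) \<Rightarrow> ('a, 'h) hopf_coset set monoid"
  where "PicH K H \<Delta> \<epsilon> A \<rho> =
    \<lparr>carrier = {rel_hopf_class K H \<Delta> \<epsilon> A \<rho> M | M :: ('a, 'h) hopf_coset.
       invertible_rel_hopf K H \<Delta> \<epsilon> A \<rho> M},
     mult = (\<lambda>C D. the_elem {rel_hopf_class K H \<Delta> \<epsilon> A \<rho> (rel_hopf_tensor K H A M N) | M N.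
       M \<in> C \<and> N \<in> D}),
     one = rel_hopf_class K H \<Delta> \<epsilon> A \<rho> (rel_hopf_unit A \<rho>)\<rparr>"


section \<open>Base change along \<open>B \<subseteq> A\<close>\<close>

text \<open>\<open>N \<otimes>\<^sub>B A\<close> as an \<open>A\<close>-module; \<open>A\<close> is a \<open>B\<close>-module through \<open>regular A\<close>, whose scalar
  multiplication is that of \<open>A\<close>.\<close>

definition base_change ::
  "('k, 'a) module \<Rightarrow> ('k, 'a) module \<Rightarrow> ('a, 'n) module \<Rightarrow> ('a, ('n, 'a) tens) module"
  where "base_change B A N = (tensor B N (regular A))
    \<lparr>smult := (\<lambda>a. tensor_map B N (regular A) id (\<lambda>a'. a \<otimes>\<^bsub>A\<^esub> a'))\<rparr>"

text \<open>The coaction \<open>N \<otimes>\<^sub>B \<rho>\<close>, with \<open>N \<otimes>\<^sub>B (A \<otimes> H)\<close> identified with \<open>(N \<otimes>\<^sub>B A) \<otimes> H\<close>.\<close>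

definition base_change_coaction ::
  "'k ring \<Rightarrow> ('k, 'h) module \<Rightarrow> ('k, 'a) module \<Rightarrow> ('a \<Rightarrow> ('a, 'h) tens) \<Rightarrow>
    ('k, 'a) module \<Rightarrow> ('a, 'n) module \<Rightarrow> ('n, 'a) tens \<Rightarrow> (('n, 'a) tens, 'h) tens"
  where "base_change_coaction K H A \<rho> B N =
    (let P = restrict_scalars A (base_change B A N) in
      tensor_lift (tensor K P H)
        (\<lambda>n a. tensor_map K P H (pure B N (regular A) n) id (\<rho> a)))"

definition pic_j ::
  "'k ring \<Rightarrow> ('k, 'h) module \<Rightarrow> ('h \<Rightarrow> ('h, 'h) tens) \<Rightarrow> ('h \<Rightarrow> 'k) \<Rightarrow>
    ('k, 'a) module \<Rightarrow> ('a \<Rightarrow> ('a, 'h) tens) \<Rightarrow>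
    ('a, 'a coset) module set \<Rightarrow> ('a, 'h) hopf_coset set"
  where "pic_j K H \<Delta> \<epsilon> A \<rho> C =
    (let B = coinvariants K H A \<rho> in
      the_elem ((\<lambda>N. rel_hopf_class K H \<Delta> \<epsilon> A \<rho>
        (base_change B A N, base_change_coaction K H A \<rho> B N)) ` C))"


section \<open>The group \<open>K\<^sub>1\<close> and grouplike elements\<close>

type_synonym ('n, 'a) trivialized = "('a, 'n) module \<times> (('n, 'a) tens \<Rightarrow> 'a)"

definition trivialized_module ::
  "('k, 'a) module \<Rightarrow> ('k, 'a) module \<Rightarrow> ('n, 'a) trivialized \<Rightarrow> bool"
  where "trivialized_module B A = (\<lambda>(N, \<alpha>).
    invertible_module B N \<and> \<alpha> \<in> mod_iso A (base_change B A N) (regular A))"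

definition K1_class ::
  "('k, 'a) module \<Rightarrow> ('k, 'a) module \<Rightarrow> ('n, 'a) trivialized \<Rightarrow> ('a coset, 'a) trivialized set"
  where "K1_class B A = (\<lambda>(N, \<alpha>).
    {(N', \<alpha>'). trivialized_module B A (N', \<alpha>') \<and>
      (\<exists>f\<in>mod_iso B N N'. \<forall>x\<in>carrier (base_change B A N).
        \<alpha> x = \<alpha>' (tensor_map B N' (regular A) f id x))})"

text \<open>The product of \<open>\<alpha>\<close> and \<open>\<beta>\<close> is \<open>\<alpha> \<otimes>\<^sub>A \<beta>\<close> read along the canonical isomorphisms
  \<open>(N \<otimes>\<^sub>B N') \<otimes>\<^sub>B A \<cong> (N \<otimes>\<^sub>B A) \<otimes>\<^sub>A (N' \<otimes>\<^sub>B A)\<close> and \<open>A \<otimes>\<^sub>A A \<cong> A\<close>.\<close>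

definition trivialized_tensor ::
  "('k, 'a) module \<Rightarrow> ('k, 'a) module \<Rightarrow> ('n, 'a) trivialized \<Rightarrow> ('m, 'a) trivialized \<Rightarrow>
    (('n, 'm) tens, 'a) trivialized"
  where "trivialized_tensor B A = (\<lambda>(N, \<alpha>) (N', \<beta>).
    (tensor B N N',
     tensor_lift A (\<lambda>X a. tensor_lift A
       (\<lambda>n n'. \<alpha> (pure B N (regular A) n \<one>\<^bsub>A\<^esub>) \<otimes>\<^bsub>A\<^esub> \<beta> (pure B N' (regular A) n' \<one>\<^bsub>A\<^esub>)) X \<otimes>\<^bsub>A\<^esub> a)))"

definition trivialized_unit :: "('k, 'a) module \<Rightarrow> ('k, 'a) module \<Rightarrow> ('a, 'a) trivialized"
  where "trivialized_unit B A = (regular B, tensor_lift A (\<lambda>b a. b \<otimes>\<^bsub>A\<^esub> a))"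

definition K1 :: "('k, 'a) module \<Rightarrow> ('k, 'a) module \<Rightarrow> ('a coset, 'a) trivialized set monoid"
  where "K1 B A =
    \<lparr>carrier = {K1_class B A p | p :: ('a coset, 'a) trivialized. trivialized_module B A p},
     mult = (\<lambda>C D. the_elem {K1_class B A (trivialized_tensor B A p q) | p q. p \<in> C \<and> q \<in> D}),
     one = K1_class B A (trivialized_unit B A)\<rparr>"

text \<open>The first condition is an equation in \<open>A \<otimes> (H \<otimes> H)\<close>; its right-hand side is the sum of the
  \<open>(X \<rho>(a\<^sub>j)) \<otimes> h\<^sub>j\<close> for \<open>X\<close> the sum of the \<open>a\<^sub>j \<otimes> h\<^sub>j\<close>.\<close>

definition grouplike ::
  "'k ring \<Rightarrow> ('k, 'h) module \<Rightarrow> ('h \<Rightarrow> ('h, 'h) tens) \<Rightarrow> ('h \<Rightarrow> 'k) \<Rightarrow>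
    ('k, 'a) module \<Rightarrow> ('a \<Rightarrow> ('a, 'h) tens) \<Rightarrow> ('a, 'h) tens \<Rightarrow> bool"
  where "grouplike K H \<Delta> \<epsilon> A \<rho> X \<longleftrightarrow> X \<in> carrier (tensor K A H) \<and>
    tensor_map K A (tensor K H H) id \<Delta> X =
      tensor_assoc K A H H
        (tensor_map K (tensor K A H) H (\<lambda>a. X \<otimes>\<^bsub>tensor_alg K A H\<^esub> \<rho> a) id X) \<and>
    tensor_lift A (\<lambda>a h. \<epsilon> h \<odot>\<^bsub>A\<^esub> a) X = \<one>\<^bsub>A\<^esub>"

definition Gi ::
  "'k ring \<Rightarrow> ('k, 'h) module \<Rightarrow> ('h \<Rightarrow> ('h, 'h) tens) \<Rightarrow> ('h \<Rightarrow> 'k) \<Rightarrow>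
    ('k, 'a) module \<Rightarrow> ('a \<Rightarrow> ('a, 'h) tens) \<Rightarrow> ('a, 'h) tens monoid"
  where "Gi K H \<Delta> \<epsilon> A \<rho> =
    \<lparr>carrier = {X \<in> Units (tensor_alg K A H). grouplike K H \<Delta> \<epsilon> A \<rho> X},
     mult = mult (tensor_alg K A H), one = one (tensor_alg K A H)\<rparr>"

text \<open>The value of \<open>k1_i\<close> at the class of \<open>(N, \<alpha>)\<close> is \<open>(\<alpha> \<otimes> H) ((N \<otimes>\<^sub>B \<rho>) (\<alpha>\<inverse> 1))\<close>.\<close>

definition k1_i ::
  "'k ring \<Rightarrow> ('k, 'h) module \<Rightarrow> ('k, 'a) module \<Rightarrow> ('a \<Rightarrow> ('a, 'h) tens) \<Rightarrow>
    ('a coset, 'a) trivialized set \<Rightarrow> ('a, 'h) tens"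
  where "k1_i K H A \<rho> C =
    (let B = coinvariants K H A \<rho> in
      the_elem ((\<lambda>(N, \<alpha>). tensor_map K A H \<alpha> id (base_change_coaction K H A \<rho> B N
        (inv_into (carrier (base_change B A N)) \<alpha> \<one>\<^bsub>A\<^esub>))) ` C))"

end

theory Submission
  imports Defs
begin

text \<open>Let \<open>B\<close> be the ring of coinvariants of \<open>A\<close>.  Both injectivity claims rest on one fact: for an
  invertible \<open>B\<close>-module \<open>N\<close>, the map \<open>n \<mapsto> n \<otimes> 1\<close> identifies \<open>N\<close> with the coinvariants of
  \<open>N \<otimes>\<^sub>B A\<close>.  A colinear \<open>A\<close>-isomorphism \<open>N \<otimes>\<^sub>B A \<rightarrow> N' \<otimes>\<^sub>B A\<close> preserves coinvariants, so
  it is \<open>g \<otimes>\<^sub>B A\<close> for an isomorphism \<open>g : N \<rightarrow> N'\<close> (\<open>descend_iso\<close>).  This gives at once the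
  injectivity of \<open>j\<close>.  It gives that of \<open>i\<close> because \<open>\<alpha> : N \<otimes>\<^sub>B A \<rightarrow> A\<close> is colinear for
  the coaction \<open>a \<mapsto> X \<rho>(a)\<close> on \<open>A\<close>, where \<open>X\<close> is the value of \<open>i\<close>
  (\<open>trivialization_colinear\<close>): two trivializations with the same \<open>X\<close> differ by a colinear isomorphism.

  The description of the coinvariants uses no flatness theory, only a dual basis \<open>(f\<^sub>j, p\<^sub>j)\<close> of \<open>N\<close>
  (\<open>dual_basis_left\<close>).  The functionals \<open>F\<^sub>j = f\<^sub>j \<otimes>\<^sub>B A\<close> are colinear, as the \<open>f\<^sub>j\<close> take values in
  \<open>B\<close>, and \<open>x = \<Sum> p\<^sub>j \<otimes> F\<^sub>j(x)\<close> on \<open>N \<otimes>\<^sub>B A\<close>.  If \<open>x\<close> is coinvariant then \<open>F\<^sub>j(x) \<in> B\<close>, so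
  \<open>x = (\<Sum> F\<^sub>j(x) p\<^sub>j) \<otimes> 1\<close> (\<open>bc_coinvariant\<close>).

  There remain the codomains.  A dual basis also shows that \<open>N \<otimes>\<^sub>B A\<close> is finitely generated, hence
  isomorphic to a module of cosets, and a perfect pairing of \<open>N\<close> with \<open>N'\<close> extends to a colinear one of
  \<open>N \<otimes>\<^sub>B A\<close> with \<open>N' \<otimes>\<^sub>B A\<close> (\<open>bc_pairing\<close>), so \<open>j\<close> takes values in the Picard group of relative
  Hopf modules.  The element \<open>X\<close> is grouplike because this condition is the comodule axioms at \<open>1\<close> for
  the coaction \<open>a \<mapsto> X \<rho>(a)\<close> (\<open>trivialization_is_grouplike\<close>), and the dual basis yields an
  explicit inverse (\<open>grouplike_of_unit\<close>).\<close>

section \<open>Sums over lists and homomorphisms\<close>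

lemma module_abelian_group: "module R M \<Longrightarrow> abelian_group M"
  by (simp add: module_def)

text \<open>Tensors and dual bases are given by lists, in which an entry may occur repeatedly; hence sums over
  lists instead of finite sets.\<close>

definition lsum :: "('g, 'x) ring_scheme \<Rightarrow> ('i \<Rightarrow> 'g) \<Rightarrow> 'i list \<Rightarrow> 'g"
  where "lsum G f xs = foldr (\<lambda>x s. f x \<oplus>\<^bsub>G\<^esub> s) xs \<zero>\<^bsub>G\<^esub>"

lemma lsum_Nil [simp]: "lsum G f [] = \<zero>\<^bsub>G\<^esub>"
  and lsum_Cons [simp]: "lsum G f (x # xs) = f x \<oplus>\<^bsub>G\<^esub> lsum G f xs"
  by (simp_all add: lsum_def)

lemma lsum_closed:
  assumes "abelian_group G" "\<And>x. x \<in> set xs \<Longrightarrow> f x \<in> carrier G"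
  shows "lsum G f xs \<in> carrier G"
proof -
  interpret abelian_group G by fact
  show ?thesis using assms(2) by (induction xs) auto
qed

lemma lsum_append:
  assumes "abelian_group G" "\<And>x. x \<in> set xs \<Longrightarrow> f x \<in> carrier G"
    "\<And>x. x \<in> set ys \<Longrightarrow> f x \<in> carrier G"
  shows "lsum G f (xs @ ys) = lsum G f xs \<oplus>\<^bsub>G\<^esub> lsum G f ys"
proof -
  interpret abelian_group G by fact
  show ?thesis using assms(2,3)
    by (induction xs) (auto simp: lsum_closed[OF assms(1)] a_assoc)
qed

lemma lsum_cong: "(\<And>x. x \<in> set xs \<Longrightarrow> f x = g x) \<Longrightarrow> lsum G f xs = lsum G g xs"
  by (induction xs) auto

lemma lsum_map: "lsum G f (map h xs) = lsum G (\<lambda>x. f (h x)) xs"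
  by (induction xs) auto

text \<open>Pure tensors generate a tensor product additively, so equalities of maps are checked on them for
  maps that need only be additive, whatever ring they are linear over.\<close>

definition additive_maps :: "('m, 'x) ring_scheme \<Rightarrow> ('n, 'y) ring_scheme \<Rightarrow> ('m \<Rightarrow> 'n) set"
  where "additive_maps M N = {f \<in> carrier M \<rightarrow> carrier N.
    \<forall>x\<in>carrier M. \<forall>y\<in>carrier M. f (x \<oplus>\<^bsub>M\<^esub> y) = f x \<oplus>\<^bsub>N\<^esub> f y}"

lemma additive_mapsI:
  assumes "\<And>x. x \<in> carrier M \<Longrightarrow> f x \<in> carrier N"
    "\<And>x y. x \<in> carrier M \<Longrightarrow> y \<in> carrier M \<Longrightarrow> f (x \<oplus>\<^bsub>M\<^esub> y) = f x \<oplus>\<^bsub>N\<^esub> f y"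
  shows "f \<in> additive_maps M N"
  using assms by (auto simp: additive_maps_def)

lemma additive_maps_closed: "f \<in> additive_maps M N \<Longrightarrow> x \<in> carrier M \<Longrightarrow> f x \<in> carrier N"
  and additive_maps_add: "f \<in> additive_maps M N \<Longrightarrow> x \<in> carrier M \<Longrightarrow> y \<in> carrier M \<Longrightarrow>
    f (x \<oplus>\<^bsub>M\<^esub> y) = f x \<oplus>\<^bsub>N\<^esub> f y"
  by (auto simp: additive_maps_def)

lemma additive_maps_zero:
  assumes "f \<in> additive_maps M N" "abelian_group M" "abelian_group N"
  shows "f \<zero>\<^bsub>M\<^esub> = \<zero>\<^bsub>N\<^esub>"
proof -
  interpret M: abelian_group M by fact
  interpret N: abelian_group N by fact
  have "f \<zero>\<^bsub>M\<^esub> \<oplus>\<^bsub>N\<^esub> f \<zero>\<^bsub>M\<^esub> = f \<zero>\<^bsub>M\<^esub>"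
    using additive_maps_add[OF assms(1), of "\<zero>\<^bsub>M\<^esub>" "\<zero>\<^bsub>M\<^esub>"] by simp
  with additive_maps_closed[OF assms(1) M.zero_closed] show ?thesis
    by (metis N.add.r_cancel_one')
qed

lemma additive_maps_lsum:
  assumes "F \<in> additive_maps M N" "abelian_group M" "abelian_group N"
    "\<And>x. x \<in> set xs \<Longrightarrow> f x \<in> carrier M"
  shows "F (lsum M f xs) = lsum N (\<lambda>x. F (f x)) xs"
  using assms(4)
  by (induction xs)
    (auto simp: additive_maps_zero[OF assms(1-3)] additive_maps_add[OF assms(1)] lsum_closed[OF assms(2)])

lemma lsum_add:
  assumes "abelian_group G" "\<And>x. x \<in> set xs \<Longrightarrow> f x \<in> carrier G" "\<And>x. x \<in> set xs \<Longrightarrow> g x \<in> carrier G"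
  shows "lsum G (\<lambda>x. f x \<oplus>\<^bsub>G\<^esub> g x) xs = lsum G f xs \<oplus>\<^bsub>G\<^esub> lsum G g xs"
proof -
  interpret abelian_group G by fact
  show ?thesis using assms(2,3)
    by (induction xs) (simp_all add: lsum_closed[OF assms(1)] a_ac)
qed

lemma lsum_mult:
  assumes "cring R" "\<And>x. x \<in> set xs \<Longrightarrow> f x \<in> carrier R" "\<And>y. y \<in> set ys \<Longrightarrow> g y \<in> carrier R"
  shows "lsum R f xs \<otimes>\<^bsub>R\<^esub> lsum R g ys = lsum R (\<lambda>x. lsum R (\<lambda>y. f x \<otimes>\<^bsub>R\<^esub> g y) ys) xs"
proof -
  interpret cring R by fact
  have g: "lsum R g ys \<in> carrier R" by (rule lsum_closed[OF abelian_group_axioms assms(3)])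
  have 1: "(\<lambda>r. r \<otimes>\<^bsub>R\<^esub> lsum R g ys) \<in> additive_maps R R"
    by (rule additive_mapsI) (simp_all add: g l_distr)
  have 2: "f x \<otimes>\<^bsub>R\<^esub> lsum R g ys = lsum R (\<lambda>y. f x \<otimes>\<^bsub>R\<^esub> g y) ys" if "x \<in> set xs" for x
  proof -
    have "(\<lambda>r. f x \<otimes>\<^bsub>R\<^esub> r) \<in> additive_maps R R"
      by (rule additive_mapsI) (simp_all add: assms(2)[OF that] r_distr)
    from additive_maps_lsum[OF this abelian_group_axioms abelian_group_axioms, of ys g] assms(3)
    show ?thesis by simp
  qed
  from additive_maps_lsum[OF 1 abelian_group_axioms abelian_group_axioms, of xs f] assms(2)
  have "lsum R f xs \<otimes>\<^bsub>R\<^esub> lsum R g ys = lsum R (\<lambda>x. f x \<otimes>\<^bsub>R\<^esub> lsum R g ys) xs" by simp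
  also have "\<dots> = lsum R (\<lambda>x. lsum R (\<lambda>y. f x \<otimes>\<^bsub>R\<^esub> g y) ys) xs"
    by (rule lsum_cong) (rule 2)
  finally show ?thesis .
qed

lemma mod_homI:
  assumes "\<And>x. x \<in> carrier M \<Longrightarrow> f x \<in> carrier N"
    "\<And>x y. x \<in> carrier M \<Longrightarrow> y \<in> carrier M \<Longrightarrow> f (x \<oplus>\<^bsub>M\<^esub> y) = f x \<oplus>\<^bsub>N\<^esub> f y"
    "\<And>r x. r \<in> carrier R \<Longrightarrow> x \<in> carrier M \<Longrightarrow> f (r \<odot>\<^bsub>M\<^esub> x) = r \<odot>\<^bsub>N\<^esub> f x"
  shows "f \<in> mod_hom R M N"
  using assms by (auto simp: mod_hom_def)

lemma mod_hom_closed: "f \<in> mod_hom R M N \<Longrightarrow> x \<in> carrier M \<Longrightarrow> f x \<in> carrier N"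
  and mod_hom_add: "f \<in> mod_hom R M N \<Longrightarrow> x \<in> carrier M \<Longrightarrow> y \<in> carrier M \<Longrightarrow>
    f (x \<oplus>\<^bsub>M\<^esub> y) = f x \<oplus>\<^bsub>N\<^esub> f y"
  and mod_hom_smult: "f \<in> mod_hom R M N \<Longrightarrow> r \<in> carrier R \<Longrightarrow> x \<in> carrier M \<Longrightarrow>
    f (r \<odot>\<^bsub>M\<^esub> x) = r \<odot>\<^bsub>N\<^esub> f x"
  by (auto simp: mod_hom_def)

lemmas mod_hom_simps = mod_hom_closed mod_hom_add mod_hom_smult

lemma mod_hom_additive: "f \<in> mod_hom R M N \<Longrightarrow> f \<in> additive_maps M N"
  by (auto simp: mod_hom_def additive_maps_def)

lemma mod_hom_id: "id \<in> mod_hom R M M"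
  by (auto simp: mod_hom_def)

lemma mod_hom_comp: "f \<in> mod_hom R M N \<Longrightarrow> g \<in> mod_hom R N P \<Longrightarrow> g \<circ> f \<in> mod_hom R M P"
  by (auto simp: mod_hom_def Pi_def)

lemma mod_iso_hom: "f \<in> mod_iso R M N \<Longrightarrow> f \<in> mod_hom R M N"
  by (simp add: mod_iso_def)

lemma mod_iso_bij: "f \<in> mod_iso R M N \<Longrightarrow> bij_betw f (carrier M) (carrier N)"
  by (simp add: mod_iso_def)

lemma mod_iso_id: "id \<in> mod_iso R M M"
  by (simp add: mod_iso_def mod_hom_id)

lemma mod_iso_comp: "f \<in> mod_iso R M N \<Longrightarrow> g \<in> mod_iso R N P \<Longrightarrow> g \<circ> f \<in> mod_iso R M P"
  by (auto simp: mod_iso_def mod_hom_comp intro: bij_betw_trans)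

lemma mod_iso_inv_closed: "f \<in> mod_iso R M N \<Longrightarrow> y \<in> carrier N \<Longrightarrow> inv_into (carrier M) f y \<in> carrier M"
  by (metis bij_betw_imp_surj_on inv_into_into mod_iso_bij)

lemma mod_iso_inv_right: "f \<in> mod_iso R M N \<Longrightarrow> y \<in> carrier N \<Longrightarrow> f (inv_into (carrier M) f y) = y"
  by (metis bij_betw_inv_into_right mod_iso_bij)

lemma mod_iso_inv_left: "f \<in> mod_iso R M N \<Longrightarrow> x \<in> carrier M \<Longrightarrow> inv_into (carrier M) f (f x) = x"
  by (metis bij_betw_inv_into_left mod_iso_bij)

lemma mod_iso_inv:
  assumes "f \<in> mod_iso R M N" "module R M"
  shows "inv_into (carrier M) f \<in> mod_iso R N M"
proof -
  interpret module R M by fact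
  let ?g = "inv_into (carrier M) f"
  have f: "f \<in> mod_hom R M N" using assms by (simp add: mod_iso_hom)
  note g = mod_iso_inv_closed[OF assms(1)] mod_iso_inv_right[OF assms(1)]
  have "?g \<in> mod_hom R N M"
  proof (rule mod_homI)
    fix x y assume xy: "x \<in> carrier N" "y \<in> carrier N"
    have "?g (x \<oplus>\<^bsub>N\<^esub> y) = ?g (f (?g x \<oplus>\<^bsub>M\<^esub> ?g y))"
      using xy g by (simp add: mod_hom_add[OF f])
    thus "?g (x \<oplus>\<^bsub>N\<^esub> y) = ?g x \<oplus>\<^bsub>M\<^esub> ?g y"
      using xy g mod_iso_inv_left[OF assms(1)] by simp
  next
    fix r x assume xy: "r \<in> carrier R" "x \<in> carrier N"
    have "?g (r \<odot>\<^bsub>N\<^esub> x) = ?g (f (r \<odot>\<^bsub>M\<^esub> ?g x))"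
      using xy g by (simp add: mod_hom_smult[OF f])
    thus "?g (r \<odot>\<^bsub>N\<^esub> x) = r \<odot>\<^bsub>M\<^esub> ?g x"
      using xy g mod_iso_inv_left[OF assms(1)] by simp
  qed (use g in auto)
  thus ?thesis
    using bij_betw_inv_into[OF mod_iso_bij[OF assms(1)]] by (simp add: mod_iso_def)
qed

lemma mod_isoI:
  assumes "f \<in> mod_hom R M N" "g \<in> carrier N \<rightarrow> carrier M"
    "\<And>x. x \<in> carrier M \<Longrightarrow> g (f x) = x" "\<And>y. y \<in> carrier N \<Longrightarrow> f (g y) = y"
  shows "f \<in> mod_iso R M N"
  using assms unfolding mod_iso_def
  by (auto simp: mod_hom_def intro!: bij_betw_byWitness[where f' = g])

lemma mod_class_eq:
  assumes "module R M" "g \<in> mod_iso R M N"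
  shows "mod_class R M = mod_class R N"
  using mod_iso_comp[OF assms(2)] mod_iso_comp[OF mod_iso_inv[OF assms(2,1)]]
  unfolding mod_class_def by blast

section \<open>The tensor product of modules\<close>

abbreviation tensor_words where "tensor_words M N \<equiv> lists (carrier M \<times> carrier N)"

lemma tensor_rel_lists:
  assumes "module R M" "module R N" "(xs, ys) \<in> tensor_rel R M N"
  shows "xs \<in> tensor_words M N \<and> ys \<in> tensor_words M N"
proof -
  interpret M: module R M by fact
  interpret N: module R N by fact
  show ?thesis using assms(3) by induction auto
qed

lemma tensor_rel_equiv:
  assumes "module R M" "module R N"
  shows "equiv (tensor_words M N) (tensor_rel R M N)"
  using tensor_rel_lists[OF assms]
  by (auto intro!: equivI refl_onI symI transI tensor_rel.refl
      intro: tensor_rel.sym tensor_rel.trans)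

definition tensor_class where
  "tensor_class R M N xs = tensor_rel R M N `` {xs}"

lemma pure_class: "pure R M N m n = tensor_class R M N [(m, n)]"
  by (simp add: pure_def tensor_class_def)

lemma tensor_zero_class: "\<zero>\<^bsub>tensor R M N\<^esub> = tensor_class R M N []"
  by (simp add: tensor_def tensor_class_def)

lemma tensor_carrier_class:
  "carrier (tensor R M N) = tensor_class R M N ` tensor_words M N"
  by (auto simp: tensor_def tensor_class_def quotient_def)

lemma tensor_repE:
  assumes "x \<in> carrier (tensor R M N)"
  obtains xs where "xs \<in> tensor_words M N" "x = tensor_class R M N xs"
  using assms by (auto simp: tensor_carrier_class simp del: in_lists_conv_set)

lemma tensor_class_closed:
  "xs \<in> tensor_words M N \<Longrightarrow> tensor_class R M N xs \<in> carrier (tensor R M N)"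
  by (simp add: tensor_carrier_class)

lemma tensor_class_eq_iff:
  assumes "module R M" "module R N"
    "xs \<in> tensor_words M N" "ys \<in> tensor_words M N"
  shows "tensor_class R M N xs = tensor_class R M N ys \<longleftrightarrow> (xs, ys) \<in> tensor_rel R M N"
  using eq_equiv_class_iff[OF tensor_rel_equiv] assms by (simp add: tensor_class_def)

lemma tensor_add_class:
  assumes "module R M" "module R N"
    "xs \<in> tensor_words M N" "ys \<in> tensor_words M N"
  shows "tensor_class R M N xs \<oplus>\<^bsub>tensor R M N\<^esub> tensor_class R M N ys = tensor_class R M N (xs @ ys)"
proof -
  note eq = tensor_rel_equiv[OF assms(1,2)]
  have "congruent2 (tensor_rel R M N) (tensor_rel R M N) (\<lambda>xs ys. tensor_rel R M N `` {xs @ ys})"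
    by (rule congruent2I') (auto intro!: equiv_class_eq[OF eq] tensor_rel.append)
  from UN_equiv_class2[OF eq eq this assms(3,4)] show ?thesis
    by (simp add: tensor_def tensor_class_def)
qed

lemma tensor_smult_rel:
  assumes "module R M" "module R N" "r \<in> carrier R" "(xs, ys) \<in> tensor_rel R M N"
  shows "(map (\<lambda>(m, n). (r \<odot>\<^bsub>M\<^esub> m, n)) xs, map (\<lambda>(m, n). (r \<odot>\<^bsub>M\<^esub> m, n)) ys) \<in> tensor_rel R M N"
proof -
  interpret M: module R M by fact
  interpret N: module R N by fact
  have l: "map (\<lambda>(m, n). (r \<odot>\<^bsub>M\<^esub> m, n)) xs \<in> tensor_words M N"
    if "xs \<in> tensor_words M N" for xs
    using that assms(3) by (induction xs) auto
  show ?thesis using assms(4)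
  proof induction
    case (balanced s m n)
    have "r \<odot>\<^bsub>M\<^esub> (s \<odot>\<^bsub>M\<^esub> m) = s \<odot>\<^bsub>M\<^esub> (r \<odot>\<^bsub>M\<^esub> m)"
      using balanced assms(3) by (metis M.smult_assoc1 M.m_comm)
    then show ?case using balanced assms(3) by (simp add: tensor_rel.balanced)
  next
    case (refl xs)
    then show ?case using l by (blast intro: tensor_rel.refl)
  next
    case (sym xs ys)
    then show ?case by (blast intro: tensor_rel.sym)
  next
    case (trans xs ys zs)
    then show ?case by (blast intro: tensor_rel.trans)
  next
    case (append xs ys us vs)
    then show ?case by (simp add: tensor_rel.append)
  next
    case (commute xs ys)
    then show ?case using l by (simp add: tensor_rel.commute)
  qed (use assms(3) in \<open>auto simp: M.smult_r_distr intro: tensor_rel.intros\<close>)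
qed

lemma tensor_smult_class:
  assumes "module R M" "module R N" "r \<in> carrier R" "xs \<in> tensor_words M N"
  shows "r \<odot>\<^bsub>tensor R M N\<^esub> tensor_class R M N xs =
    tensor_class R M N (map (\<lambda>(m, n). (r \<odot>\<^bsub>M\<^esub> m, n)) xs)"
proof -
  note eq = tensor_rel_equiv[OF assms(1,2)]
  have "congruent (tensor_rel R M N) (\<lambda>xs. tensor_rel R M N `` {map (\<lambda>(m, n). (r \<odot>\<^bsub>M\<^esub> m, n)) xs})"
    by (rule congruentI) (auto intro!: equiv_class_eq[OF eq] tensor_smult_rel assms)
  from UN_equiv_class[OF eq this assms(4)] show ?thesis
    by (simp add: tensor_def tensor_class_def)
qed

lemma pure_closed:
  "m \<in> carrier M \<Longrightarrow> n \<in> carrier N \<Longrightarrow> pure R M N m n \<in> carrier (tensor R M N)"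
  by (simp add: pure_class tensor_class_closed)

lemma pure_add_left:
  assumes "module R M" "module R N" "m \<in> carrier M" "m' \<in> carrier M" "n \<in> carrier N"
  shows "pure R M N (m \<oplus>\<^bsub>M\<^esub> m') n = pure R M N m n \<oplus>\<^bsub>tensor R M N\<^esub> pure R M N m' n"
proof -
  interpret M: module R M by fact
  show ?thesis using assms
    by (simp add: pure_class tensor_add_class tensor_class_eq_iff tensor_rel.add_left)
qed

lemma pure_add_right:
  assumes "module R M" "module R N" "m \<in> carrier M" "n \<in> carrier N" "n' \<in> carrier N"
  shows "pure R M N m (n \<oplus>\<^bsub>N\<^esub> n') = pure R M N m n \<oplus>\<^bsub>tensor R M N\<^esub> pure R M N m n'"
proof -
  interpret N: module R N by fact
  show ?thesis using assms
    by (simp add: pure_class tensor_add_class tensor_class_eq_iff tensor_rel.add_right)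
qed

lemma pure_balanced:
  assumes "module R M" "module R N" "r \<in> carrier R" "m \<in> carrier M" "n \<in> carrier N"
  shows "pure R M N (r \<odot>\<^bsub>M\<^esub> m) n = pure R M N m (r \<odot>\<^bsub>N\<^esub> n)"
proof -
  interpret M: module R M by fact
  interpret N: module R N by fact
  show ?thesis using assms
    by (simp add: pure_class tensor_class_eq_iff tensor_rel.balanced)
qed

lemma pure_smult:
  assumes "module R M" "module R N" "r \<in> carrier R" "m \<in> carrier M" "n \<in> carrier N"
  shows "r \<odot>\<^bsub>tensor R M N\<^esub> pure R M N m n = pure R M N (r \<odot>\<^bsub>M\<^esub> m) n"
  using assms by (simp add: pure_class tensor_smult_class)

lemma pure_zero_left:
  assumes "module R M" "module R N" "n \<in> carrier N"
  shows "pure R M N \<zero>\<^bsub>M\<^esub> n = \<zero>\<^bsub>tensor R M N\<^esub>"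
proof -
  interpret M: module R M by fact
  show ?thesis using assms
    by (simp add: pure_class tensor_zero_class tensor_class_eq_iff tensor_rel.zero)
qed

text \<open>The zero tensor is \<open>0 \<otimes> 0\<close>, so it needs no case of its own.\<close>

lemma tensor_induct [consumes 3, case_names pure add]:
  assumes "module R M" "module R N" "x \<in> carrier (tensor R M N)"
    and pure: "\<And>m n. m \<in> carrier M \<Longrightarrow> n \<in> carrier N \<Longrightarrow> P (pure R M N m n)"
    and add: "\<And>x y. x \<in> carrier (tensor R M N) \<Longrightarrow> y \<in> carrier (tensor R M N) \<Longrightarrow>
      P x \<Longrightarrow> P y \<Longrightarrow> P (x \<oplus>\<^bsub>tensor R M N\<^esub> y)"
  shows "P x"
proof -
  interpret M: module R M by fact
  interpret N: module R N by fact
  have "P (tensor_class R M N xs)" if "xs \<in> tensor_words M N" for xs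
    using that
  proof (induction xs)
    case Nil
    have "P (pure R M N \<zero>\<^bsub>M\<^esub> \<zero>\<^bsub>N\<^esub>)" by (rule pure) auto
    then show ?case by (simp add: pure_zero_left[OF assms(1,2)] tensor_zero_class)
  next
    case (Cons p xs)
    obtain m n where p: "p = (m, n)" by (cases p)
    have "P (pure R M N m n \<oplus>\<^bsub>tensor R M N\<^esub> tensor_class R M N xs)"
      using Cons p by (intro add pure) (auto simp: tensor_class_closed pure_closed)
    then show ?case
      using Cons p by (simp add: pure_class tensor_add_class[OF assms(1,2)])
  qed
  with assms(3) show ?thesis by (auto simp: tensor_carrier_class)
qed

lemma tensor_add_closed:
  assumes "module R M" "module R N" "x \<in> carrier (tensor R M N)" "y \<in> carrier (tensor R M N)"
  shows "x \<oplus>\<^bsub>tensor R M N\<^esub> y \<in> carrier (tensor R M N)"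
proof -
  from assms(3,4) obtain xs ys where "xs \<in> tensor_words M N" "x = tensor_class R M N xs"
    "ys \<in> tensor_words M N" "y = tensor_class R M N ys"
    by (metis tensor_repE)
  thus ?thesis by (auto simp: tensor_add_class[OF assms(1,2)] intro!: tensor_class_closed)
qed

lemma tensor_smult_closed:
  assumes "module R M" "module R N" "r \<in> carrier R" "x \<in> carrier (tensor R M N)"
  shows "r \<odot>\<^bsub>tensor R M N\<^esub> x \<in> carrier (tensor R M N)"
proof -
  interpret M: module R M by fact
  have "map (\<lambda>(m, n). (r \<odot>\<^bsub>M\<^esub> m, n)) xs \<in> tensor_words M N"
    if "xs \<in> tensor_words M N" for xs
    using that assms(3) by (induction xs) auto
  moreover from assms(4) obtain xs where "xs \<in> tensor_words M N" "x = tensor_class R M N xs"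
    by (metis tensor_repE)
  ultimately show ?thesis
    by (simp add: tensor_smult_class[OF assms(1-3)] tensor_class_closed del: in_lists_conv_set)
qed

lemma tensor_smult_add:
  assumes "module R M" "module R N" "r \<in> carrier R" "x \<in> carrier (tensor R M N)" "y \<in> carrier (tensor R M N)"
  shows "r \<odot>\<^bsub>tensor R M N\<^esub> (x \<oplus>\<^bsub>tensor R M N\<^esub> y) =
    r \<odot>\<^bsub>tensor R M N\<^esub> x \<oplus>\<^bsub>tensor R M N\<^esub> r \<odot>\<^bsub>tensor R M N\<^esub> y"
proof -
  interpret M: module R M by fact
  have *: "map (\<lambda>(m, n). (r \<odot>\<^bsub>M\<^esub> m, n)) xs \<in> tensor_words M N"
    if "xs \<in> tensor_words M N" for xs
    using that assms(3) by (induction xs) auto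
  obtain xs ys where "xs \<in> tensor_words M N" "x = tensor_class R M N xs"
    "ys \<in> tensor_words M N" "y = tensor_class R M N ys"
    using assms(4,5) by (auto simp: tensor_carrier_class simp del: in_lists_conv_set)
  thus ?thesis
    using * by (simp add: tensor_add_class[OF assms(1,2)] tensor_smult_class[OF assms(1-3)] del: in_lists_conv_set)
qed

text \<open>Negatives come from \<open>((- m) \<otimes> n) + (m \<otimes> n) = 0 \<otimes> n = 0\<close>, extended to sums.\<close>

lemma tensor_abelian_group:
  assumes "module R M" "module R N"
  shows "abelian_group (tensor R M N)"
proof -
  interpret M: module R M by fact
  interpret N: module R N by fact
  let ?T = "tensor R M N"
  note cl = tensor_add_closed[OF assms] pure_closed[of _ M _ N R]
  have assoc: "x \<oplus>\<^bsub>?T\<^esub> y \<oplus>\<^bsub>?T\<^esub> z = x \<oplus>\<^bsub>?T\<^esub> (y \<oplus>\<^bsub>?T\<^esub> z)"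
    if xyz: "x \<in> carrier ?T" "y \<in> carrier ?T" "z \<in> carrier ?T" for x y z
  proof -
    obtain xs where "xs \<in> tensor_words M N" "x = tensor_class R M N xs"
      using xyz(1) by (rule tensor_repE)
    moreover obtain ys where "ys \<in> tensor_words M N" "y = tensor_class R M N ys"
      using xyz(2) by (rule tensor_repE)
    moreover obtain zs where "zs \<in> tensor_words M N" "z = tensor_class R M N zs"
      using xyz(3) by (rule tensor_repE)
    ultimately show ?thesis
      by (simp add: tensor_add_class[OF assms] append_in_lists_conv del: in_lists_conv_set)
  qed
  have comm: "x \<oplus>\<^bsub>?T\<^esub> y = y \<oplus>\<^bsub>?T\<^esub> x" if xy: "x \<in> carrier ?T" "y \<in> carrier ?T" for x y
  proof -
    obtain xs where "xs \<in> tensor_words M N" "x = tensor_class R M N xs"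
      using xy(1) by (rule tensor_repE)
    moreover obtain ys where "ys \<in> tensor_words M N" "y = tensor_class R M N ys"
      using xy(2) by (rule tensor_repE)
    ultimately show ?thesis
      by (simp add: tensor_add_class[OF assms] tensor_class_eq_iff[OF assms] append_in_lists_conv tensor_rel.commute
          del: in_lists_conv_set)
  qed
  have zero: "\<zero>\<^bsub>?T\<^esub> \<oplus>\<^bsub>?T\<^esub> x = x" if "x \<in> carrier ?T" for x
    by (rule tensor_repE[OF that])
      (simp add: tensor_zero_class tensor_add_class[OF assms] del: in_lists_conv_set)
  have zcl: "\<zero>\<^bsub>?T\<^esub> \<in> carrier ?T"
    by (simp add: tensor_zero_class tensor_class_closed)
  have inv: "\<exists>y\<in>carrier ?T. y \<oplus>\<^bsub>?T\<^esub> x = \<zero>\<^bsub>?T\<^esub>" if "x \<in> carrier ?T" for x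
    using assms that
  proof (induction rule: tensor_induct)
    case (pure m n)
    then show ?case
      by (intro bexI[of _ "pure R M N (\<ominus>\<^bsub>M\<^esub> m) n"])
        (simp_all add: pure_closed pure_add_left[OF assms, symmetric] M.M.l_neg pure_zero_left[OF assms])
  next
    case (add x y)
    then obtain x' y' where "x' \<in> carrier ?T" "x' \<oplus>\<^bsub>?T\<^esub> x = \<zero>\<^bsub>?T\<^esub>" "y' \<in> carrier ?T" "y' \<oplus>\<^bsub>?T\<^esub> y = \<zero>\<^bsub>?T\<^esub>"
      by blast
    note xy = this
    have "y' \<oplus>\<^bsub>?T\<^esub> x' \<oplus>\<^bsub>?T\<^esub> (x \<oplus>\<^bsub>?T\<^esub> y) = y' \<oplus>\<^bsub>?T\<^esub> (x' \<oplus>\<^bsub>?T\<^esub> x \<oplus>\<^bsub>?T\<^esub> y)"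
      using xy add.hyps by (metis assoc cl(1))
    also have "\<dots> = \<zero>\<^bsub>?T\<^esub>"
      using xy add.hyps by (simp add: zero)
    finally show ?case using xy cl by blast
  qed
  show ?thesis
    by (rule abelian_groupI) (fact cl(1) zcl assoc comm zero inv)+
qed

lemma tensor_module:
  assumes "module R M" "module R N"
  shows "module R (tensor R M N)"
proof -
  interpret M: module R M by fact
  interpret N: module R N by fact
  interpret T: abelian_group "tensor R M N" by (rule tensor_abelian_group[OF assms])
  note t = tensor_smult_closed[OF assms] tensor_smult_add[OF assms] pure_smult[OF assms]
    pure_add_left[OF assms]
  show ?thesis
  proof (rule moduleI)
    fix a b x assume a: "a \<in> carrier R" "b \<in> carrier R" and x: "x \<in> carrier (tensor R M N)"
    show "(a \<oplus>\<^bsub>R\<^esub> b) \<odot>\<^bsub>tensor R M N\<^esub> x = a \<odot>\<^bsub>tensor R M N\<^esub> x \<oplus>\<^bsub>tensor R M N\<^esub> b \<odot>\<^bsub>tensor R M N\<^esub> x"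
      using assms x
      by (induction rule: tensor_induct) (use a in \<open>simp_all add: t M.smult_l_distr T.a_ac\<close>)
    show "(a \<otimes>\<^bsub>R\<^esub> b) \<odot>\<^bsub>tensor R M N\<^esub> x = a \<odot>\<^bsub>tensor R M N\<^esub> (b \<odot>\<^bsub>tensor R M N\<^esub> x)"
      using assms x
      by (induction rule: tensor_induct) (use a in \<open>simp_all add: t M.smult_assoc1\<close>)
  next
    fix x assume x: "x \<in> carrier (tensor R M N)"
    show "\<one>\<^bsub>R\<^esub> \<odot>\<^bsub>tensor R M N\<^esub> x = x"
      using assms x by (induction rule: tensor_induct) (simp_all add: t)
  qed (simp_all add: t M.R.cring_axioms T.abelian_group_axioms M.is_cring)
qed

lemma tensor_class_lsum:
  assumes "module R M" "module R N" "xs \<in> tensor_words M N"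
  shows "tensor_class R M N xs = lsum (tensor R M N) (\<lambda>(m, n). pure R M N m n) xs"
  using assms(3)
proof (induction xs)
  case Nil
  then show ?case by (simp add: tensor_zero_class)
next
  case (Cons p xs)
  then show ?case
    using tensor_add_class[OF assms(1,2), of "[p]" xs]
    by (auto simp: pure_class split: prod.splits)
qed

subsection \<open>Maps out of a tensor product\<close>

definition balanced_map ::
  "('r, 'x) ring_scheme \<Rightarrow> ('r, 'm, 'y) module_scheme \<Rightarrow> ('r, 'n, 'z) module_scheme \<Rightarrow>
    ('p, 'w) ring_scheme \<Rightarrow> ('m \<Rightarrow> 'n \<Rightarrow> 'p) \<Rightarrow> bool"
  where "balanced_map R M N P f \<longleftrightarrow>
    (\<forall>m\<in>carrier M. \<forall>n\<in>carrier N. f m n \<in> carrier P) \<and>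
    (\<forall>m\<in>carrier M. \<forall>m'\<in>carrier M. \<forall>n\<in>carrier N. f (m \<oplus>\<^bsub>M\<^esub> m') n = f m n \<oplus>\<^bsub>P\<^esub> f m' n) \<and>
    (\<forall>m\<in>carrier M. \<forall>n\<in>carrier N. \<forall>n'\<in>carrier N. f m (n \<oplus>\<^bsub>N\<^esub> n') = f m n \<oplus>\<^bsub>P\<^esub> f m n') \<and>
    (\<forall>r\<in>carrier R. \<forall>m\<in>carrier M. \<forall>n\<in>carrier N. f (r \<odot>\<^bsub>M\<^esub> m) n = f m (r \<odot>\<^bsub>N\<^esub> n))"

lemma balanced_mapI:
  assumes "\<And>m n. m \<in> carrier M \<Longrightarrow> n \<in> carrier N \<Longrightarrow> f m n \<in> carrier P"
    "\<And>m m' n. m \<in> carrier M \<Longrightarrow> m' \<in> carrier M \<Longrightarrow> n \<in> carrier N \<Longrightarrow>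
      f (m \<oplus>\<^bsub>M\<^esub> m') n = f m n \<oplus>\<^bsub>P\<^esub> f m' n"
    "\<And>m n n'. m \<in> carrier M \<Longrightarrow> n \<in> carrier N \<Longrightarrow> n' \<in> carrier N \<Longrightarrow>
      f m (n \<oplus>\<^bsub>N\<^esub> n') = f m n \<oplus>\<^bsub>P\<^esub> f m n'"
    "\<And>r m n. r \<in> carrier R \<Longrightarrow> m \<in> carrier M \<Longrightarrow> n \<in> carrier N \<Longrightarrow>
      f (r \<odot>\<^bsub>M\<^esub> m) n = f m (r \<odot>\<^bsub>N\<^esub> n)"
  shows "balanced_map R M N P f"
  using assms by (simp add: balanced_map_def)

lemma tensor_lift_lsum:
  "tensor_lift P f X = lsum P (\<lambda>(m, n). f m n) (SOME xs. xs \<in> X)"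
  unfolding tensor_lift_def lsum_def
  by (rule arg_cong2[where f = "\<lambda>g xs. foldr g xs \<zero>\<^bsub>P\<^esub>"]) (auto simp: fun_eq_iff)

lemma tensor_some_rep:
  assumes "module R M" "module R N" "X \<in> carrier (tensor R M N)"
  shows "(SOME xs. xs \<in> X) \<in> X" "(SOME xs. xs \<in> X) \<in> tensor_words M N"
proof -
  obtain xs where xs: "xs \<in> tensor_words M N" "X = tensor_class R M N xs"
    using assms(3) by (auto simp: tensor_carrier_class simp del: in_lists_conv_set)
  hence "xs \<in> X" by (auto simp: tensor_class_def intro: tensor_rel.refl)
  thus *: "(SOME xs. xs \<in> X) \<in> X" by (rule someI)
  thus "(SOME xs. xs \<in> X) \<in> tensor_words M N"
    using xs tensor_rel_lists[OF assms(1,2)] by (auto simp: tensor_class_def)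
qed

lemma tensor_lift_cong:
  assumes "module R M" "module R N" "X \<in> carrier (tensor R M N)"
    "\<And>m n. m \<in> carrier M \<Longrightarrow> n \<in> carrier N \<Longrightarrow> f m n = g m n"
  shows "tensor_lift P f X = tensor_lift P g X"
  unfolding tensor_lift_lsum
  by (rule lsum_cong) (use tensor_some_rep(2)[OF assms(1-3)] assms(4) in auto)

text \<open>Each generator of the congruence is respected by the sum of a balanced map; this is what makes
  \<open>tensor_lift\<close> independent of the representing list.\<close>

lemma lsum_tensor_rel:
  assumes "module R M" "module R N" "abelian_group P" "balanced_map R M N P f"
    "(xs, ys) \<in> tensor_rel R M N"
  shows "lsum P (\<lambda>(m, n). f m n) xs = lsum P (\<lambda>(m, n). f m n) ys"
proof -
  interpret M: module R M by fact
  interpret N: module R N by fact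
  interpret P: abelian_group P by fact
  note b = assms(4)[unfolded balanced_map_def]
  have c: "lsum P (\<lambda>(m, n). f m n) xs \<in> carrier P"
    and c': "\<And>x. x \<in> set xs \<Longrightarrow> (\<lambda>(m, n). f m n) x \<in> carrier P"
    if "xs \<in> tensor_words M N" for xs
    using that b by (auto intro!: lsum_closed[OF assms(3)])
  have ap: "lsum P (\<lambda>(m, n). f m n) (xs @ ys) = lsum P (\<lambda>(m, n). f m n) xs \<oplus>\<^bsub>P\<^esub> lsum P (\<lambda>(m, n). f m n) ys"
    if "xs \<in> tensor_words M N" "ys \<in> tensor_words M N" for xs ys
    by (rule lsum_append[OF assms(3)]) (use c' that in blast)+
  show ?thesis using assms(5)
  proof induction
    case (append xs ys us vs)
    then show ?case
      using tensor_rel_lists[OF assms(1,2) append.hyps(1)] tensor_rel_lists[OF assms(1,2) append.hyps(2)]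
      by (simp add: ap del: in_lists_conv_set)
  next
    case (commute xs ys)
    then show ?case by (simp add: ap c P.a_comm del: in_lists_conv_set)
  next
    case (zero n)
    have "(\<lambda>m. f m n) \<in> additive_maps M P"
      using b zero by (intro additive_mapsI) auto
    from additive_maps_zero[OF this M.abelian_group_axioms assms(3)] show ?case by simp
  next
    case (balanced r m n)
    then show ?case using b by simp
  next
    case (add_left m m' n)
    then show ?case using b by (simp add: P.a_assoc)
  next
    case (add_right m n n')
    then show ?case using b by (simp add: P.a_assoc)
  qed simp_all
qed

lemma tensor_lift_class:
  assumes "module R M" "module R N" "abelian_group P" "balanced_map R M N P f"
    "xs \<in> tensor_words M N"
  shows "tensor_lift P f (tensor_class R M N xs) = lsum P (\<lambda>(m, n). f m n) xs"
proof -
  have "(SOME ys. ys \<in> tensor_class R M N xs) \<in> tensor_class R M N xs"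
    by (rule tensor_some_rep[OF assms(1,2) tensor_class_closed[OF assms(5)]])
  hence "(xs, SOME ys. ys \<in> tensor_class R M N xs) \<in> tensor_rel R M N"
    by (simp add: tensor_class_def)
  from lsum_tensor_rel[OF assms(1-4) this] show ?thesis
    by (simp add: tensor_lift_lsum)
qed

lemma tensor_lift_pure:
  assumes "module R M" "module R N" "abelian_group P" "balanced_map R M N P f"
    "m \<in> carrier M" "n \<in> carrier N"
  shows "tensor_lift P f (pure R M N m n) = f m n"
proof -
  interpret P: abelian_group P by fact
  have "f m n \<in> carrier P" using assms(4-6) by (simp add: balanced_map_def)
  thus ?thesis
    using tensor_lift_class[OF assms(1-4), of "[(m, n)]"] assms(5,6) by (simp add: pure_class)
qed

lemma tensor_lift_additive:
  assumes "module R M" "module R N" "abelian_group P" "balanced_map R M N P f"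
  shows "tensor_lift P f \<in> additive_maps (tensor R M N) P"
proof (rule additive_mapsI)
  note c = tensor_lift_class[OF assms]
  have cl: "(\<lambda>(m, n). f m n) x \<in> carrier P" if "x \<in> carrier M \<times> carrier N" for x
    using that assms(4) by (auto simp: balanced_map_def)
  have ls: "lsum P (\<lambda>(m, n). f m n) xs \<in> carrier P" if "xs \<in> tensor_words M N" for xs
    by (rule lsum_closed[OF assms(3)], rule cl) (use that in auto)
  fix x assume "x \<in> carrier (tensor R M N)"
  then obtain xs where xs: "xs \<in> tensor_words M N" "x = tensor_class R M N xs"
    by (rule tensor_repE)
  show "tensor_lift P f x \<in> carrier P"
    using xs ls by (simp add: c del: in_lists_conv_set)
  fix y assume "y \<in> carrier (tensor R M N)"
  then obtain ys where ys: "ys \<in> tensor_words M N" "y = tensor_class R M N ys"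
    by (rule tensor_repE)
  have "lsum P (\<lambda>(m, n). f m n) (xs @ ys) = lsum P (\<lambda>(m, n). f m n) xs \<oplus>\<^bsub>P\<^esub> lsum P (\<lambda>(m, n). f m n) ys"
    by (rule lsum_append[OF assms(3)]; rule cl) (use xs ys in auto)
  thus "tensor_lift P f (x \<oplus>\<^bsub>tensor R M N\<^esub> y) = tensor_lift P f x \<oplus>\<^bsub>P\<^esub> tensor_lift P f y"
    using xs ys by (simp add: tensor_add_class[OF assms(1,2)] c append_in_lists_conv del: in_lists_conv_set)
qed

lemma tensor_lift_hom:
  assumes "module R M" "module R N" "module R P" "balanced_map R M N P f"
    "\<And>r m n. r \<in> carrier R \<Longrightarrow> m \<in> carrier M \<Longrightarrow> n \<in> carrier N \<Longrightarrow> f (r \<odot>\<^bsub>M\<^esub> m) n = r \<odot>\<^bsub>P\<^esub> f m n"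
  shows "tensor_lift P f \<in> mod_hom R (tensor R M N) P"
proof -
  interpret M: module R M by fact
  interpret P: module R P by fact
  note ag = M.M.abelian_group_axioms P.M.abelian_group_axioms
  note h = tensor_lift_additive[OF assms(1,2) ag(2) assms(4)]
  note hs = additive_maps_closed[OF h] additive_maps_add[OF h] tensor_smult_closed[OF assms(1,2)]
    tensor_smult_add[OF assms(1,2)] tensor_lift_pure[OF assms(1,2) ag(2) assms(4)] pure_smult[OF assms(1,2)]
  show ?thesis
  proof (rule mod_homI)
    fix r x assume r: "r \<in> carrier R" and x: "x \<in> carrier (tensor R M N)"
    show "tensor_lift P f (r \<odot>\<^bsub>tensor R M N\<^esub> x) = r \<odot>\<^bsub>P\<^esub> tensor_lift P f x"
      using assms(1,2) x
      by (induction rule: tensor_induct) (use r in \<open>simp_all add: hs assms(5) P.smult_r_distr\<close>)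
  qed (simp_all add: hs)
qed

text \<open>The product of \<open>A \<otimes> H\<close>, its action on \<open>M \<otimes> H\<close> and the coaction of \<open>M \<otimes>\<^sub>A N\<close> are all nested
  lifts of the form \<open>(a \<otimes> g, m \<otimes> h) \<mapsto> q a g m h\<close>; biadditivity and the value on pure tensors are
  proved here once for all three.\<close>

definition bilift where
  "bilift P q X Y = tensor_lift P (\<lambda>a g. tensor_lift P (q a g) Y) X"

definition bibalanced where
  "bibalanced R A G M L P q \<longleftrightarrow>
    (\<forall>a\<in>carrier A. \<forall>g\<in>carrier G. balanced_map R M L P (q a g)) \<and>
    (\<forall>m\<in>carrier M. \<forall>h\<in>carrier L. balanced_map R A G P (\<lambda>a g. q a g m h))"

lemma
  assumes mods: "module R A" "module R G" "module R M" "module R L" "abelian_group P"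
    and q: "bibalanced R A G M L P q"
  shows bilift_closed: "X \<in> carrier (tensor R A G) \<Longrightarrow> Y \<in> carrier (tensor R M L) \<Longrightarrow> bilift P q X Y \<in> carrier P"
    and bilift_add_left: "X \<in> carrier (tensor R A G) \<Longrightarrow> X' \<in> carrier (tensor R A G) \<Longrightarrow>
      Y \<in> carrier (tensor R M L) \<Longrightarrow> bilift P q (X \<oplus>\<^bsub>tensor R A G\<^esub> X') Y = bilift P q X Y \<oplus>\<^bsub>P\<^esub> bilift P q X' Y"
    and bilift_add_right: "X \<in> carrier (tensor R A G) \<Longrightarrow> Y \<in> carrier (tensor R M L) \<Longrightarrow>
      Y' \<in> carrier (tensor R M L) \<Longrightarrow> bilift P q X (Y \<oplus>\<^bsub>tensor R M L\<^esub> Y') = bilift P q X Y \<oplus>\<^bsub>P\<^esub> bilift P q X Y'"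
    and bilift_pure: "a \<in> carrier A \<Longrightarrow> g \<in> carrier G \<Longrightarrow> m \<in> carrier M \<Longrightarrow> h \<in> carrier L \<Longrightarrow>
      bilift P q (pure R A G a g) (pure R M L m h) = q a g m h"
proof -
  interpret A: module R A by fact
  interpret G: module R G by fact
  interpret M: module R M by fact
  interpret L: module R L by fact
  interpret P: abelian_group P by fact
  have q1: "a \<in> carrier A \<Longrightarrow> g \<in> carrier G \<Longrightarrow> balanced_map R M L P (q a g)" for a g
    using q by (simp add: bibalanced_def)
  have q2: "m \<in> carrier M \<Longrightarrow> h \<in> carrier L \<Longrightarrow> balanced_map R A G P (\<lambda>a g. q a g m h)" for m h
    using q by (simp add: bibalanced_def)
  note in_pure = tensor_lift_pure[OF mods(3,4,5) q1]
  note in_hom = tensor_lift_additive[OF mods(3,4,5) q1]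
  note in_add = additive_maps_add[OF in_hom] and in_cl = additive_maps_closed[OF in_hom]
  have out: "balanced_map R A G P (\<lambda>a g. tensor_lift P (q a g) Y)" if "Y \<in> carrier (tensor R M L)" for Y
    using mods(3,4) that
  proof (induction rule: tensor_induct)
    case (pure m h)
    from q2[OF this] show ?case
      by (simp add: balanced_map_def in_pure pure)
  next
    case (add x y)
    show ?case using add.IH add.hyps
      by (simp add: balanced_map_def in_add P.a_ac)
  qed
  note out_hom = tensor_lift_additive[OF mods(1,2,5) out]
  show cl: "X \<in> carrier (tensor R A G) \<Longrightarrow> Y \<in> carrier (tensor R M L) \<Longrightarrow> bilift P q X Y \<in> carrier P" for X Y
    by (simp add: bilift_def additive_maps_closed[OF out_hom])
  show addl: "X \<in> carrier (tensor R A G) \<Longrightarrow> X' \<in> carrier (tensor R A G) \<Longrightarrow>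
      Y \<in> carrier (tensor R M L) \<Longrightarrow> bilift P q (X \<oplus>\<^bsub>tensor R A G\<^esub> X') Y = bilift P q X Y \<oplus>\<^bsub>P\<^esub> bilift P q X' Y" for X X' Y
    by (simp add: bilift_def additive_maps_add[OF out_hom])
  show bp: "a \<in> carrier A \<Longrightarrow> g \<in> carrier G \<Longrightarrow> m \<in> carrier M \<Longrightarrow> h \<in> carrier L \<Longrightarrow>
      bilift P q (pure R A G a g) (pure R M L m h) = q a g m h" for a g m h
    by (simp add: bilift_def tensor_lift_pure[OF mods(1,2,5) out] pure_closed in_pure)
  assume X: "X \<in> carrier (tensor R A G)" and Y: "Y \<in> carrier (tensor R M L)" "Y' \<in> carrier (tensor R M L)"
  show "bilift P q X (Y \<oplus>\<^bsub>tensor R M L\<^esub> Y') = bilift P q X Y \<oplus>\<^bsub>P\<^esub> bilift P q X Y'"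
    using mods(1,2) X
  proof (induction rule: tensor_induct)
    case (pure a g)
    then show ?case using Y
      by (simp add: bilift_def tensor_lift_pure[OF mods(1,2,5) out] tensor_add_closed mods in_add)
  next
    case (add x y)
    then show ?case using Y
      by (simp add: addl cl tensor_add_closed mods P.a_ac)
  qed
qed


lemmas bilift_simps = bilift_closed bilift_add_left bilift_add_right bilift_pure

subsection \<open>Functoriality\<close>

text \<open>Keeping \<open>id\<close> and compositions folded lets maps such as \<open>f \<otimes> id\<close> be matched by the rules below.\<close>

declare id_apply [simp del] comp_apply [simp del]

lemma pure_balanced_map:
  assumes "module R M" "module R N" "module R M'" "module R N'"
    "f \<in> mod_hom R M M'" "g \<in> mod_hom R N N'"
  shows "balanced_map R M N (tensor R M' N') (\<lambda>m n. pure R M' N' (f m) (g n))"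
  using assms
  by (intro balanced_mapI) (simp_all add: mod_hom_simps[OF assms(5)] mod_hom_simps[OF assms(6)]
      pure_closed pure_add_left pure_add_right pure_balanced)

lemma tensor_map_hom:
  assumes "module R M" "module R N" "module R M'" "module R N'"
    "f \<in> mod_hom R M M'" "g \<in> mod_hom R N N'"
  shows "tensor_map R M' N' f g \<in> mod_hom R (tensor R M N) (tensor R M' N')"
  unfolding tensor_map_def
  by (rule tensor_lift_hom[OF assms(1,2) tensor_module[OF assms(3,4)] pure_balanced_map[OF assms]])
    (simp add: pure_smult assms mod_hom_simps[OF assms(5)] mod_hom_simps[OF assms(6)])

lemma tensor_map_pure:
  assumes "module R M" "module R N" "module R M'" "module R N'"
    "f \<in> mod_hom R M M'" "g \<in> mod_hom R N N'" "m \<in> carrier M" "n \<in> carrier N"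
  shows "tensor_map R M' N' f g (pure R M N m n) = pure R M' N' (f m) (g n)"
  unfolding tensor_map_def
  by (rule tensor_lift_pure[OF assms(1,2) tensor_abelian_group[OF assms(3,4)]
        pure_balanced_map[OF assms(1-6)] assms(7,8)])

lemma tensor_map_pure_id:
  assumes "module R M" "module R N" "module R M'" "module R N"
    "f \<in> mod_hom R M M'" "m \<in> carrier M" "n \<in> carrier N"
  shows "tensor_map R M' N f id (pure R M N m n) = pure R M' N (f m) n"
  by (subst tensor_map_pure[OF assms(1-5) mod_hom_id assms(6,7)]) (simp add: id_apply)

lemma tensor_map_cong:
  assumes "module R M" "module R N" "x \<in> carrier (tensor R M N)"
    "\<And>m. m \<in> carrier M \<Longrightarrow> f m = f' m" "\<And>n. n \<in> carrier N \<Longrightarrow> g n = g' n"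
  shows "tensor_map R M' N' f g x = tensor_map R M' N' f' g' x"
  unfolding tensor_map_def by (rule tensor_lift_cong[OF assms(1-3)]) (simp add: assms(4,5))

lemma tensor_map_comp:
  assumes "module R M" "module R N" "module R M'" "module R N'" "module R M''" "module R N''"
    and f: "f \<in> mod_hom R M M'" "g \<in> mod_hom R N N'"
    and f': "f' \<in> mod_hom R M' M''" "g' \<in> mod_hom R N' N''"
    and x: "x \<in> carrier (tensor R M N)"
  shows "tensor_map R M'' N'' f' g' (tensor_map R M' N' f g x) = tensor_map R M'' N'' (f' \<circ> f) (g' \<circ> g) x"
  using assms(1,2) x
proof (induction rule: tensor_induct)
  case (pure m n)
  then show ?case
    using mod_hom_comp[OF f(1) f'(1)] mod_hom_comp[OF f(2) f'(2)]
    by (simp add: tensor_map_pure[of R M N] tensor_map_pure[of R M' N'] assms mod_hom_closed[OF f(1)] mod_hom_closed[OF f(2)])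
      (simp add: comp_apply)
next
  case (add x y)
  note h = tensor_map_hom[OF assms(1-4) f] tensor_map_hom[OF assms(3-6) f']
    tensor_map_hom[OF assms(1,2,5,6) mod_hom_comp[OF f(1) f'(1)] mod_hom_comp[OF f(2) f'(2)]]
  show ?case using add
    by (simp add: mod_hom_simps[OF h(1)] mod_hom_simps[OF h(2)] mod_hom_simps[OF h(3)])
qed

lemma tensor_map_id:
  assumes "module R M" "module R N" "x \<in> carrier (tensor R M N)"
  shows "tensor_map R M N id id x = x"
proof -
  note h = tensor_map_hom[OF assms(1,2,1,2) mod_hom_id mod_hom_id]
  show ?thesis using assms
  proof (induction rule: tensor_induct)
    case (pure m n)
    then show ?case
      by (simp add: tensor_map_pure[OF assms(1,2,1,2) mod_hom_id mod_hom_id], simp add: id_apply)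
  next
    case (add x y)
    then show ?case by (simp add: mod_hom_add[OF h])
  qed
qed

lemma tensor_map_iso:
  assumes "module R M" "module R N" "module R M'" "module R N'"
    and f: "f \<in> mod_iso R M M'" and g: "g \<in> mod_iso R N N'"
  shows "tensor_map R M' N' f g \<in> mod_iso R (tensor R M N) (tensor R M' N')"
proof -
  let ?f = "inv_into (carrier M) f" and ?g = "inv_into (carrier N) g"
  note fi = mod_iso_inv[OF f assms(1)] and gi = mod_iso_inv[OF g assms(2)]
  note h = mod_iso_hom[OF f] mod_iso_hom[OF g] mod_iso_hom[OF fi] mod_iso_hom[OF gi]
  note t = tensor_map_hom[OF assms(1-4) h(1,2)] and t' = tensor_map_hom[OF assms(3,4,1,2) h(3,4)]
  show ?thesis
  proof (rule mod_isoI[OF t, where g = "tensor_map R M N ?f ?g"])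
    show "tensor_map R M N ?f ?g \<in> carrier (tensor R M' N') \<rightarrow> carrier (tensor R M N)"
      using mod_hom_closed[OF t'] by blast
    fix x assume x: "x \<in> carrier (tensor R M N)"
    have "tensor_map R M N ?f ?g (tensor_map R M' N' f g x) = tensor_map R M N id id x"
      unfolding tensor_map_comp[OF assms(1-4) assms(1,2) h x]
      by (rule tensor_map_cong[OF assms(1,2) x])
        (simp_all add: comp_apply id_apply mod_iso_inv_left[OF f] mod_iso_inv_left[OF g])
    thus "tensor_map R M N ?f ?g (tensor_map R M' N' f g x) = x"
      by (simp add: tensor_map_id[OF assms(1,2) x])
  next
    fix x assume x: "x \<in> carrier (tensor R M' N')"
    have "tensor_map R M' N' f g (tensor_map R M N ?f ?g x) = tensor_map R M' N' id id x"
      unfolding tensor_map_comp[OF assms(3,4,1,2,3,4) h(3,4,1,2) x]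
      by (rule tensor_map_cong[OF assms(3,4) x])
        (simp_all add: comp_apply id_apply mod_iso_inv_right[OF f] mod_iso_inv_right[OF g])
    thus "tensor_map R M' N' f g (tensor_map R M N ?f ?g x) = x"
      by (simp add: tensor_map_id[OF assms(3,4) x])
  qed
qed

text \<open>Tensor products see only the operations on the carrier.  This matters for \<open>A\<close> itself, whose scalar
  multiplication by \<open>c\<close> is known to agree with the product by \<open>c 1\<close> only there.\<close>

lemma tensor_rel_mono:
  assumes carr: "carrier M' = carrier M" and zero: "\<zero>\<^bsub>M'\<^esub> = \<zero>\<^bsub>M\<^esub>" and add: "add M' = add M"
    and smult: "\<And>r m. r \<in> carrier R \<Longrightarrow> m \<in> carrier M \<Longrightarrow> r \<odot>\<^bsub>M'\<^esub> m = r \<odot>\<^bsub>M\<^esub> m"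
  shows "tensor_rel R M N \<subseteq> tensor_rel R M' N"
proof (rule subrelI)
  fix xs ys assume "(xs, ys) \<in> tensor_rel R M N"
  thus "(xs, ys) \<in> tensor_rel R M' N"
  proof induction
    case (balanced r m n)
    then show ?case using tensor_rel.balanced[of r R m M' n N] by (simp add: carr smult)
  next
    case (zero n)
    then show ?case using tensor_rel.zero[of n N M' R] by (simp add: assms(2))
  next
    case (add_left m m' n)
    then show ?case using tensor_rel.add_left[of m M' m' n N R] by (simp add: carr add)
  next
    case (refl xs)
    then show ?case by (intro tensor_rel.refl) (simp add: carr)
  next
    case (commute xs ys)
    then show ?case by (intro tensor_rel.commute) (simp_all add: carr)
  qed (auto simp: carr intro: tensor_rel.intros)
qed

lemma tensor_rel_cong:
  assumes carr: "carrier M' = carrier M" and zero: "\<zero>\<^bsub>M'\<^esub> = \<zero>\<^bsub>M\<^esub>" and add: "add M' = add M"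
    and smult: "\<And>r m. r \<in> carrier R \<Longrightarrow> m \<in> carrier M \<Longrightarrow> r \<odot>\<^bsub>M'\<^esub> m = r \<odot>\<^bsub>M\<^esub> m"
  shows "tensor_rel R M' N = tensor_rel R M N"
proof
  show "tensor_rel R M' N \<subseteq> tensor_rel R M N"
    by (rule tensor_rel_mono) (use assms in simp_all)
  show "tensor_rel R M N \<subseteq> tensor_rel R M' N"
    by (rule tensor_rel_mono) (use assms in simp_all)
qed

lemma assoc_inner_balanced:
  assumes "module R M" "module R N" "module R P" "p \<in> carrier P"
  shows "balanced_map R M N (tensor R M (tensor R N P)) (\<lambda>m n. pure R M (tensor R N P) m (pure R N P n p))"
  using assms tensor_module[OF assms(2,3)]
  by (intro balanced_mapI) (simp_all add: pure_closed pure_add_left pure_add_right pure_balanced pure_smult)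

lemma
  assumes mods: "module R M" "module R N" "module R P"
  shows tensor_assoc_hom: "tensor_assoc R M N P \<in>
      mod_hom R (tensor R (tensor R M N) P) (tensor R M (tensor R N P))"
    and tensor_assoc_pure: "m \<in> carrier M \<Longrightarrow> n \<in> carrier N \<Longrightarrow> p \<in> carrier P \<Longrightarrow>
      tensor_assoc R M N P (pure R (tensor R M N) P (pure R M N m n) p) =
        pure R M (tensor R N P) m (pure R N P n p)"
proof -
  interpret M: module R M by fact
  interpret N: module R N by fact
  interpret P: module R P by fact
  let ?T = "tensor R M (tensor R N P)" and ?MN = "tensor R M N"
  let ?q = "\<lambda>p m n. pure R M (tensor R N P) m (pure R N P n p)"
  note NP = tensor_module[OF mods(2,3)] and MN = tensor_module[OF mods(1,2)]
  interpret T: module R ?T by (rule tensor_module[OF mods(1) NP])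
  note T = T.module_axioms T.M.abelian_group_axioms
  note ps = pure_closed pure_add_left pure_add_right pure_smult mods NP
  have i_pure: "p \<in> carrier P \<Longrightarrow> m \<in> carrier M \<Longrightarrow> n \<in> carrier N \<Longrightarrow>
    tensor_lift ?T (?q p) (pure R M N m n) = ?q p m n" for p m n
    by (rule tensor_lift_pure[OF mods(1,2) T(2) assoc_inner_balanced[OF mods]])
  have i_hom: "p \<in> carrier P \<Longrightarrow> tensor_lift ?T (?q p) \<in> mod_hom R ?MN ?T" for p
    by (rule tensor_lift_hom[OF mods(1,2) T(1) assoc_inner_balanced[OF mods]]) (simp_all add: ps)
  note iss = mod_hom_simps[OF i_hom]
  have addr: "tensor_lift ?T (?q (p \<oplus>\<^bsub>P\<^esub> p')) X = tensor_lift ?T (?q p) X \<oplus>\<^bsub>?T\<^esub> tensor_lift ?T (?q p') X"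
    if p: "p \<in> carrier P" "p' \<in> carrier P" and X: "X \<in> carrier ?MN" for p p' X
    using mods(1,2) X
    by (induction rule: tensor_induct) (use p in \<open>simp_all add: iss i_pure ps T.M.a_ac\<close>)
  have smr: "tensor_lift ?T (?q (r \<odot>\<^bsub>P\<^esub> p)) X = r \<odot>\<^bsub>?T\<^esub> tensor_lift ?T (?q p) X"
    if p: "p \<in> carrier P" "r \<in> carrier R" and X: "X \<in> carrier ?MN" for p r X
    using mods(1,2) X
  proof (induction rule: tensor_induct)
    case (pure m n)
    have "pure R N P n (r \<odot>\<^bsub>P\<^esub> p) = r \<odot>\<^bsub>tensor R N P\<^esub> pure R N P n p"
      using p pure by (simp add: pure_smult[OF mods(2,3)] pure_balanced[OF mods(2,3)])
    hence "?q (r \<odot>\<^bsub>P\<^esub> p) m n = r \<odot>\<^bsub>?T\<^esub> ?q p m n"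
      using p pure by (simp add: pure_smult[OF mods(1) NP] pure_balanced[OF mods(1) NP] pure_closed)
    then show ?case using p pure by (simp add: i_pure)
  next
    case (add x y)
    then show ?case using p by (simp add: iss T.smult_r_distr)
  qed
  have bal: "balanced_map R ?MN P ?T (\<lambda>X p. tensor_lift ?T (?q p) X)"
    by (rule balanced_mapI) (simp_all add: iss addr smr)
  have eq: "tensor_assoc R M N P = tensor_lift ?T (\<lambda>X p. tensor_lift ?T (?q p) X)"
    by (simp add: tensor_assoc_def Let_def)
  show "tensor_assoc R M N P \<in> mod_hom R (tensor R (tensor R M N) P) (tensor R M (tensor R N P))"
    unfolding eq by (rule tensor_lift_hom[OF MN mods(3) T(1) bal]) (simp add: iss)
  show "m \<in> carrier M \<Longrightarrow> n \<in> carrier N \<Longrightarrow> p \<in> carrier P \<Longrightarrow>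
      tensor_assoc R M N P (pure R (tensor R M N) P (pure R M N m n) p) = ?q p m n"
    unfolding eq by (simp add: tensor_lift_pure[OF MN mods(3) T(2) bal] ps i_pure)
qed

lemma tensor_assoc_natural:
  assumes mods: "module R M" "module R M'" "module R N" "module R P"
    and f: "f \<in> mod_hom R M M'" and x: "x \<in> carrier (tensor R (tensor R M N) P)"
  shows "tensor_assoc R M' N P (tensor_map R (tensor R M' N) P (tensor_map R M' N f id) id x) =
    tensor_map R M' (tensor R N P) f id (tensor_assoc R M N P x)"
proof -
  note MN = tensor_module[OF mods(1,3)] and MN' = tensor_module[OF mods(2,3)] and NP = tensor_module[OF mods(3,4)]
  note f1 = tensor_map_hom[OF mods(1,3,2,3) f mod_hom_id]
  note f2 = tensor_map_hom[OF MN mods(4) MN' mods(4) f1 mod_hom_id]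
  note a = tensor_assoc_hom[OF mods(1,3,4)] and a' = tensor_assoc_hom[OF mods(2,3,4)]
  note f3 = tensor_map_hom[OF mods(1) NP mods(2) NP f mod_hom_id]
  note hs = mod_hom_simps[OF f] mod_hom_simps[OF f1] mod_hom_simps[OF f2] mod_hom_simps[OF f3] mod_hom_simps[OF a] mod_hom_simps[OF a']
    tensor_map_pure_id[OF mods(1,3,2,3) f] tensor_map_pure_id[OF MN mods(4) MN' mods(4) f1]
    tensor_map_pure_id[OF mods(1) NP mods(2) NP f]
    tensor_assoc_pure[OF mods(1,3,4)] tensor_assoc_pure[OF mods(2,3,4)]
  show ?thesis
    using MN mods(4) x
  proof (induction rule: tensor_induct)
    case (pure X p)
    from mods(1,3) pure(1) show ?case
    proof (induction rule: tensor_induct)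
      case (pure m n)
      then show ?case using \<open>p \<in> carrier P\<close> by (simp add: hs pure_closed)
    next
      case (add x y)
      then show ?case using \<open>p \<in> carrier P\<close>
        by (simp add: hs pure_closed pure_add_left MN mods MN')
    qed
  next
    case (add x y)
    then show ?case by (simp add: hs)
  qed
qed

section \<open>Colinear maps\<close>

text \<open>The comodule axioms at a single element.  They pass to sums and along colinear maps, so it is enough
  to know them on generators that are images of elements of known comodules.\<close>

definition comodule_at where
  "comodule_at K H \<Delta> \<epsilon> M \<rho> m \<longleftrightarrow>
    tensor_assoc K M H H (tensor_map K (tensor K M H) H \<rho> id (\<rho> m)) =
      tensor_map K M (tensor K H H) id \<Delta> (\<rho> m) \<and>
    tensor_lift M (\<lambda>m' h. \<epsilon> h \<odot>\<^bsub>M\<^esub> m') (\<rho> m) = m"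

lemma comodule_iff:
  "comodule K H \<Delta> \<epsilon> M \<rho> \<longleftrightarrow> module K M \<and> \<rho> \<in> mod_hom K M (tensor K M H) \<and>
    (\<forall>m\<in>carrier M. comodule_at K H \<Delta> \<epsilon> M \<rho> m)"
  by (simp add: comodule_def comodule_at_def)

lemma counit_balanced:
  assumes "module K M" "module K H" "\<epsilon> \<in> mod_hom K H (regular K)"
  shows "balanced_map K M H M (\<lambda>m h. \<epsilon> h \<odot>\<^bsub>M\<^esub> m)"
proof -
  interpret M: module K M by fact
  note e = mod_hom_simps[OF assms(3), unfolded regular_def, simplified]
  show ?thesis
    by (rule balanced_mapI)
      (simp_all add: e M.smult_r_distr M.smult_l_distr M.smult_assoc1[symmetric] M.m_comm)
qed

lemma comodule_at_add:
  assumes mods: "module K M" "module K H"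
    and r: "\<rho> \<in> mod_hom K M (tensor K M H)" and d: "\<Delta> \<in> mod_hom K H (tensor K H H)"
    and e: "\<epsilon> \<in> mod_hom K H (regular K)"
    and xy: "x \<in> carrier M" "y \<in> carrier M"
      "comodule_at K H \<Delta> \<epsilon> M \<rho> x" "comodule_at K H \<Delta> \<epsilon> M \<rho> y"
  shows "comodule_at K H \<Delta> \<epsilon> M \<rho> (x \<oplus>\<^bsub>M\<^esub> y)"
proof -
  note MH = tensor_module[OF mods] and HH = tensor_module[OF mods(2,2)]
  note l = tensor_lift_additive[OF mods module_abelian_group[OF mods(1)] counit_balanced[OF mods e]]
  note hs = mod_hom_simps[OF r] mod_hom_simps[OF tensor_map_hom[OF mods MH mods(2) r mod_hom_id]]
    mod_hom_simps[OF tensor_assoc_hom[OF mods mods(2)]]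
    mod_hom_simps[OF tensor_map_hom[OF mods mods(1) HH mod_hom_id d]]
  show ?thesis
    using xy by (simp add: comodule_at_def hs additive_maps_add[OF l])
qed

text \<open>The coassociativity at \<open>f(m)\<close> is the image of that at \<open>m\<close> by naturality of the associator.  The lemma
  serves for transport of structure, for \<open>N \<otimes>\<^sub>B A\<close>, which is generated by images of colinear maps
  \<open>A \<rightarrow> N \<otimes>\<^sub>B A\<close>, and for the grouplike element of a trivialization.\<close>

lemma comodule_at_image:
  assumes mods: "module K M" "module K M'" "module K H"
    and f: "f \<in> mod_hom K M M'"
    and r: "\<rho> \<in> mod_hom K M (tensor K M H)" and r': "\<rho>' \<in> mod_hom K M' (tensor K M' H)"
    and d: "\<Delta> \<in> mod_hom K H (tensor K H H)" and e: "\<epsilon> \<in> mod_hom K H (regular K)"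
    and colinear: "\<And>m. m \<in> carrier M \<Longrightarrow> \<rho>' (f m) = tensor_map K M' H f id (\<rho> m)"
    and m: "m \<in> carrier M" and at: "comodule_at K H \<Delta> \<epsilon> M \<rho> m"
  shows "comodule_at K H \<Delta> \<epsilon> M' \<rho>' (f m)"
proof -
  interpret M: module K M by fact
  interpret M': module K M' by fact
  note MH = tensor_module[OF mods(1,3)] and MH' = tensor_module[OF mods(2,3)] and HH = tensor_module[OF mods(3,3)]
  note fH = tensor_map_hom[OF mods(1,3,2,3) f mod_hom_id]
  have rm: "\<rho> m \<in> carrier (tensor K M H)" by (rule mod_hom_closed[OF r m])
  have "tensor_map K (tensor K M' H) H \<rho>' id (\<rho>' (f m)) =
      tensor_map K (tensor K M' H) H (\<rho>' \<circ> f) id (\<rho> m)"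
    using tensor_map_comp[OF mods(1,3,2,3) MH' mods(3) f mod_hom_id r' mod_hom_id rm]
    by (simp add: colinear m)
  also have "\<dots> = tensor_map K (tensor K M' H) H (tensor_map K M' H f id \<circ> \<rho>) (id \<circ> id) (\<rho> m)"
    by (rule tensor_map_cong[OF mods(1,3) rm]) (simp_all add: colinear comp_apply)
  also have "\<dots> = tensor_map K (tensor K M' H) H (tensor_map K M' H f id) id
      (tensor_map K (tensor K M H) H \<rho> id (\<rho> m))"
    by (rule tensor_map_comp[OF mods(1,3) MH mods(3) MH' mods(3) r mod_hom_id fH mod_hom_id rm, symmetric])
  finally have "tensor_assoc K M' H H (tensor_map K (tensor K M' H) H \<rho>' id (\<rho>' (f m))) =
      tensor_map K M' (tensor K H H) f id
        (tensor_assoc K M H H (tensor_map K (tensor K M H) H \<rho> id (\<rho> m)))"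
    by (simp add: tensor_assoc_natural[OF mods(1,2,3,3) f]
        mod_hom_closed[OF tensor_map_hom[OF mods(1,3) MH mods(3) r mod_hom_id]] rm)
  also have "\<dots> = tensor_map K M' (tensor K H H) f id (tensor_map K M (tensor K H H) id \<Delta> (\<rho> m))"
    using at by (simp add: comodule_at_def)
  also have "\<dots> = tensor_map K M' (tensor K H H) id \<Delta> (tensor_map K M' H f id (\<rho> m))"
    by (simp add: tensor_map_comp[OF mods(1,3,1) HH mods(2) HH mod_hom_id d f mod_hom_id rm]
        tensor_map_comp[OF mods(1,3,2,3,2) HH f mod_hom_id mod_hom_id d rm])
  finally have 1: "tensor_assoc K M' H H (tensor_map K (tensor K M' H) H \<rho>' id (\<rho>' (f m))) =
      tensor_map K M' (tensor K H H) id \<Delta> (\<rho>' (f m))"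
    by (simp add: colinear m)
  note ag = M.M.abelian_group_axioms M'.M.abelian_group_axioms
  note l = tensor_lift_additive[OF mods(1,3) ag(1) counit_balanced[OF mods(1,3) e]]
  note l' = tensor_lift_additive[OF mods(2,3) ag(2) counit_balanced[OF mods(2,3) e]]
  note lp = tensor_lift_pure[OF mods(1,3) ag(1) counit_balanced[OF mods(1,3) e]]
  note lp' = tensor_lift_pure[OF mods(2,3) ag(2) counit_balanced[OF mods(2,3) e]]
  have ec: "h \<in> carrier H \<Longrightarrow> \<epsilon> h \<in> carrier K" for h
    using mod_hom_closed[OF e] by (simp add: regular_def)
  have "tensor_lift M' (\<lambda>m' h. \<epsilon> h \<odot>\<^bsub>M'\<^esub> m') (tensor_map K M' H f id z) =
      f (tensor_lift M (\<lambda>m' h. \<epsilon> h \<odot>\<^bsub>M\<^esub> m') z)" if z: "z \<in> carrier (tensor K M H)" for z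
    using mods(1,3) z
  proof (induction rule: tensor_induct)
    case (pure m h)
    then show ?case
      by (simp add: tensor_map_pure_id[OF mods(1,3,2,3) f] lp lp' mod_hom_simps[OF f] ec)
  next
    case (add x y)
    then show ?case
      by (simp add: mod_hom_simps[OF fH] mod_hom_simps[OF f] additive_maps_add[OF l] additive_maps_closed[OF l]
          additive_maps_add[OF l'])
  qed
  from this[OF rm] have 2: "tensor_lift M' (\<lambda>m' h. \<epsilon> h \<odot>\<^bsub>M'\<^esub> m') (\<rho>' (f m)) = f m"
    using at by (simp add: colinear m comodule_at_def)
  from 1 2 show ?thesis by (simp add: comodule_at_def)
qed

section \<open>Restriction of scalars\<close>

lemma regular_simps [simp]:
  "carrier (regular R) = carrier R" "mult (regular R) = mult R" "one (regular R) = one R"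
  "zero (regular R) = zero R" "add (regular R) = add R" "smult (regular R) = mult R"
  by (simp_all add: regular_def)

lemma restrict_scalars_simps [simp]:
  "carrier (restrict_scalars A M) = carrier M"
  "zero (restrict_scalars A M) = zero M" "add (restrict_scalars A M) = add M"
  "smult (restrict_scalars A M) c m = (c \<odot>\<^bsub>A\<^esub> \<one>\<^bsub>A\<^esub>) \<odot>\<^bsub>M\<^esub> m"
  by (simp_all add: restrict_scalars_def)

lemma abelian_group_cong:
  assumes "abelian_group M" "carrier N = carrier M" "zero N = zero M" "add N = add M"
  shows "abelian_group N"
proof -
  interpret abelian_group M by fact
  show ?thesis
  proof (rule abelian_groupI)
    fix x assume "x \<in> carrier N"
    thus "\<exists>y\<in>carrier N. y \<oplus>\<^bsub>N\<^esub> x = \<zero>\<^bsub>N\<^esub>"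
      using assms by (intro bexI[of _ "\<ominus>\<^bsub>M\<^esub> x"]) (simp_all add: l_neg)
  qed (use assms in \<open>simp_all add: a_ac\<close>)
qed

lemma regular_module: "cring R \<Longrightarrow> module R (regular R)"
proof -
  assume "cring R"
  then interpret cring R .
  show ?thesis
    by (rule moduleI)
      (auto simp: l_distr r_distr m_assoc is_cring intro!: abelian_group_cong[OF abelian_group_axioms])
qed

lemma restrict_scalars_module:
  assumes "algebra K A" "module A M"
  shows "module K (restrict_scalars A M)"
proof -
  interpret A: algebra K A by fact
  interpret M: module A M by fact
  have "(a \<otimes>\<^bsub>K\<^esub> b) \<odot>\<^bsub>A\<^esub> \<one>\<^bsub>A\<^esub> = (a \<odot>\<^bsub>A\<^esub> \<one>\<^bsub>A\<^esub>) \<otimes>\<^bsub>A\<^esub> (b \<odot>\<^bsub>A\<^esub> \<one>\<^bsub>A\<^esub>)"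
    if "a \<in> carrier K" "b \<in> carrier K" for a b
    using that by (simp add: A.smult_assoc2 A.smult_assoc1)
  thus ?thesis
    by (intro moduleI)
      (auto simp: A.R_cring A.smult_l_distr M.smult_l_distr M.smult_r_distr M.smult_assoc1
        intro!: abelian_group_cong[OF M.M.abelian_group_axioms])
qed

lemma mod_hom_restrict_scalars:
  assumes "algebra K A" "f \<in> mod_hom A M N"
  shows "f \<in> mod_hom K (restrict_scalars A M) (restrict_scalars A N)"
proof -
  interpret A: algebra K A by fact
  show ?thesis by (rule mod_homI) (simp_all add: mod_hom_simps[OF assms(2)])
qed

lemma restrict_regular_smult:
  assumes "algebra K A" "r \<in> carrier K" "a \<in> carrier A"
  shows "(r \<odot>\<^bsub>A\<^esub> \<one>\<^bsub>A\<^esub>) \<otimes>\<^bsub>A\<^esub> a = r \<odot>\<^bsub>A\<^esub> a"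
proof -
  interpret A: algebra K A by fact
  show ?thesis using assms by (simp add: A.smult_assoc2)
qed

lemma mod_hom_from_regular:
  assumes "algebra K A" "f \<in> mod_hom A (regular A) M"
  shows "f \<in> mod_hom K A (restrict_scalars A M)"
proof -
  interpret A: algebra K A by fact
  note f = mod_hom_simps[OF assms(2), simplified]
  show ?thesis
  proof (rule mod_homI)
    fix r a assume "r \<in> carrier K" "a \<in> carrier A"
    thus "f (r \<odot>\<^bsub>A\<^esub> a) = r \<odot>\<^bsub>restrict_scalars A M\<^esub> f a"
      using f(3)[of "r \<odot>\<^bsub>A\<^esub> \<one>\<^bsub>A\<^esub>" a] by (simp add: restrict_regular_smult[OF assms(1)])
  qed (simp_all add: f)
qed

lemma mod_hom_to_regular:
  assumes "algebra K A" "module A M" "f \<in> mod_hom A M (regular A)"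
  shows "f \<in> mod_hom K (restrict_scalars A M) A"
proof -
  interpret A: algebra K A by fact
  interpret M: module A M by fact
  note f = mod_hom_simps[OF assms(3), simplified]
  show ?thesis
    by (rule mod_homI) (simp_all add: f restrict_regular_smult[OF assms(1)])
qed

text \<open>The algebra \<open>A\<close> is a module over the ground ring both as an algebra and by restriction from itself.
  Its tensor products with \<open>H\<close> are the same, so the coaction of \<open>A\<close> is also one on its regular module.\<close>

lemma regular_restrict_rel:
  assumes "algebra K A"
  shows "tensor_rel K (restrict_scalars A (regular A)) H = tensor_rel K A H"
  by (intro tensor_rel_cong) (simp_all add: restrict_regular_smult[OF assms])

lemma regular_restrict_tensor:
  assumes "algebra K A"
  shows "carrier (tensor K (restrict_scalars A (regular A)) H) = carrier (tensor K A H)"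
    "add (tensor K (restrict_scalars A (regular A)) H) = add (tensor K A H)"
    "zero (tensor K (restrict_scalars A (regular A)) H) = zero (tensor K A H)"
    "pure K (restrict_scalars A (regular A)) H = pure K A H"
    "tensor_map K (restrict_scalars A (regular A)) H = tensor_map K A H"
  by (simp_all add: tensor_def pure_def tensor_map_def tensor_lift_def fun_eq_iff regular_restrict_rel[OF assms])

section \<open>The algebra \<open>A \<otimes> H\<close> and its modules \<open>M \<otimes> H\<close>\<close>

lemma tensor_alg_simps [simp]:
  "carrier (tensor_alg R M N) = carrier (tensor R M N)" "add (tensor_alg R M N) = add (tensor R M N)"
  "zero (tensor_alg R M N) = zero (tensor R M N)" "smult (tensor_alg R M N) = smult (tensor R M N)"
  "one (tensor_alg R M N) = pure R M N \<one>\<^bsub>M\<^esub> \<one>\<^bsub>N\<^esub>"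
  by (simp_all add: tensor_alg_def tensor_def)

locale algebra_pair = A: algebra K A + H: algebra K H
  for K :: "'k ring" and A :: "('k, 'a) module" and H :: "('k, 'h) module"
begin

abbreviation AH where "AH \<equiv> tensor K A H"
abbreviation amult (infixl "\<star>" 70) where "X \<star> Y \<equiv> X \<otimes>\<^bsub>tensor_alg K A H\<^esub> Y"

lemmas modA = A.module_axioms and modH = H.module_axioms
lemmas modAH = tensor_module[OF A.module_axioms H.module_axioms]

lemma mult_bilift:
  "X \<star> Y = bilift AH (\<lambda>a h b g. pure K A H (a \<otimes>\<^bsub>A\<^esub> b) (h \<otimes>\<^bsub>H\<^esub> g)) X Y"
  by (simp add: tensor_alg_def bilift_def)

lemma A_smult_right: "r \<in> carrier K \<Longrightarrow> a \<in> carrier A \<Longrightarrow> b \<in> carrier A \<Longrightarrow>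
    a \<otimes>\<^bsub>A\<^esub> (r \<odot>\<^bsub>A\<^esub> b) = r \<odot>\<^bsub>A\<^esub> (a \<otimes>\<^bsub>A\<^esub> b)"
  by (metis A.smult_assoc2 A.m_comm A.smult_closed)

lemma H_smult_right: "r \<in> carrier K \<Longrightarrow> a \<in> carrier H \<Longrightarrow> b \<in> carrier H \<Longrightarrow>
    a \<otimes>\<^bsub>H\<^esub> (r \<odot>\<^bsub>H\<^esub> b) = r \<odot>\<^bsub>H\<^esub> (a \<otimes>\<^bsub>H\<^esub> b)"
  by (metis H.smult_assoc2 H.m_comm H.smult_closed)

lemma mult_bibalanced:
  "bibalanced K A H A H AH (\<lambda>a h b g. pure K A H (a \<otimes>\<^bsub>A\<^esub> b) (h \<otimes>\<^bsub>H\<^esub> g))"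
  unfolding bibalanced_def
  by (intro conjI ballI balanced_mapI)
    (simp_all add: pure_closed pure_add_left[OF modA modH] pure_add_right[OF modA modH] A.l_distr A.r_distr
      H.l_distr H.r_distr A_smult_right H_smult_right A.smult_assoc2 H.smult_assoc2 pure_balanced[OF modA modH])

lemmas amult_simps =
  bilift_simps[OF modA modH modA modH module_abelian_group[OF modAH] mult_bibalanced, folded mult_bilift]

lemma amult_smult_right:
  assumes c: "c \<in> carrier K" and X: "X \<in> carrier AH" and Y: "Y \<in> carrier AH"
  shows "X \<star> (c \<odot>\<^bsub>AH\<^esub> Y) = c \<odot>\<^bsub>AH\<^esub> (X \<star> Y)"
proof -
  interpret AH: module K AH by (rule modAH)
  show ?thesis using modA modH X
  proof (induction rule: tensor_induct)
    case X: (pure a h)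
    show ?case using modA modH Y
    proof (induction rule: tensor_induct)
      case (pure a' h')
      then show ?case using X c by (simp add: amult_simps pure_smult[OF modA modH] A_smult_right)
    next
      case (add x y)
      then show ?case using X c by (simp add: amult_simps AH.smult_r_distr pure_closed)
    qed
  next
    case (add x y)
    then show ?case using Y c by (simp add: amult_simps AH.smult_r_distr)
  qed
qed

lemma tensor_alg_cring: "cring (tensor_alg K A H)"
proof -
  interpret AH: module K AH by (rule modAH)
  let ?T = "tensor_alg K A H"
  note ind = tensor_induct[OF modA modH, consumes 1, case_names pure add]
  have comm: "X \<star> Y = Y \<star> X" if X: "X \<in> carrier AH" and Y: "Y \<in> carrier AH" for X Y
    using X
  proof (induction rule: ind)
    case (pure a h)
    show ?case using Y
      by (induction rule: ind) (use pure in \<open>simp_all add: amult_simps pure_closed A.m_comm H.m_comm\<close>)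
  qed (use Y in \<open>simp add: amult_simps\<close>)
  have assoc: "(X \<star> Y) \<star> Z = X \<star> (Y \<star> Z)"
    if X: "X \<in> carrier AH" and Y: "Y \<in> carrier AH" and Z: "Z \<in> carrier AH" for X Y Z
    using X
  proof (induction rule: ind)
    case X: (pure a h)
    show ?case using Y
    proof (induction rule: ind)
      case Y: (pure b g)
      show ?case using Z
        by (induction rule: ind) (use X Y in \<open>simp_all add: amult_simps pure_closed A.m_assoc H.m_assoc\<close>)
    qed (use X Z in \<open>simp add: amult_simps pure_closed\<close>)
  qed (use Y Z in \<open>simp add: amult_simps\<close>)
  have one: "pure K A H \<one>\<^bsub>A\<^esub> \<one>\<^bsub>H\<^esub> \<star> X = X" if "X \<in> carrier AH" for X
    using that by (induction rule: ind) (simp_all add: amult_simps pure_closed)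
  show ?thesis
  proof (intro cringI abelian_group_cong[OF AH.abelian_group_axioms])
    show "comm_monoid ?T"
      by (rule comm_monoidI) (simp_all add: amult_simps pure_closed assoc one, simp add: comm)
  qed (simp_all add: amult_simps)
qed

abbreviation MK where "MK M \<equiv> restrict_scalars A M"
abbreviation MH where "MH M \<equiv> tensor K (restrict_scalars A M) H"
abbreviation mapH where "mapH M f \<equiv> tensor_map K (restrict_scalars A M) H f id"

lemma algA: "algebra K A" ..

lemmas modMK = restrict_scalars_module[OF algA]

lemma modMH: "module A M \<Longrightarrow> module K (MH M)"
  by (simp add: tensor_module modMK modH)

lemma act_bilift:
  "tensor_act K H A M X Y = bilift (MH M) (\<lambda>a g m h. pure K (MK M) H (a \<odot>\<^bsub>M\<^esub> m) (h \<otimes>\<^bsub>H\<^esub> g)) X Y"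
  by (simp add: tensor_act_def bilift_def Let_def)

lemma act_bibalanced:
  assumes M: "module A M"
  shows "bibalanced K A H (MK M) H (MH M) (\<lambda>a g m h. pure K (MK M) H (a \<odot>\<^bsub>M\<^esub> m) (h \<otimes>\<^bsub>H\<^esub> g))"
proof -
  interpret M: module A M by fact
  note mk = modMK[OF M]
  note b = pure_balanced[OF mk modH, symmetric, simplified]
  show ?thesis
  unfolding bibalanced_def
  by (intro conjI ballI balanced_mapI)
    (simp_all add: pure_closed pure_add_left[OF mk modH, simplified] pure_add_right[OF mk modH] M.smult_l_distr M.smult_r_distr
      H.l_distr H.r_distr H_smult_right H.smult_assoc2 b
      M.smult_assoc1[symmetric] A_smult_right A.smult_assoc2)
qed

lemma
  assumes M: "module A M"
  shows act_closed: "X \<in> carrier AH \<Longrightarrow> Y \<in> carrier (MH M) \<Longrightarrow> tensor_act K H A M X Y \<in> carrier (MH M)"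
    and act_add_left: "X \<in> carrier AH \<Longrightarrow> X' \<in> carrier AH \<Longrightarrow> Y \<in> carrier (MH M) \<Longrightarrow>
      tensor_act K H A M (X \<oplus>\<^bsub>AH\<^esub> X') Y = tensor_act K H A M X Y \<oplus>\<^bsub>MH M\<^esub> tensor_act K H A M X' Y"
    and act_add_right: "X \<in> carrier AH \<Longrightarrow> Y \<in> carrier (MH M) \<Longrightarrow> Y' \<in> carrier (MH M) \<Longrightarrow>
      tensor_act K H A M X (Y \<oplus>\<^bsub>MH M\<^esub> Y') = tensor_act K H A M X Y \<oplus>\<^bsub>MH M\<^esub> tensor_act K H A M X Y'"
    and act_pure: "a \<in> carrier A \<Longrightarrow> g \<in> carrier H \<Longrightarrow> m \<in> carrier M \<Longrightarrow> h \<in> carrier H \<Longrightarrow>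
      tensor_act K H A M (pure K A H a g) (pure K (MK M) H m h) = pure K (MK M) H (a \<odot>\<^bsub>M\<^esub> m) (h \<otimes>\<^bsub>H\<^esub> g)"
  unfolding act_bilift
  using bilift_simps[OF modA modH modMK[OF M] modH module_abelian_group[OF modMH[OF M]] act_bibalanced[OF M]]
  by simp_all

lemmas act_simps = act_closed act_add_left act_add_right act_pure

text \<open>Linearity of \<open>f \<otimes> H\<close> over \<open>A \<otimes> H\<close> turns compatibility of a coaction with the action of \<open>A\<close> into
  the same statement for its image under \<open>f\<close>.\<close>

lemma act_hom:
  assumes M: "module A M" "module A N" and f: "f \<in> mod_hom A M N"
    and X: "X \<in> carrier AH" and Y: "Y \<in> carrier (MH M)"
  shows "mapH N f (tensor_act K H A M X Y) = tensor_act K H A N X (mapH N f Y)"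
proof -
  note fK = mod_hom_restrict_scalars[OF algA f]
  note t = tensor_map_hom[OF modMK[OF M(1)] modH modMK[OF M(2)] modH fK mod_hom_id]
  note tp = tensor_map_pure_id[OF modMK[OF M(1)] modH modMK[OF M(2)] modH fK, simplified]
  interpret M: module A M by fact
  note s = act_simps[OF M(1)] act_simps[OF M(2)] mod_hom_simps[OF t] tp pure_closed mod_hom_simps[OF f]
  show ?thesis using modA modH X
  proof (induction rule: tensor_induct)
    case X: (pure a g)
    show ?case using modMK[OF M(1)] modH Y
    proof (induction rule: tensor_induct)
      case (pure m h)
      then show ?case using X by (simp add: s)
    next
      case (add x y)
      then show ?case using X by (simp add: s)
    qed
  next
    case (add x y)
    then show ?case using Y by (simp add: s)
  qed
qed

lemma act_regular:
  assumes X: "X \<in> carrier AH" and Y: "Y \<in> carrier AH"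
  shows "tensor_act K H A (regular A) X Y = X \<star> Y"
proof -
  note s = act_simps[OF regular_module[OF A.is_cring], unfolded regular_restrict_tensor[OF algA], simplified]
    amult_simps pure_closed
  show ?thesis using modA modH X
  proof (induction rule: tensor_induct)
    case X: (pure a g)
    show ?case using modA modH Y
      by (induction rule: tensor_induct) (use X in \<open>simp_all add: s H.m_comm\<close>)
  next
    case (add x y)
    then show ?case using Y by (simp add: s)
  qed
qed

lemma act_from_A:
  assumes M: "module A M" and f: "f \<in> mod_hom A (regular A) M"
    and X: "X \<in> carrier AH" and Y: "Y \<in> carrier AH"
  shows "mapH M f (X \<star> Y) = tensor_act K H A M X (mapH M f Y)"
  using act_hom[OF regular_module[OF A.is_cring] M f X] Y
  by (simp add: regular_restrict_tensor[OF algA] act_regular X)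

lemma act_to_A:
  assumes M: "module A M" and f: "f \<in> mod_hom A M (regular A)"
    and X: "X \<in> carrier AH" and Y: "Y \<in> carrier (MH M)"
  shows "tensor_map K A H f id (tensor_act K H A M X Y) = X \<star> tensor_map K A H f id Y"
proof -
  have "tensor_map K A H f id Y \<in> carrier AH"
    using mod_hom_closed[OF tensor_map_hom[OF modMK[OF M] modH modA modH mod_hom_to_regular[OF algA M f] mod_hom_id] Y] .
  thus ?thesis
    using act_hom[OF M regular_module[OF A.is_cring] f X Y]
    by (simp add: regular_restrict_tensor[OF algA] act_regular X)
qed

text \<open>For a coinvariant \<open>b\<close> this computes \<open>\<rho>(b a) = (b \<otimes> 1) \<rho>(a)\<close>, that is, the \<open>B\<close>-linearity of
  \<open>\<rho>\<close>.\<close>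

lemma mult_pure_one:
  assumes b: "b \<in> carrier A" and Y: "Y \<in> carrier AH"
  shows "pure K A H b \<one>\<^bsub>H\<^esub> \<star> Y = tensor_map K A H (\<lambda>a. b \<otimes>\<^bsub>A\<^esub> a) id Y"
proof -
  have f: "(\<lambda>a. b \<otimes>\<^bsub>A\<^esub> a) \<in> mod_hom K A A"
    by (rule mod_homI) (simp_all add: b A.r_distr A_smult_right)
  note t = tensor_map_hom[OF modA modH modA modH f mod_hom_id]
    and tp = tensor_map_pure_id[OF modA modH modA modH f, simplified]
  show ?thesis using modA modH Y
    by (induction rule: tensor_induct)
      (use b in \<open>simp_all add: amult_simps pure_closed tp mod_hom_simps[OF t]\<close>)
qed

end


section \<open>Modules of cosets\<close>

definition transport_module :: "('r, 'm) module \<Rightarrow> ('m \<Rightarrow> 'p) \<Rightarrow> ('r, 'p) module"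
  where "transport_module M f = (let g = inv_into (carrier M) f in
    \<lparr>carrier = f ` carrier M, mult = undefined, one = undefined, zero = f \<zero>\<^bsub>M\<^esub>,
     add = (\<lambda>x y. f (g x \<oplus>\<^bsub>M\<^esub> g y)), smult = (\<lambda>r x. f (r \<odot>\<^bsub>M\<^esub> g x))\<rparr>)"

lemma transport_module:
  assumes "module R M" "inj_on f (carrier M)"
  shows "module R (transport_module M f)" "f \<in> mod_iso R M (transport_module M f)"
proof -
  interpret module R M by fact
  let ?N = "transport_module M f"
  have s: "carrier ?N = f ` carrier M" "\<zero>\<^bsub>?N\<^esub> = f \<zero>\<^bsub>M\<^esub>"
    "x \<in> carrier M \<Longrightarrow> y \<in> carrier M \<Longrightarrow> f x \<oplus>\<^bsub>?N\<^esub> f y = f (x \<oplus>\<^bsub>M\<^esub> y)"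
    "x \<in> carrier M \<Longrightarrow> r \<odot>\<^bsub>?N\<^esub> f x = f (r \<odot>\<^bsub>M\<^esub> x)" for x y r
    by (simp_all add: transport_module_def Let_def inv_into_f_f[OF assms(2)])
  have "abelian_group ?N"
  proof (rule abelian_groupI)
    fix x assume "x \<in> carrier ?N"
    then obtain m where "m \<in> carrier M" "x = f m" by (auto simp: s)
    thus "\<exists>y\<in>carrier ?N. y \<oplus>\<^bsub>?N\<^esub> x = \<zero>\<^bsub>?N\<^esub>"
      by (intro bexI[of _ "f (\<ominus>\<^bsub>M\<^esub> m)"]) (simp_all add: s M.l_neg)
  qed (auto simp: s M.a_ac)
  thus "module R ?N"
    by (intro moduleI) (auto simp: s smult_l_distr smult_r_distr smult_assoc1 is_cring)
  show "f \<in> mod_iso R M ?N"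
    using assms(2) by (auto simp: mod_iso_def s bij_betw_def intro!: mod_homI)
qed

text \<open>An element is named by the set of all its coordinate vectors with respect to the generators.  These
  sets are nonempty, and two different elements never share a vector.\<close>

lemma finitely_generated_coset_iso:
  fixes M :: "('r, 'm) module"
  assumes "module R M"
    and gen: "\<And>m. m \<in> carrier M \<Longrightarrow> \<exists>c. (\<forall>d\<in>set ds. c d \<in> carrier R) \<and> m = lsum M (\<lambda>d. c d \<odot>\<^bsub>M\<^esub> p d) ds"
  shows "\<exists>(N :: ('r, 'r coset) module) f. module R N \<and> f \<in> mod_iso R M N"
proof -
  interpret module R M by fact
  define f :: "'m \<Rightarrow> 'r coset" where
    "f m = {v. (\<forall>i<length ds. v i \<in> carrier R) \<and> m = lsum M (\<lambda>i. v i \<odot>\<^bsub>M\<^esub> p (ds ! i)) [0..<length ds]}" for m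
  have ne: "f m \<noteq> {}" if m: "m \<in> carrier M" for m
  proof -
    from gen[OF m] obtain c where c: "\<forall>d\<in>set ds. c d \<in> carrier R" "m = lsum M (\<lambda>d. c d \<odot>\<^bsub>M\<^esub> p d) ds"
      by blast
    have "m = lsum M (\<lambda>d. c d \<odot>\<^bsub>M\<^esub> p d) (map ((!) ds) [0..<length ds])"
      using c(2) by (simp add: map_nth)
    hence "(\<lambda>i. c (ds ! i)) \<in> f m"
      using c(1) by (simp add: f_def lsum_map)
    thus ?thesis by blast
  qed
  have "inj_on f (carrier M)"
  proof (rule inj_onI)
    fix x y assume "x \<in> carrier M" "y \<in> carrier M" "f x = f y"
    with ne[of x] obtain v where "v \<in> f x" "v \<in> f y" by blast
    thus "x = y" by (simp add: f_def)
  qed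
  from transport_module[OF assms(1) this] show ?thesis by blast
qed

section \<open>Relative Hopf modules\<close>

lemma (in comm_comodule_algebra) pair: "algebra_pair K A H"
  by (simp add: algebra_pair_def A.algebra_axioms H.algebra_axioms)

sublocale comm_comodule_algebra \<subseteq> algebra_pair K A H
  by (rule pair)

context comm_comodule_algebra
begin

lemma epsilon_hom: "\<epsilon> \<in> mod_hom K H (regular K)"
  by (rule counit_linear)

lemma comult_hom: "\<Delta> \<in> mod_hom K H (tensor K H H)"
  using comult_comodule by (simp add: comodule_iff)

lemma rho_hom: "\<rho> \<in> mod_hom K A AH"
  using coaction_comodule by (simp add: comodule_iff)

lemmas rho_simps = mod_hom_simps[OF rho_hom]

lemma rho_at: "a \<in> carrier A \<Longrightarrow> comodule_at K H \<Delta> \<epsilon> A \<rho> a"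
  using coaction_comodule by (simp add: comodule_iff)

lemma rho_mult: "a \<in> carrier A \<Longrightarrow> b \<in> carrier A \<Longrightarrow> \<rho> (a \<otimes>\<^bsub>A\<^esub> b) = \<rho> a \<star> \<rho> b"
  using coaction_ring_hom by (simp add: ring_hom_def)

lemma rho_one: "\<rho> \<one>\<^bsub>A\<^esub> = pure K A H \<one>\<^bsub>A\<^esub> \<one>\<^bsub>H\<^esub>"
  using coaction_ring_hom by (simp add: ring_hom_def)

abbreviation hopf where "hopf \<equiv> rel_hopf_module K H \<Delta> \<epsilon> A \<rho>"
abbreviation hopf_class where "hopf_class \<equiv> rel_hopf_class K H \<Delta> \<epsilon> A \<rho>"
abbreviation jmap where "jmap \<equiv> pic_j K H \<Delta> \<epsilon> A \<rho>"
abbreviation imap where "imap \<equiv> k1_i K H A \<rho>"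
abbreviation hopf_iso where "hopf_iso \<equiv> rel_hopf_iso K H A"

lemma hopfD:
  assumes "hopf (M, \<rho>M)"
  shows "module A M" "\<rho>M \<in> mod_hom K (MK M) (MH M)"
    "\<And>m. m \<in> carrier M \<Longrightarrow> comodule_at K H \<Delta> \<epsilon> (MK M) \<rho>M m"
    "\<And>a m. a \<in> carrier A \<Longrightarrow> m \<in> carrier M \<Longrightarrow> \<rho>M (a \<odot>\<^bsub>M\<^esub> m) = tensor_act K H A M (\<rho> a) (\<rho>M m)"
  using assms by (simp_all add: rel_hopf_module_def comodule_iff)

lemma coaction_simps:
  assumes "hopf (M, \<rho>M)"
  shows "m \<in> carrier M \<Longrightarrow> \<rho>M m \<in> carrier (MH M)"
    "m \<in> carrier M \<Longrightarrow> m' \<in> carrier M \<Longrightarrow> \<rho>M (m \<oplus>\<^bsub>M\<^esub> m') = \<rho>M m \<oplus>\<^bsub>MH M\<^esub> \<rho>M m'"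
  using mod_hom_closed[OF hopfD(2)[OF assms]] mod_hom_add[OF hopfD(2)[OF assms]] by simp_all

lemma hopf_isoI:
  assumes "f \<in> mod_iso A M N"
    "\<And>m. m \<in> carrier M \<Longrightarrow> \<rho>N (f m) = mapH N f (\<rho>M m)"
  shows "f \<in> hopf_iso (M, \<rho>M) (N, \<rho>N)"
  using assms by (simp add: rel_hopf_iso_def)

lemma hopf_isoD:
  assumes "f \<in> hopf_iso (M, \<rho>M) (N, \<rho>N)"
  shows "f \<in> mod_iso A M N"
    "\<And>m. m \<in> carrier M \<Longrightarrow> \<rho>N (f m) = mapH N f (\<rho>M m)"
  using assms by (simp_all add: rel_hopf_iso_def)

lemma MH_map_hom:
  assumes "module A M" "module A N" "f \<in> mod_hom A M N"
  shows "mapH N f \<in> mod_hom K (MH M) (MH N)"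
  by (rule tensor_map_hom[OF modMK[OF assms(1)] modH modMK[OF assms(2)] modH
        mod_hom_restrict_scalars[OF algA assms(3)] mod_hom_id])

lemma MH_map_comp:
  assumes "module A M" "module A N" "module A P" "f \<in> mod_hom A M N" "g \<in> mod_hom A N P" "x \<in> carrier (MH M)"
  shows "mapH P g (mapH N f x) = mapH P (g \<circ> f) x"
  using tensor_map_comp[OF modMK[OF assms(1)] modH modMK[OF assms(2)] modH modMK[OF assms(3)] modH
        mod_hom_restrict_scalars[OF algA assms(4)] mod_hom_id mod_hom_restrict_scalars[OF algA assms(5)] mod_hom_id assms(6)]
  by simp

lemma MH_map_cong:
  assumes "module A M" "x \<in> carrier (MH M)" "\<And>m. m \<in> carrier M \<Longrightarrow> f m = g m"
  shows "tensor_map K N H f id x = tensor_map K N H g id x"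
  by (rule tensor_map_cong[OF modMK[OF assms(1)] modH assms(2)]) (simp_all add: assms(3))

text \<open>Composition and inversion are stated for arbitrary maps into the right tensor product in place of
  coactions, since they are applied to \<open>M \<otimes>\<^sub>A N\<close> and to \<open>A\<close> with the map \<open>a \<mapsto> X \<rho>(a)\<close>.\<close>

lemma hopf_iso_comp:
  assumes "module A M" "module A N" "module A P"
    and coaction: "\<And>m. m \<in> carrier M \<Longrightarrow> \<rho>M m \<in> carrier (MH M)"
    and f: "f \<in> hopf_iso (M, \<rho>M) (N, \<rho>N)" and g: "g \<in> hopf_iso (N, \<rho>N) (P, \<rho>P)"
  shows "g \<circ> f \<in> hopf_iso (M, \<rho>M) (P, \<rho>P)"
proof (rule hopf_isoI)
  note f' = hopf_isoD[OF f] and g' = hopf_isoD[OF g]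
  show "g \<circ> f \<in> mod_iso A M P" by (rule mod_iso_comp[OF f'(1) g'(1)])
  fix m assume m: "m \<in> carrier M"
  show "\<rho>P ((g \<circ> f) m) = mapH P (g \<circ> f) (\<rho>M m)"
    using m mod_hom_closed[OF mod_iso_hom[OF f'(1)]]
    by (simp add: comp_apply g'(2) f'(2) MH_map_comp[OF assms(1-3) mod_iso_hom[OF f'(1)] mod_iso_hom[OF g'(1)]] coaction)
qed

lemma hopf_iso_inv:
  assumes "module A M" "module A N"
    and coaction: "\<And>m. m \<in> carrier M \<Longrightarrow> \<rho>M m \<in> carrier (MH M)"
    and f: "f \<in> hopf_iso (M, \<rho>M) (N, \<rho>N)"
  shows "inv_into (carrier M) f \<in> hopf_iso (N, \<rho>N) (M, \<rho>M)"
proof (rule hopf_isoI)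
  note f' = hopf_isoD[OF f]
  let ?g = "inv_into (carrier M) f"
  show g: "?g \<in> mod_iso A N M" by (rule mod_iso_inv[OF f'(1) assms(1)])
  fix n assume n: "n \<in> carrier N"
  have gn: "?g n \<in> carrier M" by (rule mod_iso_inv_closed[OF f'(1) n])
  have "\<rho>N n = \<rho>N (f (?g n))" by (simp add: mod_iso_inv_right[OF f'(1) n])
  also have "\<dots> = mapH N f (\<rho>M (?g n))" by (rule f'(2)[OF gn])
  finally have "mapH M ?g (\<rho>N n) = mapH M (?g \<circ> f) (\<rho>M (?g n))"
    by (simp add: MH_map_comp[OF assms(1,2,1) mod_iso_hom[OF f'(1)] mod_iso_hom[OF g]] coaction gn)
  also have "\<dots> = mapH M id (\<rho>M (?g n))"
    by (rule MH_map_cong[OF assms(1) coaction[OF gn]]) (simp add: comp_apply id_apply mod_iso_inv_left[OF f'(1)])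
  finally show "\<rho>M (?g n) = mapH M ?g (\<rho>N n)"
    by (simp add: tensor_map_id[OF modMK[OF assms(1)] modH coaction[OF gn]])
qed

lemma rel_hopf_class_eq:
  assumes M: "hopf (M, \<rho>M)" and N: "hopf (N, \<rho>N)" and f: "f \<in> hopf_iso (M, \<rho>M) (N, \<rho>N)"
  shows "hopf_class (M, \<rho>M) = hopf_class (N, \<rho>N)"
proof -
  note M' = hopfD(1)[OF M] coaction_simps(1)[OF M] and N' = hopfD(1)[OF N] coaction_simps(1)[OF N]
  note g = hopf_iso_inv[OF M'(1) N'(1) M'(2) f]
  have "hopf_iso (M, \<rho>M) (P, \<rho>P) \<noteq> {} \<longleftrightarrow> hopf_iso (N, \<rho>N) (P, \<rho>P) \<noteq> {}" if P: "hopf (P, \<rho>P)" for P \<rho>P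
    using hopf_iso_comp[OF M'(1) N'(1) hopfD(1)[OF P] M'(2) f]
      hopf_iso_comp[OF N'(1) M'(1) hopfD(1)[OF P] N'(2) g] by blast
  thus ?thesis by (auto simp: rel_hopf_class_def)
qed

text \<open>The new coaction is forced by colinearity of \<open>f\<close>; the comodule axioms follow from
  \<open>comodule_at_image\<close>, as \<open>f\<close> is onto.\<close>

lemma hopf_transport:
  assumes M: "hopf (M, \<rho>M)" and N: "module A N" and f: "f \<in> mod_iso A M N"
  defines "\<rho>N \<equiv> \<lambda>n. mapH N f (\<rho>M (inv_into (carrier M) f n))"
  shows "hopf (N, \<rho>N)" "f \<in> hopf_iso (M, \<rho>M) (N, \<rho>N)"
proof -
  note M' = hopfD[OF M]
  note cl = coaction_simps[OF M]
  let ?g = "inv_into (carrier M) f"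
  note g = mod_iso_inv[OF f M'(1)]
  note fh = mod_iso_hom[OF f] and gh = mod_iso_hom[OF g]
  have "?g \<in> mod_hom K (MK N) (MK M)" by (rule mod_hom_restrict_scalars[OF algA gh])
  from mod_hom_comp[OF mod_hom_comp[OF this M'(2)] MH_map_hom[OF M'(1) N fh]]
  have rN: "\<rho>N \<in> mod_hom K (MK N) (MH N)"
    by (simp add: \<rho>N_def comp_def)
  have col: "\<rho>N (f m) = mapH N f (\<rho>M m)" if "m \<in> carrier M" for m
    using that by (simp add: \<rho>N_def mod_iso_inv_left[OF f])
  show "f \<in> hopf_iso (M, \<rho>M) (N, \<rho>N)" by (intro hopf_isoI f col)
  have at: "comodule_at K H \<Delta> \<epsilon> (MK N) \<rho>N n" if n: "n \<in> carrier N" for n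
  proof -
    have "?g n \<in> carrier M" by (rule mod_iso_inv_closed[OF f n])
    with comodule_at_image[OF modMK[OF M'(1)] modMK[OF N] modH mod_hom_restrict_scalars[OF algA fh]
        M'(2) rN comult_hom epsilon_hom _ _ M'(3), of "?g n"]
    show ?thesis by (simp add: col mod_iso_inv_right[OF f n])
  qed
  have "\<rho>N (a \<odot>\<^bsub>N\<^esub> n) = tensor_act K H A N (\<rho> a) (\<rho>N n)" if a: "a \<in> carrier A" and n: "n \<in> carrier N" for a n
  proof -
    have gn: "?g n \<in> carrier M" by (rule mod_iso_inv_closed[OF f n])
    have "\<rho>N (a \<odot>\<^bsub>N\<^esub> n) = mapH N f (tensor_act K H A M (\<rho> a) (\<rho>M (?g n)))"
      using a n gn by (simp add: \<rho>N_def mod_hom_smult[OF gh] M'(4))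
    thus ?thesis
      using a n gn by (simp add: \<rho>N_def act_hom[OF M'(1) N fh] rho_simps cl)
  qed
  with N rN at modMK[OF N] show "hopf (N, \<rho>N)"
    by (simp add: rel_hopf_module_def comodule_iff)
qed

subsection \<open>The coaction on \<open>M \<otimes>\<^sub>A N\<close>\<close>

text \<open>The map \<open>(m \<otimes> h, n \<otimes> g) \<mapsto> (m \<otimes> n) \<otimes> h g\<close>; the coaction of \<open>M \<otimes>\<^sub>A N\<close> is its value at a
  pair of coactions.\<close>

definition diag where
  "diag M N = bilift (MH (tensor A M N))
    (\<lambda>m h n g. pure K (MK (tensor A M N)) H (pure A M N m n) (h \<otimes>\<^bsub>H\<^esub> g))"

abbreviation tensor_coaction where
  "tensor_coaction M \<rho>M N \<rho>N \<equiv> tensor_lift (MH (tensor A M N)) (\<lambda>m n. diag M N (\<rho>M m) (\<rho>N n))"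

lemma rel_hopf_tensor_eq:
  "rel_hopf_tensor K H A (M, \<rho>M) (N, \<rho>N) =
    (tensor A M N, tensor_coaction M \<rho>M N \<rho>N)"
  by (simp add: rel_hopf_tensor_def Let_def diag_def bilift_def)

lemma diag_bibalanced:
  assumes M: "module A M" and N: "module A N"
  shows "bibalanced K (MK M) H (MK N) H (MH (tensor A M N))
    (\<lambda>m h n g. pure K (MK (tensor A M N)) H (pure A M N m n) (h \<otimes>\<^bsub>H\<^esub> g))"
proof -
  interpret M: module A M by fact
  interpret N: module A N by fact
  note P = tensor_module[OF M N]
  interpret P: module A "tensor A M N" by (rule P)
  note mk = modMK[OF P]
  note b = pure_balanced[OF mk modH, symmetric, simplified]
  show ?thesis
  unfolding bibalanced_def
  by (intro conjI ballI balanced_mapI)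
    (simp_all add: pure_closed pure_add_left[OF mk modH, simplified] pure_add_right[OF mk modH]
      pure_add_left[OF M N] pure_add_right[OF M N]
      H.l_distr H.r_distr H_smult_right H.smult_assoc2 b pure_balanced[OF M N, symmetric]
      pure_smult[OF M N])
qed

lemma
  assumes M: "module A M" and N: "module A N"
  shows diag_closed: "X \<in> carrier (MH M) \<Longrightarrow> Y \<in> carrier (MH N) \<Longrightarrow> diag M N X Y \<in> carrier (MH (tensor A M N))"
    and diag_add_left: "X \<in> carrier (MH M) \<Longrightarrow> X' \<in> carrier (MH M) \<Longrightarrow> Y \<in> carrier (MH N) \<Longrightarrow>
      diag M N (X \<oplus>\<^bsub>MH M\<^esub> X') Y = diag M N X Y \<oplus>\<^bsub>MH (tensor A M N)\<^esub> diag M N X' Y"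
    and diag_add_right: "X \<in> carrier (MH M) \<Longrightarrow> Y \<in> carrier (MH N) \<Longrightarrow> Y' \<in> carrier (MH N) \<Longrightarrow>
      diag M N X (Y \<oplus>\<^bsub>MH N\<^esub> Y') = diag M N X Y \<oplus>\<^bsub>MH (tensor A M N)\<^esub> diag M N X Y'"
    and diag_pure: "m \<in> carrier M \<Longrightarrow> h \<in> carrier H \<Longrightarrow> n \<in> carrier N \<Longrightarrow> g \<in> carrier H \<Longrightarrow>
      diag M N (pure K (MK M) H m h) (pure K (MK N) H n g) =
        pure K (MK (tensor A M N)) H (pure A M N m n) (h \<otimes>\<^bsub>H\<^esub> g)"
  unfolding diag_def
  using bilift_simps[OF modMK[OF M] modH modMK[OF N] modH module_abelian_group[OF modMH[OF tensor_module[OF M N]]]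
      diag_bibalanced[OF M N]]
  by simp_all

lemmas diag_simps = diag_closed diag_add_left diag_add_right diag_pure

text \<open>Together with \<open>\<rho>(a m) = \<rho>(a) \<rho>(m)\<close> this makes the coaction of \<open>M \<otimes>\<^sub>A N\<close> balanced over \<open>A\<close>.\<close>

lemma diag_act:
  assumes M: "module A M" and N: "module A N"
    and X: "X \<in> carrier AH" and Y: "Y \<in> carrier (MH M)" and Z: "Z \<in> carrier (MH N)"
  shows "diag M N (tensor_act K H A M X Y) Z = diag M N Y (tensor_act K H A N X Z)"
proof -
  interpret M: module A M by fact
  interpret N: module A N by fact
  note s = act_simps[OF M] act_simps[OF N] diag_simps[OF M N] pure_closed
  show ?thesis using modA modH X
  proof (induction rule: tensor_induct)
    case X: (pure a k)
    show ?case using modMK[OF M] modH Y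
    proof (induction rule: tensor_induct)
      case Y: (pure m h)
      show ?case using modMK[OF N] modH Z
      proof (induction rule: tensor_induct)
        case (pure n g)
        then show ?case using X Y
          by (simp add: s pure_balanced[OF M N] H.m_ac)
      next
        case (add x y)
        then show ?case using X Y by (simp add: s)
      qed
    next
      case (add x y)
      then show ?case using X Z by (simp add: s)
    qed
  next
    case (add x y)
    then show ?case using Y Z by (simp add: s)
  qed
qed

lemma hopf_tensor_balanced:
  assumes M: "hopf (M, \<rho>M)" and N: "hopf (N, \<rho>N)"
  shows "balanced_map A M N (MH (tensor A M N)) (\<lambda>m n. diag M N (\<rho>M m) (\<rho>N n))"
proof -
  note M' = hopfD(1)[OF M] and N' = hopfD(1)[OF N]
  show ?thesis
    by (rule balanced_mapI)
      (simp_all add: diag_closed[OF M' N'] diag_add_left[OF M' N'] diag_add_right[OF M' N']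
        coaction_simps[OF M] coaction_simps[OF N] hopfD(4)[OF M] hopfD(4)[OF N] diag_act[OF M' N'] rho_simps)
qed

lemma
  assumes M: "hopf (M, \<rho>M)" and N: "hopf (N, \<rho>N)"
  shows tensor_coaction_additive: "tensor_coaction M \<rho>M N \<rho>N \<in>
      additive_maps (tensor A M N) (MH (tensor A M N))"
    and tensor_coaction_pure: "m \<in> carrier M \<Longrightarrow> n \<in> carrier N \<Longrightarrow>
      tensor_coaction M \<rho>M N \<rho>N (pure A M N m n) = diag M N (\<rho>M m) (\<rho>N n)"
  using tensor_lift_additive[OF hopfD(1)[OF M] hopfD(1)[OF N]
      module_abelian_group[OF modMH[OF tensor_module[OF hopfD(1)[OF M] hopfD(1)[OF N]]]] hopf_tensor_balanced[OF M N]]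
    tensor_lift_pure[OF hopfD(1)[OF M] hopfD(1)[OF N]
      module_abelian_group[OF modMH[OF tensor_module[OF hopfD(1)[OF M] hopfD(1)[OF N]]]] hopf_tensor_balanced[OF M N]]
  by simp_all

lemma hopf_tensor_iso:
  assumes M: "hopf (M, \<rho>M)" and N: "hopf (N, \<rho>N)" and M': "hopf (M', \<rho>M')" and N': "hopf (N', \<rho>N')"
    and f: "f \<in> hopf_iso (M, \<rho>M) (M', \<rho>M')" and g: "g \<in> hopf_iso (N, \<rho>N) (N', \<rho>N')"
  shows "tensor_map A M' N' f g \<in> hopf_iso (rel_hopf_tensor K H A (M, \<rho>M) (N, \<rho>N))
    (rel_hopf_tensor K H A (M', \<rho>M') (N', \<rho>N'))"
  unfolding rel_hopf_tensor_eq
proof (rule hopf_isoI)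
  note m = hopfD(1)[OF M] hopfD(1)[OF N] hopfD(1)[OF M'] hopfD(1)[OF N']
  note f' = hopf_isoD[OF f] and g' = hopf_isoD[OF g]
  note fh = mod_iso_hom[OF f'(1)] and gh = mod_iso_hom[OF g'(1)]
  show F: "tensor_map A M' N' f g \<in> mod_iso A (tensor A M N) (tensor A M' N')"
    by (rule tensor_map_iso[OF m f'(1) g'(1)])
  note Fh = mod_iso_hom[OF F]
  note T = tensor_module[OF m(1,2)] and T' = tensor_module[OF m(3,4)]
  note FH = MH_map_hom[OF T T' Fh]
  note cp = tensor_coaction_pure[OF M N] tensor_coaction_pure[OF M' N']
  note ca = tensor_coaction_additive[OF M N] tensor_coaction_additive[OF M' N']
  note MHf = mod_hom_simps[OF MH_map_hom[OF m(1,3) fh]] and MHg = mod_hom_simps[OF MH_map_hom[OF m(2,4) gh]]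
  note tp = tensor_map_pure_id[OF modMK[OF m(1)] modH modMK[OF m(3)] modH mod_hom_restrict_scalars[OF algA fh], simplified]
    tensor_map_pure_id[OF modMK[OF m(2)] modH modMK[OF m(4)] modH mod_hom_restrict_scalars[OF algA gh], simplified]
    tensor_map_pure_id[OF modMK[OF T] modH modMK[OF T'] modH mod_hom_restrict_scalars[OF algA Fh], simplified]
    tensor_map_pure[OF m fh gh]
  note s = diag_simps[OF m(1,2)]
    diag_simps[OF m(3,4)]
    pure_closed MHf MHg tp mod_hom_simps[OF FH] mod_hom_closed[OF fh] mod_hom_closed[OF gh]
  have d: "diag M' N' (mapH M' f X) (mapH N' g Y) =
      mapH (tensor A M' N') (tensor_map A M' N' f g) (diag M N X Y)"
    if X: "X \<in> carrier (MH M)" and Y: "Y \<in> carrier (MH N)" for X Y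
    using modMK[OF m(1)] modH X
  proof (induction rule: tensor_induct)
    case X: (pure m' h)
    show ?case using modMK[OF m(2)] modH Y
    proof (induction rule: tensor_induct)
      case (pure n g)
      then show ?case using X by (simp add: s)
    next
      case (add x y)
      then show ?case using X by (simp add: s)
    qed
  next
    case (add x y)
    then show ?case using Y by (simp add: s)
  qed
  fix x assume x: "x \<in> carrier (tensor A M N)"
  let ?c = "tensor_coaction M \<rho>M N \<rho>N"
  let ?c' = "tensor_coaction M' \<rho>M' N' \<rho>N'"
  show "?c' (tensor_map A M' N' f g x) =
    mapH (tensor A M' N') (tensor_map A M' N' f g) (?c x)"
    using m(1,2) x
  proof (induction rule: tensor_induct)
    case (pure m n)
    then show ?case
      by (simp add: tp cp mod_hom_closed[OF fh] mod_hom_closed[OF gh] f'(2) g'(2) d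
          coaction_simps(1)[OF M] coaction_simps(1)[OF N])
  next
    case (add x y)
    then show ?case
      by (simp add: mod_hom_simps[OF Fh] additive_maps_add[OF ca(1)] additive_maps_add[OF ca(2)]
          additive_maps_closed[OF ca(1)] mod_hom_simps[OF FH])
  qed
qed

end


section \<open>Invertible modules have dual bases\<close>

lemma lsum_smult_scalars:
  assumes "module R M" "m \<in> carrier M" "\<And>x. x \<in> set xs \<Longrightarrow> f x \<in> carrier R"
  shows "lsum M (\<lambda>x. f x \<odot>\<^bsub>M\<^esub> m) xs = lsum R f xs \<odot>\<^bsub>M\<^esub> m"
proof -
  interpret module R M by fact
  have "(\<lambda>r. r \<odot>\<^bsub>M\<^esub> m) \<in> additive_maps R M"
    using assms(2) by (intro additive_mapsI) (simp_all add: smult_l_distr)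
  from additive_maps_lsum[OF this R.abelian_group_axioms M.abelian_group_axioms, of xs f]
  show ?thesis using assms(3) by simp
qed

definition dual_basis where
  "dual_basis R N ds \<longleftrightarrow> (\<forall>(f, p)\<in>set ds. f \<in> mod_hom R N (regular R) \<and> p \<in> carrier N) \<and>
    (\<forall>n\<in>carrier N. n = lsum N (\<lambda>(f, p). f n \<odot>\<^bsub>N\<^esub> p) ds)"

lemma dual_basisD:
  assumes "dual_basis R N ds"
  shows "(f, p) \<in> set ds \<Longrightarrow> f \<in> mod_hom R N (regular R)" "(f, p) \<in> set ds \<Longrightarrow> p \<in> carrier N"
    "n \<in> carrier N \<Longrightarrow> lsum N (\<lambda>(f, p). f n \<odot>\<^bsub>N\<^esub> p) ds = n"
  using assms by (auto simp: dual_basis_def)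

lemma pairing_unit:
  assumes "module R M" "module R N" "\<phi> \<in> mod_iso R (tensor R M N) (regular R)"
  obtains es where "es \<in> tensor_words M N" "\<phi> (tensor_class R M N es) = \<one>\<^bsub>R\<^esub>"
proof -
  interpret M: module R M by fact
  have "\<one>\<^bsub>R\<^esub> \<in> \<phi> ` carrier (tensor R M N)"
    using mod_iso_bij[OF assms(3)] by (simp add: bij_betw_def)
  then obtain x where x: "x \<in> carrier (tensor R M N)" "\<phi> x = \<one>\<^bsub>R\<^esub>" by auto
  from x(1) obtain es where "es \<in> tensor_words M N" "x = tensor_class R M N es"
    by (rule tensor_repE)
  with x(2) show thesis using that by blast
qed

text \<open>Let \<open>e\<close> be the tensor with \<open>\<phi>(e) = 1\<close>.  Then \<open>m \<otimes> n\<close> and \<open>\<phi>(m \<otimes> n) e\<close> have the same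
  image under \<open>\<phi>\<close>, hence are equal.  So every bilinear map out of \<open>M\<close> and \<open>N\<close> is determined by the
  value at \<open>e\<close> of the linear map it induces.\<close>

lemma pairing_universal:
  assumes mods: "module R M" "module R N" "module R Q"
    and \<phi>: "\<phi> \<in> mod_iso R (tensor R M N) (regular R)"
    and es: "es \<in> tensor_words M N" "\<phi> (tensor_class R M N es) = \<one>\<^bsub>R\<^esub>"
    and g: "balanced_map R M N Q g"
      "\<And>r m n. r \<in> carrier R \<Longrightarrow> m \<in> carrier M \<Longrightarrow> n \<in> carrier N \<Longrightarrow> g (r \<odot>\<^bsub>M\<^esub> m) n = r \<odot>\<^bsub>Q\<^esub> g m n"
    and mn: "m \<in> carrier M" "n \<in> carrier N"
  shows "g m n = \<phi> (pure R M N m n) \<odot>\<^bsub>Q\<^esub> lsum Q (\<lambda>(m, n). g m n) es"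
proof -
  interpret M: module R M by fact
  interpret T: module R "tensor R M N" by (rule tensor_module[OF mods(1,2)])
  let ?e = "tensor_class R M N es"
  note h = mod_hom_simps[OF mod_iso_hom[OF \<phi>], simplified]
  have e: "?e \<in> carrier (tensor R M N)" by (rule tensor_class_closed[OF es(1)])
  have p: "pure R M N m n \<in> carrier (tensor R M N)" using mn by (rule pure_closed)
  have "\<phi> (\<phi> (pure R M N m n) \<odot>\<^bsub>tensor R M N\<^esub> ?e) = \<phi> (pure R M N m n)"
    using e p es(2) by (simp add: h)
  hence eq: "\<phi> (pure R M N m n) \<odot>\<^bsub>tensor R M N\<^esub> ?e = pure R M N m n"
    using mod_iso_bij[OF \<phi>] e p h(1) by (auto simp: bij_betw_def inj_on_def)
  note l = tensor_lift_hom[OF mods g]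
  note ag = module_abelian_group[OF mods(3)]
  have "g m n = tensor_lift Q g (pure R M N m n)"
    by (rule tensor_lift_pure[OF mods(1,2) ag g(1) mn, symmetric])
  also have "\<dots> = \<phi> (pure R M N m n) \<odot>\<^bsub>Q\<^esub> tensor_lift Q g ?e"
    by (subst eq[symmetric]) (simp add: mod_hom_smult[OF l] h p e)
  finally show ?thesis by (simp only: tensor_lift_class[OF mods(1,2) ag g(1) es(1)])
qed

text \<open>Summing \<open>s\<^sub>j x = c\<^sub>j(x) w\<^sub>j\<close> over \<open>j\<close> gives \<open>x = \<Sum> c\<^sub>j(x) w\<^sub>j\<close>.\<close>

lemma dual_basis_of_scalars:
  assumes M: "module R M"
    and c: "\<And>j. j \<in> set es \<Longrightarrow> c j \<in> mod_hom R M (regular R)"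
    and w: "\<And>j. j \<in> set es \<Longrightarrow> w j \<in> carrier M"
    and s: "\<And>j. j \<in> set es \<Longrightarrow> s j \<in> carrier R" "lsum R s es = \<one>\<^bsub>R\<^esub>"
    and eq: "\<And>j x. j \<in> set es \<Longrightarrow> x \<in> carrier M \<Longrightarrow> s j \<odot>\<^bsub>M\<^esub> x = c j x \<odot>\<^bsub>M\<^esub> w j"
  shows "dual_basis R M (map (\<lambda>j. (c j, w j)) es)"
proof -
  interpret module R M by fact
  have "n = lsum M (\<lambda>j. c j n \<odot>\<^bsub>M\<^esub> w j) es" if n: "n \<in> carrier M" for n
  proof -
    have "lsum M (\<lambda>j. c j n \<odot>\<^bsub>M\<^esub> w j) es = lsum M (\<lambda>j. s j \<odot>\<^bsub>M\<^esub> n) es"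
      by (rule lsum_cong) (simp add: eq n)
    also have "\<dots> = lsum R s es \<odot>\<^bsub>M\<^esub> n" by (rule lsum_smult_scalars[OF M n s(1)])
    finally show ?thesis using n s(2) by simp
  qed
  thus ?thesis using c w by (auto simp: dual_basis_def lsum_map)
qed

lemma pairing_lsum_unit:
  assumes mods: "module R M" "module R N"
    and \<phi>: "\<phi> \<in> mod_iso R (tensor R M N) (regular R)"
    and es: "es \<in> tensor_words M N" "\<phi> (tensor_class R M N es) = \<one>\<^bsub>R\<^esub>"
  shows "lsum R (\<lambda>(m, n). \<phi> (pure R M N m n)) es = \<one>\<^bsub>R\<^esub>"
proof -
  interpret M: module R M by fact
  interpret T: module R "tensor R M N" by (rule tensor_module[OF mods])
  note h = mod_hom_simps[OF mod_iso_hom[OF \<phi>], simplified]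
  have F: "\<phi> \<in> additive_maps (tensor R M N) R" by (rule additive_mapsI) (simp_all add: h)
  have "\<one>\<^bsub>R\<^esub> = \<phi> (lsum (tensor R M N) (\<lambda>(m, n). pure R M N m n) es)"
    using es by (simp add: tensor_class_lsum[OF mods] del: in_lists_conv_set)
  also have "\<dots> = lsum R (\<lambda>x. \<phi> (case x of (m, n) \<Rightarrow> pure R M N m n)) es"
    by (rule additive_maps_lsum[OF F T.M.abelian_group_axioms M.R.abelian_group_axioms])
      (use es(1) in \<open>auto simp: pure_closed\<close>)
  finally show ?thesis by (simp add: case_prod_beta')
qed

text \<open>Write \<open>b(m, n)\<close> for \<open>\<phi>(m \<otimes> n)\<close> and \<open>\<Sum> m\<^sub>j \<otimes> n\<^sub>j\<close> for the tensor with image \<open>1\<close>.  Applied to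
  \<open>(m, n) \<mapsto> b(m\<^sub>j, n) m\<close>, \<open>pairing_universal\<close> gives \<open>b(m\<^sub>j, n) m = b(m, n) u\<^sub>j\<close> with
  \<open>u\<^sub>j = \<Sum> b(m\<^sub>j, n\<^sub>i) m\<^sub>i\<close>.  At \<open>n = n\<^sub>j\<close> the scalars \<open>b(m\<^sub>j, n\<^sub>j)\<close> add up to \<open>1\<close>, so the
  functionals \<open>b(-, n\<^sub>j)\<close> and the elements \<open>u\<^sub>j\<close> form a dual basis of \<open>M\<close>.  Working with \<open>u\<^sub>j\<close> avoids
  the identity \<open>b(m', n) m = b(m, n) m'\<close>, which would need a local argument.\<close>

lemma
  assumes mods: "module R M" "module R N"
    and \<phi>: "\<phi> \<in> mod_iso R (tensor R M N) (regular R)"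
  shows dual_basis_left: "\<exists>ds. dual_basis R M ds"
    and dual_basis_right: "\<exists>ds. dual_basis R N ds"
proof -
  interpret M: module R M by fact
  interpret N: module R N by fact
  obtain es where es: "es \<in> tensor_words M N" "\<phi> (tensor_class R M N es) = \<one>\<^bsub>R\<^esub>"
    by (rule pairing_unit[OF mods \<phi>])
  let ?b = "\<lambda>m n. \<phi> (pure R M N m n)"
  note h = mod_hom_simps[OF mod_iso_hom[OF \<phi>], simplified]
  have esc: "fst j \<in> carrier M" "snd j \<in> carrier N" if "j \<in> set es" for j
    using es(1) that by auto
  have b: "m \<in> carrier M \<Longrightarrow> n \<in> carrier N \<Longrightarrow> ?b m n \<in> carrier R"
    "m \<in> carrier M \<Longrightarrow> m' \<in> carrier M \<Longrightarrow> n \<in> carrier N \<Longrightarrow> ?b (m \<oplus>\<^bsub>M\<^esub> m') n = ?b m n \<oplus>\<^bsub>R\<^esub> ?b m' n"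
    "m \<in> carrier M \<Longrightarrow> n \<in> carrier N \<Longrightarrow> n' \<in> carrier N \<Longrightarrow> ?b m (n \<oplus>\<^bsub>N\<^esub> n') = ?b m n \<oplus>\<^bsub>R\<^esub> ?b m n'"
    "r \<in> carrier R \<Longrightarrow> m \<in> carrier M \<Longrightarrow> n \<in> carrier N \<Longrightarrow> ?b (r \<odot>\<^bsub>M\<^esub> m) n = r \<otimes>\<^bsub>R\<^esub> ?b m n"
    "r \<in> carrier R \<Longrightarrow> m \<in> carrier M \<Longrightarrow> n \<in> carrier N \<Longrightarrow> ?b m (r \<odot>\<^bsub>N\<^esub> n) = r \<otimes>\<^bsub>R\<^esub> ?b m n" for m m' n n' r
    by (simp_all add: h pure_closed pure_add_left[OF mods] pure_add_right[OF mods] pure_smult[OF mods, symmetric]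
        pure_balanced[OF mods, symmetric])
  have one: "lsum R (\<lambda>j. ?b (fst j) (snd j)) es = \<one>\<^bsub>R\<^esub>"
    using pairing_lsum_unit[OF mods \<phi> es] by (simp add: case_prod_beta')
  have "dual_basis R M (map (\<lambda>j. (\<lambda>x. ?b x (snd j), lsum M (\<lambda>(m, n). ?b (fst j) n \<odot>\<^bsub>M\<^esub> m) es)) es)"
  proof (rule dual_basis_of_scalars[OF mods(1) _ _ _ one])
    fix j x assume j: "j \<in> set es" and x: "x \<in> carrier M"
    note j' = esc[OF j]
    have "balanced_map R M N M (\<lambda>m n. ?b (fst j) n \<odot>\<^bsub>M\<^esub> m)"
      by (rule balanced_mapI)
        (use j' in \<open>simp_all add: b M.smult_l_distr M.smult_r_distr M.smult_assoc1[symmetric] M.m_comm\<close>)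
    from pairing_universal[OF mods mods(1) \<phi> es this _ x j'(2)]
    show "?b (fst j) (snd j) \<odot>\<^bsub>M\<^esub> x = ?b x (snd j) \<odot>\<^bsub>M\<^esub> lsum M (\<lambda>(m, n). ?b (fst j) n \<odot>\<^bsub>M\<^esub> m) es"
      using j' by (simp add: b M.smult_assoc1[symmetric] M.m_comm)
  qed (use esc in \<open>auto simp: b intro!: mod_homI lsum_closed[OF M.M.abelian_group_axioms]\<close>)
  thus "\<exists>ds. dual_basis R M ds" by blast
  have "dual_basis R N (map (\<lambda>j. (\<lambda>x. ?b (fst j) x, lsum N (\<lambda>(m, n). ?b m (snd j) \<odot>\<^bsub>N\<^esub> n) es)) es)"
  proof (rule dual_basis_of_scalars[OF mods(2) _ _ _ one])
    fix j x assume j: "j \<in> set es" and x: "x \<in> carrier N"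
    note j' = esc[OF j]
    have "balanced_map R M N N (\<lambda>m n. ?b m (snd j) \<odot>\<^bsub>N\<^esub> n)"
      by (rule balanced_mapI)
        (use j' in \<open>simp_all add: b N.smult_l_distr N.smult_r_distr N.smult_assoc1[symmetric] M.m_comm\<close>)
    from pairing_universal[OF mods mods(2) \<phi> es this _ j'(1) x]
    show "?b (fst j) (snd j) \<odot>\<^bsub>N\<^esub> x = ?b (fst j) x \<odot>\<^bsub>N\<^esub> lsum N (\<lambda>(m, n). ?b m (snd j) \<odot>\<^bsub>N\<^esub> n) es"
      using j' by (simp add: b N.smult_assoc1[symmetric] M.m_comm)
  qed (use esc in \<open>auto simp: b intro!: mod_homI lsum_closed[OF N.M.abelian_group_axioms]\<close>)
  thus "\<exists>ds. dual_basis R N ds" by blast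
qed

section \<open>Base change from the coinvariants\<close>

context comm_comodule_algebra
begin

abbreviation B where "B \<equiv> coinvariants K H A \<rho>"

lemma B_simps [simp]:
  "zero B = zero A" "add B = add A" "one B = one A" "mult B = mult A"
  by (simp_all add: coinvariants_def)

lemma B_iff: "b \<in> carrier B \<longleftrightarrow> b \<in> carrier A \<and> \<rho> b = pure K A H b \<one>\<^bsub>H\<^esub>"
  by (simp add: coinvariants_def)

lemma B_in_A: "b \<in> carrier B \<Longrightarrow> b \<in> carrier A"
  by (simp add: B_iff)

lemma B_cring: "cring B"
proof -
  have uminus: "\<ominus>\<^bsub>A\<^esub> b \<in> carrier B" if b: "b \<in> carrier B" for b
  proof -
    have "\<ominus>\<^bsub>A\<^esub> b = (\<ominus>\<^bsub>K\<^esub> \<one>\<^bsub>K\<^esub>) \<odot>\<^bsub>A\<^esub> b"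
      using B_in_A[OF b] by (simp add: A.smult_l_minus)
    thus ?thesis using b
      by (simp add: B_iff rho_simps pure_smult[OF modA modH])
  qed
  show ?thesis
  proof (intro cringI abelian_groupI comm_monoidI)
    fix x assume "x \<in> carrier B"
    thus "\<exists>y\<in>carrier B. y \<oplus>\<^bsub>B\<^esub> x = \<zero>\<^bsub>B\<^esub>"
      using uminus by (intro bexI[of _ "\<ominus>\<^bsub>A\<^esub> x"]) (simp_all add: B_in_A A.l_neg)
  qed (simp_all add: B_iff rho_simps rho_mult rho_one amult_simps pure_add_left[OF modA modH]
      additive_maps_zero[OF mod_hom_additive[OF rho_hom] A.abelian_group_axioms module_abelian_group[OF modAH]]
      pure_zero_left[OF modA modH] A.a_ac A.m_ac A.l_distr A.r_distr)
qed

lemma module_B: "module A M \<Longrightarrow> module B M"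
proof -
  assume "module A M"
  then interpret M: module A M .
  show "module B M"
    by (rule moduleI)
      (simp_all add: B_cring M.abelian_group_axioms B_in_A M.smult_l_distr M.smult_r_distr M.smult_assoc1)
qed

lemma modReg: "module A (regular A)"
  by (rule regular_module) (rule A.is_cring)

lemma modBA: "module B (regular A)"
  by (rule module_B[OF modReg])

abbreviation NA where "NA N \<equiv> tensor B N (regular A)"
abbreviation mapA where "mapA N f \<equiv> tensor_map B N (regular A) f id"
abbreviation bc where "bc N \<equiv> base_change B A N"
text \<open>The maps \<open>a \<mapsto> n \<otimes> a\<close> are colinear and \<open>A\<close>-linear, and their images generate \<open>N \<otimes>\<^sub>B A\<close>; the
  coaction of \<open>N \<otimes>\<^sub>B A\<close> is determined by them.\<close>

abbreviation nu :: "('a, 'n) module \<Rightarrow> 'n \<Rightarrow> 'a \<Rightarrow> ('n, 'a) tens" where "nu N \<equiv> pure B N (regular A)"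
abbreviation bco where "bco N \<equiv> base_change_coaction K H A \<rho> B N"

lemma bc_simps [simp]:
  "carrier (bc N) = carrier (NA N)" "zero (bc N) = zero (NA N)"
  "add (bc N) = add (NA N)"
  by (simp_all add: base_change_def)

lemma bc_smult: "a \<odot>\<^bsub>bc N\<^esub> x = tensor_map B N (regular A) id (\<lambda>a'. a \<otimes>\<^bsub>A\<^esub> a') x"
  by (simp add: base_change_def)

lemma amult_hom: "a \<in> carrier A \<Longrightarrow> (\<lambda>a'. a \<otimes>\<^bsub>A\<^esub> a') \<in> mod_hom B (regular A) (regular A)"
  by (rule mod_homI) (simp_all add: A.r_distr B_in_A A.m_lcomm)

lemma
  assumes N: "module B N" and a: "a \<in> carrier A"
  shows bc_smult_pure: "n \<in> carrier N \<Longrightarrow> b \<in> carrier A \<Longrightarrow> a \<odot>\<^bsub>bc N\<^esub> nu N n b = nu N n (a \<otimes>\<^bsub>A\<^esub> b)"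
    and bc_smult_hom: "(\<lambda>x. a \<odot>\<^bsub>bc N\<^esub> x) \<in> mod_hom B (NA N) (NA N)"
  unfolding bc_smult
  using tensor_map_pure[OF N modBA N modBA mod_hom_id amult_hom[OF a]]
    tensor_map_hom[OF N modBA N modBA mod_hom_id amult_hom[OF a]]
  by (simp_all add: id_apply)

lemma bc_module:
  assumes N: "module B N"
  shows "module A (bc N)"
proof -
  interpret N: module B N by fact
  interpret T: module B "NA N" by (rule tensor_module[OF N modBA])
  note s = bc_smult_pure[OF N] mod_hom_simps[OF bc_smult_hom[OF N]] pure_add_right[OF N modBA, simplified]
  show ?thesis
  proof (rule moduleI)
    show "abelian_group (bc N)" by (rule abelian_group_cong[OF T.M.abelian_group_axioms]) simp_all
    fix a b x assume a: "a \<in> carrier A" "b \<in> carrier A" and x: "x \<in> carrier (bc N)"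
    from x have x: "x \<in> carrier (NA N)" by simp
    show "(a \<oplus>\<^bsub>A\<^esub> b) \<odot>\<^bsub>bc N\<^esub> x = a \<odot>\<^bsub>bc N\<^esub> x \<oplus>\<^bsub>bc N\<^esub> b \<odot>\<^bsub>bc N\<^esub> x"
      using N modBA x
      by (induction rule: tensor_induct) (use a in \<open>simp_all add: s A.l_distr T.M.a_ac\<close>)
    show "(a \<otimes>\<^bsub>A\<^esub> b) \<odot>\<^bsub>bc N\<^esub> x = a \<odot>\<^bsub>bc N\<^esub> (b \<odot>\<^bsub>bc N\<^esub> x)"
      using N modBA x
      by (induction rule: tensor_induct) (use a in \<open>simp_all add: s A.m_assoc\<close>)
  next
    fix x assume x: "x \<in> carrier (bc N)"
    from x have x: "x \<in> carrier (NA N)" by simp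
    show "\<one>\<^bsub>A\<^esub> \<odot>\<^bsub>bc N\<^esub> x = x"
      using N modBA x by (induction rule: tensor_induct) (simp_all add: s)
  qed (simp_all add: A.is_cring s)
qed

lemma nu_hom:
  assumes N: "module B N" and n: "n \<in> carrier N"
  shows "nu N n \<in> mod_hom A (regular A) (bc N)"
  by (rule mod_homI) (simp_all add: n pure_closed pure_add_right[OF N modBA, simplified] bc_smult_pure[OF N])

lemmas nu_hom_K = mod_hom_from_regular[OF algA nu_hom]

lemma nu_map_hom:
  assumes "module B N" "n \<in> carrier N"
  shows "mapH (bc N) (nu N n) \<in> mod_hom K AH (MH (bc N))"
  by (rule tensor_map_hom[OF modA modH modMK[OF bc_module[OF assms(1)]] modH nu_hom_K[OF assms] mod_hom_id])

lemma nu_map_pure: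
  assumes "module B N" "n \<in> carrier N" "a \<in> carrier A" "h \<in> carrier H"
  shows "mapH (bc N) (nu N n) (pure K A H a h) = pure K (MK (bc N)) H (nu N n a) h"
  by (rule tensor_map_pure_id[OF modA modH modMK[OF bc_module[OF assms(1)]] modH nu_hom_K[OF assms(1,2)] assms(3,4)])

text \<open>Balancedness over \<open>B\<close> comes from \<open>\<rho>(b a) = (b \<otimes> 1) \<rho>(a)\<close> for \<open>b\<close> in \<open>B\<close>.\<close>

lemma bco_balanced:
  assumes N: "module B N"
  shows "balanced_map B N (regular A) (MH (bc N)) (\<lambda>n a. mapH (bc N) (nu N n) (\<rho> a))"
proof (rule balanced_mapI)
  interpret N: module B N by fact
  note m = bc_module[OF N]
  interpret MH: module K "MH (bc N)" by (rule modMH[OF m])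
  note t = mod_hom_simps[OF nu_map_hom[OF N]] nu_map_pure[OF N]
  fix n a assume n: "n \<in> carrier N" and "a \<in> carrier (regular A)"
  hence a: "a \<in> carrier A" by simp
  show "mapH (bc N) (nu N n) (\<rho> a) \<in> carrier (MH (bc N))"
    using n a by (simp add: t rho_simps)
  show "mapH (bc N) (nu N n) (\<rho> (a \<oplus>\<^bsub>regular A\<^esub> a')) =
    mapH (bc N) (nu N n) (\<rho> a) \<oplus>\<^bsub>MH (bc N)\<^esub> mapH (bc N) (nu N n) (\<rho> a')"
    if "a' \<in> carrier (regular A)" for a'
    using n a that by (simp add: t rho_simps)
  show "mapH (bc N) (nu N (n \<oplus>\<^bsub>N\<^esub> n')) (\<rho> a) =
    mapH (bc N) (nu N n) (\<rho> a) \<oplus>\<^bsub>MH (bc N)\<^esub> mapH (bc N) (nu N n') (\<rho> a)"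
    if n': "n' \<in> carrier N" for n'
  proof -
    have "\<rho> a \<in> carrier AH" using a by (simp add: rho_simps)
    with modA modH show ?thesis
    proof (induction rule: tensor_induct)
      case (pure a h)
      then show ?case using n n'
        by (simp add: t pure_add_left[OF N modBA, simplified] pure_add_left[OF modMK[OF m] modH, simplified] pure_closed)
    next
      case (add x y)
      then show ?case using n n' by (simp add: t MH.M.a_ac)
    qed
  qed
  fix b assume b: "b \<in> carrier B"
  hence bA: "b \<in> carrier A" by (rule B_in_A)
  have "mapH (bc N) (nu N (b \<odot>\<^bsub>N\<^esub> n)) (\<rho> a) =
      tensor_map K (MK (bc N)) H (nu N n \<circ> (\<lambda>a'. b \<otimes>\<^bsub>A\<^esub> a')) (id \<circ> id) (\<rho> a)"
    by (rule tensor_map_cong[OF modA modH])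
      (use n a b in \<open>simp_all add: rho_simps comp_apply pure_balanced[OF N modBA, simplified]\<close>)
  also have "\<dots> = mapH (bc N) (nu N n) (tensor_map K A H (\<lambda>a'. b \<otimes>\<^bsub>A\<^esub> a') id (\<rho> a))"
  proof (rule tensor_map_comp[OF modA modH modA modH modMK[OF m] modH _ mod_hom_id nu_hom_K[OF N n] mod_hom_id, symmetric])
    show "(\<lambda>a'. b \<otimes>\<^bsub>A\<^esub> a') \<in> mod_hom K A A"
      using bA by (intro mod_homI) (simp_all add: A.r_distr A_smult_right)
  qed (simp add: rho_simps a)
  also have "tensor_map K A H (\<lambda>a'. b \<otimes>\<^bsub>A\<^esub> a') id (\<rho> a) = \<rho> (b \<otimes>\<^bsub>A\<^esub> a)"
    using b a by (simp add: rho_mult B_iff mult_pure_one rho_simps)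
  finally show "mapH (bc N) (nu N (b \<odot>\<^bsub>N\<^esub> n)) (\<rho> a) =
      mapH (bc N) (nu N n) (\<rho> (b \<odot>\<^bsub>regular A\<^esub> a))"
    by simp
qed

lemma bco_eq:
  "bco N = tensor_lift (MH (bc N)) (\<lambda>n a. mapH (bc N) (nu N n) (\<rho> a))"
  by (simp add: base_change_coaction_def Let_def)

lemma bco_additive:
  assumes N: "module B N"
  shows "bco N \<in> additive_maps (NA N) (MH (bc N))"
  unfolding bco_eq
  by (rule tensor_lift_additive[OF N modBA module_abelian_group[OF modMH[OF bc_module[OF N]]] bco_balanced[OF N]])

lemma bco_pure:
  assumes N: "module B N" and n: "n \<in> carrier N" and a: "a \<in> carrier A"
  shows "bco N (nu N n a) = mapH (bc N) (nu N n) (\<rho> a)"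
  unfolding bco_eq
  by (rule tensor_lift_pure[OF N modBA module_abelian_group[OF modMH[OF bc_module[OF N]]] bco_balanced[OF N]])
    (simp_all add: n a)

text \<open>All axioms are inherited from \<open>A\<close> along the maps \<open>a \<mapsto> n \<otimes> a\<close>.\<close>

lemma bc_hopf:
  assumes N: "module B N"
  shows "hopf (bc N, bco N)"
proof -
  note m = bc_module[OF N]
  interpret bc: module A "bc N" by (rule m)
  interpret MH: module K "MH (bc N)" by (rule modMH[OF m])
  note ba = additive_maps_closed[OF bco_additive[OF N]] additive_maps_add[OF bco_additive[OF N]]
  note t = mod_hom_simps[OF nu_map_hom[OF N]] nu_map_pure[OF N]
  note sm = mod_hom_simps[OF bc_smult_hom[OF N]]
  have hom: "bco N \<in> mod_hom K (MK (bc N)) (MH (bc N))"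
  proof (rule mod_homI)
    fix c x assume c: "c \<in> carrier K" and "x \<in> carrier (MK (bc N))"
    hence x: "x \<in> carrier (NA N)" by simp
    show "bco N (c \<odot>\<^bsub>MK (bc N)\<^esub> x) = c \<odot>\<^bsub>MH (bc N)\<^esub> bco N x"
      using N modBA x
    proof (induction rule: tensor_induct)
      case (pure n a)
      then show ?case using c
        by (simp add: bc_smult_pure[OF N] restrict_regular_smult[OF algA] bco_pure[OF N] rho_simps t)
    next
      case (add x y)
      then show ?case using c by (simp add: sm ba MH.smult_r_distr)
    qed
  qed (simp_all add: ba)
  have at: "comodule_at K H \<Delta> \<epsilon> (MK (bc N)) (bco N) x" if "x \<in> carrier (NA N)" for x
    using N modBA that
  proof (induction rule: tensor_induct)
    case (pure n a)
    then show ?case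
      by (intro comodule_at_image[OF modA modMK[OF m] modH nu_hom_K[OF N] rho_hom hom comult_hom epsilon_hom bco_pure[OF N] _ rho_at])
        simp_all
  next
    case (add x y)
    then show ?case
      using comodule_at_add[OF modMK[OF m] modH hom comult_hom epsilon_hom, of x y] by simp
  qed
  have act: "bco N (a \<odot>\<^bsub>bc N\<^esub> x) = tensor_act K H A (bc N) (\<rho> a) (bco N x)"
    if a: "a \<in> carrier A" and x: "x \<in> carrier (NA N)" for a x
    using N modBA x
  proof (induction rule: tensor_induct)
    case (pure n b)
    then show ?case using a
      by (simp add: bc_smult_pure[OF N] bco_pure[OF N] rho_mult rho_simps act_from_A[OF m nu_hom[OF N]])
  next
    case (add x y)
    then show ?case using a by (simp add: sm ba act_simps[OF m] rho_simps)
  qed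
  show ?thesis
    using m modMK[OF m] hom at act by (simp add: rel_hopf_module_def comodule_iff)
qed

lemma bc_map_iso:
  assumes N: "module B N" and N': "module B N'" and g: "g \<in> mod_iso B N N'"
  shows "mapA N' g \<in> hopf_iso (bc N, bco N) (bc N', bco N')"
proof (rule hopf_isoI)
  note gh = mod_iso_hom[OF g]
  note m = bc_module[OF N] and m' = bc_module[OF N']
  let ?G = "mapA N' g"
  have iso: "?G \<in> mod_iso B (NA N) (NA N')"
    by (rule tensor_map_iso[OF N modBA N' modBA g mod_iso_id])
  note Gh = mod_hom_simps[OF mod_iso_hom[OF iso]]
  note Gp = tensor_map_pure_id[OF N modBA N' modBA gh, simplified]
  have hom: "?G \<in> mod_hom A (bc N) (bc N')"
  proof (rule mod_homI)
    fix a x assume a: "a \<in> carrier A" and "x \<in> carrier (bc N)"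
    hence x: "x \<in> carrier (NA N)" by simp
    show "?G (a \<odot>\<^bsub>bc N\<^esub> x) = a \<odot>\<^bsub>bc N'\<^esub> ?G x"
      using N modBA x
      by (induction rule: tensor_induct)
        (use a in \<open>simp_all add: bc_smult_pure[OF N] bc_smult_pure[OF N'] Gp mod_hom_closed[OF gh]
          mod_hom_simps[OF bc_smult_hom[OF N]] mod_hom_simps[OF bc_smult_hom[OF N']] Gh\<close>)
  qed (simp_all add: Gh)
  with mod_iso_bij[OF iso] show "?G \<in> mod_iso A (bc N) (bc N')" by (simp add: mod_iso_def)
  note GH = mod_hom_simps[OF MH_map_hom[OF m m' hom]]
  fix x assume "x \<in> carrier (bc N)"
  hence x: "x \<in> carrier (NA N)" by simp
  show "bco N' (?G x) = mapH (bc N') ?G (bco N x)"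
    using N modBA x
  proof (induction rule: tensor_induct)
    case (pure n a)
    hence a: "a \<in> carrier A" by simp
    have "mapH (bc N') ?G (mapH (bc N) (nu N n) (\<rho> a)) =
      tensor_map K (MK (bc N')) H (?G \<circ> nu N n) (id \<circ> id) (\<rho> a)"
      by (rule tensor_map_comp[OF modA modH modMK[OF m] modH modMK[OF m'] modH nu_hom_K[OF N pure(1)] mod_hom_id
            mod_hom_restrict_scalars[OF algA hom] mod_hom_id]) (simp add: rho_simps a)
    also have "\<dots> = mapH (bc N') (nu N' (g n)) (\<rho> a)"
      by (rule tensor_map_cong[OF modA modH]) (use pure in \<open>simp_all add: rho_simps comp_apply Gp\<close>)
    finally show ?case using pure a
      by (simp add: bco_pure[OF N] bco_pure[OF N'] Gp mod_hom_closed[OF gh])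
  next
    case (add x y)
    then show ?case
      by (simp add: Gh GH additive_maps_closed[OF bco_additive[OF N]] additive_maps_add[OF bco_additive[OF N]]
          additive_maps_add[OF bco_additive[OF N']])
  qed
qed

subsection \<open>Functionals on \<open>N \<otimes>\<^sub>B A\<close>\<close>

definition extend where
  "extend f = tensor_lift A (\<lambda>n a. f n \<otimes>\<^bsub>A\<^esub> a)"

text \<open>The extension \<open>f \<otimes>\<^sub>B A\<close> is colinear because the values of \<open>f\<close> are coinvariants: the coaction sends
  \<open>f(n) a\<close> to \<open>(f(n) \<otimes> 1) \<rho>(a)\<close>.\<close>

lemma
  assumes N: "module B N" and f: "f \<in> mod_hom B N (regular B)"
  shows extend_pure: "n \<in> carrier N \<Longrightarrow> a \<in> carrier A \<Longrightarrow> extend f (nu N n a) = f n \<otimes>\<^bsub>A\<^esub> a"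
    and extend_hom: "extend f \<in> mod_hom A (bc N) (regular A)"
    and extend_colinear: "x \<in> carrier (bc N) \<Longrightarrow>
      \<rho> (extend f x) = tensor_map K A H (extend f) id (bco N x)"
proof -
  note m = bc_module[OF N]
  note fs = mod_hom_simps[OF f, simplified] 
  note fA = B_in_A[OF fs(1)]
  have bal: "balanced_map B N (regular A) A (\<lambda>n a. f n \<otimes>\<^bsub>A\<^esub> a)"
    by (rule balanced_mapI) (simp_all add: fs fA A.l_distr A.r_distr B_in_A A.m_ac)
  let ?F = "extend f"
  show p: "n \<in> carrier N \<Longrightarrow> a \<in> carrier A \<Longrightarrow> ?F (nu N n a) = f n \<otimes>\<^bsub>A\<^esub> a" for n a
    unfolding extend_def
    by (rule tensor_lift_pure[OF N modBA A.abelian_group_axioms bal]) simp_all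
  have add: "?F \<in> additive_maps (NA N) A"
    unfolding extend_def
    by (rule tensor_lift_additive[OF N modBA A.abelian_group_axioms bal])
  note as = additive_maps_closed[OF add] additive_maps_add[OF add]
  show hom: "?F \<in> mod_hom A (bc N) (regular A)"
  proof (rule mod_homI)
    fix a x assume a: "a \<in> carrier A" and "x \<in> carrier (bc N)"
    hence x: "x \<in> carrier (NA N)" by simp
    show "?F (a \<odot>\<^bsub>bc N\<^esub> x) = a \<odot>\<^bsub>regular A\<^esub> ?F x"
      using N modBA x
      by (induction rule: tensor_induct)
        (use a in \<open>simp_all add: bc_smult_pure[OF N] p fA A.m_ac as A.r_distr mod_hom_simps[OF bc_smult_hom[OF N]]\<close>)
  qed (simp_all add: as)
  note homK = mod_hom_to_regular[OF algA m hom]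
  note FH = mod_hom_simps[OF tensor_map_hom[OF modMK[OF m] modH modA modH homK mod_hom_id]]
  have "\<rho> (?F x) = tensor_map K A H ?F id (bco N x)" if x: "x \<in> carrier (NA N)"
    using N modBA x
  proof (induction rule: tensor_induct)
    case (pure n a)
    hence a: "a \<in> carrier A" by simp
    have "tensor_map K A H ?F id (mapH (bc N) (nu N n) (\<rho> a)) =
      tensor_map K A H (?F \<circ> nu N n) (id \<circ> id) (\<rho> a)"
      by (rule tensor_map_comp[OF modA modH modMK[OF m] modH modA modH nu_hom_K[OF N pure(1)] mod_hom_id
            homK mod_hom_id]) (simp add: rho_simps a)
    also have "\<dots> = tensor_map K A H (\<lambda>a'. f n \<otimes>\<^bsub>A\<^esub> a') id (\<rho> a)"
      by (rule tensor_map_cong[OF modA modH]) (use pure in \<open>simp_all add: rho_simps comp_apply p\<close>)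
    also have "\<dots> = \<rho> (f n) \<star> \<rho> a"
      using fs(1)[OF pure(1)] a by (simp add: B_iff mult_pure_one rho_simps)
    finally show ?case using pure a by (simp add: bco_pure[OF N] p rho_mult fA)
  next
    case (add x y)
    then show ?case
      by (simp add: as FH rho_simps additive_maps_closed[OF bco_additive[OF N]] additive_maps_add[OF bco_additive[OF N]])
  qed
  thus "x \<in> carrier (bc N) \<Longrightarrow> \<rho> (?F x) = tensor_map K A H ?F id (bco N x)" by simp
qed

text \<open>On \<open>n \<otimes> a\<close> this is the dual basis expansion of \<open>n\<close>, with the coefficients \<open>f\<^sub>j(n)\<close> moved across the
  tensor sign.\<close>

lemma bc_expansion:
  assumes N: "module B N" and ds: "dual_basis B N ds" and x: "x \<in> carrier (bc N)"
  shows "lsum (bc N) (\<lambda>(f, p). nu N p (extend f x)) ds = x"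
proof -
  interpret N: module B N by fact
  interpret T: module B "NA N" by (rule tensor_module[OF N modBA])
  note d = dual_basisD[OF ds]
  note ag = T.M.abelian_group_axioms
  have e: "extend f y \<in> carrier A" if "(f, p) \<in> set ds" "y \<in> carrier (NA N)" for f p y
    using mod_hom_closed[OF extend_hom[OF N d(1)[OF that(1)]]] that by simp
  have c: "nu N p (extend f y) \<in> carrier (NA N)"
    if "(f, p) \<in> set ds" "y \<in> carrier (NA N)" for f p y
    using that d(2) e by (simp add: pure_closed)
  have l: "lsum (bc N) f xs = lsum (NA N) f xs" for f :: "_ \<Rightarrow> _" and xs
    by (simp add: lsum_def)
  let ?S = "\<lambda>x. lsum (NA N) (\<lambda>(f, p). nu N p (extend f x)) ds"
  from x have "x \<in> carrier (NA N)" by simp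
  with N modBA have "?S x = x"
  proof (induction rule: tensor_induct)
    case (pure n a)
    hence a: "a \<in> carrier A" by simp
    have "(\<lambda>n. nu N n a) \<in> additive_maps N (NA N)"
      by (rule additive_mapsI) (simp_all add: a pure_closed pure_add_left[OF N modBA])
    from additive_maps_lsum[OF this N.abelian_group_axioms ag, of ds "\<lambda>(f, p). f n \<odot>\<^bsub>N\<^esub> p"]
    have "nu N n a = lsum (NA N) (\<lambda>x. nu N (case x of (f, p) \<Rightarrow> f n \<odot>\<^bsub>N\<^esub> p) a) ds"
      using d pure(1) by (auto simp: mod_hom_closed[OF d(1), simplified])
    also have "\<dots> = ?S (nu N n a)"
    proof (rule lsum_cong)
      fix x assume x: "x \<in> set ds"
      obtain f p where fp: "x = (f, p)" by (cases x)
      note f = d(1)[OF x[unfolded fp]] and p = d(2)[OF x[unfolded fp]]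
      show "nu N (case x of (f, p) \<Rightarrow> f n \<odot>\<^bsub>N\<^esub> p) a = (case x of (f, p) \<Rightarrow> nu N p (extend f (nu N n a)))"
        using pure(1) a p mod_hom_closed[OF f pure(1)]
        by (simp add: fp extend_pure[OF N f] pure_balanced[OF N modBA, simplified])
    qed
    finally show ?case by simp
  next
    case (add x y)
    have "?S (x \<oplus>\<^bsub>NA N\<^esub> y) =
      lsum (NA N) (\<lambda>d. (case d of (f, p) \<Rightarrow> nu N p (extend f x)) \<oplus>\<^bsub>NA N\<^esub>
        (case d of (f, p) \<Rightarrow> nu N p (extend f y))) ds"
    proof (rule lsum_cong)
      fix z assume z: "z \<in> set ds"
      obtain f p where fp: "z = (f, p)" by (cases z)
      note f = d(1)[OF z[unfolded fp]] and p = d(2)[OF z[unfolded fp]]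
      have "extend f (x \<oplus>\<^bsub>NA N\<^esub> y) = extend f x \<oplus>\<^bsub>A\<^esub> extend f y"
        using mod_hom_add[OF extend_hom[OF N f], of x y] add by simp
      thus "(case z of (f, p) \<Rightarrow> nu N p (extend f (x \<oplus>\<^bsub>NA N\<^esub> y))) =
        (case z of (f, p) \<Rightarrow> nu N p (extend f x)) \<oplus>\<^bsub>NA N\<^esub>
        (case z of (f, p) \<Rightarrow> nu N p (extend f y))"
        using p add e[OF z[unfolded fp]] by (simp add: fp pure_add_right[OF N modBA, simplified])
    qed
    also have "\<dots> = ?S x \<oplus>\<^bsub>NA N\<^esub> ?S y"
      by (rule lsum_add[OF ag]) (use c add in auto)
    finally show ?case using add by simp
  qed
  thus ?thesis by (simp add: l)
qed

subsection \<open>Coinvariants of \<open>N \<otimes>\<^sub>B A\<close>\<close>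

text \<open>The extensions of the \<open>f\<^sub>j\<close> recover \<open>f\<^sub>j(n)\<close> from \<open>n \<otimes> 1\<close>.\<close>

lemma nu_one_inj:
  assumes N: "module B N" and ds: "dual_basis B N ds"
    and n: "n \<in> carrier N" "n' \<in> carrier N" "nu N n \<one>\<^bsub>A\<^esub> = nu N n' \<one>\<^bsub>A\<^esub>"
  shows "n = n'"
proof -
  note d = dual_basisD[OF ds]
  have "f n = f n'" if "(f, p) \<in> set ds" for f p
  proof -
    note f = d(1)[OF that]
    have "f n \<in> carrier A" "f n' \<in> carrier A"
      using mod_hom_closed[OF f] n by (simp_all add: B_in_A)
    moreover have "f n \<otimes>\<^bsub>A\<^esub> \<one>\<^bsub>A\<^esub> = f n' \<otimes>\<^bsub>A\<^esub> \<one>\<^bsub>A\<^esub>"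
      using n by (metis extend_pure[OF N f] A.one_closed)
    ultimately show ?thesis by simp
  qed
  hence "lsum N (\<lambda>(f, p). f n \<odot>\<^bsub>N\<^esub> p) ds = lsum N (\<lambda>(f, p). f n' \<odot>\<^bsub>N\<^esub> p) ds"
    by (intro lsum_cong) (metis (no_types, lifting) case_prod_beta prod.collapse)
  thus ?thesis using d(3) n by simp
qed

text \<open>A colinear functional sends a coinvariant \<open>x\<close> into \<open>B\<close>, so the coefficients in the expansion of \<open>x\<close>
  move to the left factor, leaving \<open>x = n \<otimes> 1\<close>.\<close>

lemma bc_coinvariant:
  assumes N: "module B N" and ds: "dual_basis B N ds"
    and x: "x \<in> carrier (bc N)" "bco N x = pure K (MK (bc N)) H x \<one>\<^bsub>H\<^esub>"
  shows "\<exists>n\<in>carrier N. x = nu N n \<one>\<^bsub>A\<^esub>"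
proof -
  interpret N: module B N by fact
  interpret T: module B "NA N" by (rule tensor_module[OF N modBA])
  note d = dual_basisD[OF ds]
  have b: "extend f x \<in> carrier B" if "(f, p) \<in> set ds" for f p
  proof -
    note f = d(1)[OF that]
    note h = extend_hom[OF N f]
    show ?thesis
      using mod_hom_closed[OF h x(1)] extend_colinear[OF N f x(1)] x
      by (simp add: B_iff tensor_map_pure_id[OF modMK[OF bc_module[OF N]] modH modA modH
            mod_hom_to_regular[OF algA bc_module[OF N] h]])
  qed
  let ?n = "lsum N (\<lambda>(f, p). extend f x \<odot>\<^bsub>N\<^esub> p) ds"
  have c: "(case z of (f, p) \<Rightarrow> extend f x \<odot>\<^bsub>N\<^esub> p) \<in> carrier N" if "z \<in> set ds" for z
    using that b d(2) by (auto split: prod.splits)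
  have n: "?n \<in> carrier N"
    by (rule lsum_closed[OF N.abelian_group_axioms c])
  have "(\<lambda>n. nu N n \<one>\<^bsub>A\<^esub>) \<in> additive_maps N (NA N)"
    by (rule additive_mapsI) (simp_all add: pure_closed pure_add_left[OF N modBA])
  from additive_maps_lsum[OF this N.abelian_group_axioms T.M.abelian_group_axioms c, of ds "\<lambda>x. x"]
  have "nu N ?n \<one>\<^bsub>A\<^esub> = lsum (NA N) (\<lambda>z. nu N (case z of (f, p) \<Rightarrow> extend f x \<odot>\<^bsub>N\<^esub> p) \<one>\<^bsub>A\<^esub>) ds"
    by simp
  also have "\<dots> = lsum (NA N) (\<lambda>(f, p). nu N p (extend f x)) ds"
    by (rule lsum_cong) (use b d(2) B_in_A in \<open>auto simp: pure_balanced[OF N modBA, simplified]\<close>)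
  also have "\<dots> = x"
    using bc_expansion[OF N ds x(1)] by (simp add: lsum_def)
  finally show ?thesis using n by blast
qed

lemma nu_one_coinvariant:
  assumes N: "module B N" and n: "n \<in> carrier N"
  shows "bco N (nu N n \<one>\<^bsub>A\<^esub>) = pure K (MK (bc N)) H (nu N n \<one>\<^bsub>A\<^esub>) \<one>\<^bsub>H\<^esub>"
  by (simp add: bco_pure[OF N n] rho_one nu_map_pure[OF N n])

text \<open>A colinear map sends the coinvariant \<open>n \<otimes> 1\<close> to a coinvariant, which is \<open>g(n) \<otimes> 1\<close> for a unique
  \<open>g(n)\<close>.\<close>

lemma descend_hom:
  assumes N: "module B N" and N': "module B N'" and ds': "dual_basis B N' ds'"
    and \<theta>: "\<theta> \<in> mod_hom A (bc N) (bc N')"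
    and col: "\<And>x. x \<in> carrier (bc N) \<Longrightarrow> bco N' (\<theta> x) = mapH (bc N') \<theta> (bco N x)"
  obtains g where "g \<in> mod_hom B N N'" "\<And>n. n \<in> carrier N \<Longrightarrow> \<theta> (nu N n \<one>\<^bsub>A\<^esub>) = nu N' (g n) \<one>\<^bsub>A\<^esub>"
proof -
  interpret N: module B N by fact
  interpret N': module B N' by fact
  note \<theta>s = mod_hom_simps[OF \<theta>, simplified]
  have "\<exists>n'\<in>carrier N'. \<theta> (nu N n \<one>\<^bsub>A\<^esub>) = nu N' n' \<one>\<^bsub>A\<^esub>" if n: "n \<in> carrier N" for n
  proof (rule bc_coinvariant[OF N' ds'])
    have c: "nu N n \<one>\<^bsub>A\<^esub> \<in> carrier (bc N)" using n by (simp add: pure_closed)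
    show "\<theta> (nu N n \<one>\<^bsub>A\<^esub>) \<in> carrier (bc N')" by (rule mod_hom_closed[OF \<theta> c])
    show "bco N' (\<theta> (nu N n \<one>\<^bsub>A\<^esub>)) = pure K (MK (bc N')) H (\<theta> (nu N n \<one>\<^bsub>A\<^esub>)) \<one>\<^bsub>H\<^esub>"
      using c by (simp add: col nu_one_coinvariant[OF N n] del: bc_simps)
        (simp add: tensor_map_pure_id[OF modMK[OF bc_module[OF N]] modH modMK[OF bc_module[OF N']] modH
            mod_hom_restrict_scalars[OF algA \<theta>]])
  qed
  then obtain g where g: "\<And>n. n \<in> carrier N \<Longrightarrow> g n \<in> carrier N'"
    "\<And>n. n \<in> carrier N \<Longrightarrow> \<theta> (nu N n \<one>\<^bsub>A\<^esub>) = nu N' (g n) \<one>\<^bsub>A\<^esub>"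
    by metis
  have "g \<in> mod_hom B N N'"
  proof (rule mod_homI)
    fix n m assume nm: "n \<in> carrier N" "m \<in> carrier N"
    show "g (n \<oplus>\<^bsub>N\<^esub> m) = g n \<oplus>\<^bsub>N'\<^esub> g m"
    proof (rule nu_one_inj[OF N' ds'])
      show "nu N' (g (n \<oplus>\<^bsub>N\<^esub> m)) \<one>\<^bsub>A\<^esub> = nu N' (g n \<oplus>\<^bsub>N'\<^esub> g m) \<one>\<^bsub>A\<^esub>"
        using nm g(1) by (simp add: g(2)[symmetric] pure_add_left[OF N modBA] pure_add_left[OF N' modBA] \<theta>s pure_closed)
    qed (use nm g in simp_all)
  next
    fix b n assume b: "b \<in> carrier B" and n: "n \<in> carrier N"
    have *: "nu M (b \<odot>\<^bsub>M\<^esub> x) \<one>\<^bsub>A\<^esub> = b \<odot>\<^bsub>bc M\<^esub> nu M x \<one>\<^bsub>A\<^esub>"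
      if "module B M" "x \<in> carrier M" for M :: "('a, 'z) module" and x
      using that b by (simp add: bc_smult_pure B_in_A pure_balanced[OF that(1) modBA, simplified])
    show "g (b \<odot>\<^bsub>N\<^esub> n) = b \<odot>\<^bsub>N'\<^esub> g n"
    proof (rule nu_one_inj[OF N' ds'])
      show "nu N' (g (b \<odot>\<^bsub>N\<^esub> n)) \<one>\<^bsub>A\<^esub> = nu N' (b \<odot>\<^bsub>N'\<^esub> g n) \<one>\<^bsub>A\<^esub>"
        using b n g(1) by (simp add: g(2)[symmetric] *[OF N] *[OF N'] \<theta>s pure_closed B_in_A)
    qed (use b n g in simp_all)
  qed (use g in simp)
  thus thesis using g(2) by (rule that)
qed

text \<open>The inverse of \<open>\<theta>\<close> descends as well, and uniqueness makes the two maps mutually inverse.\<close>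

lemma descend_iso:
  assumes N: "module B N" "dual_basis B N ds" and N': "module B N'" "dual_basis B N' ds'"
    and \<theta>: "\<theta> \<in> hopf_iso (bc N, bco N) (bc N', bco N')"
  obtains g where "g \<in> mod_iso B N N'"
    "\<And>x. x \<in> carrier (bc N) \<Longrightarrow> \<theta> x = mapA N' g x"
proof -
  note m = bc_module[OF N(1)] and m' = bc_module[OF N'(1)]
  note \<theta>' = hopf_isoD[OF \<theta>]
  let ?\<theta>i = "inv_into (carrier (bc N)) \<theta>"
  have \<theta>i: "?\<theta>i \<in> hopf_iso (bc N', bco N') (bc N, bco N)"
    by (rule hopf_iso_inv[OF m m' _ \<theta>]) (rule coaction_simps(1)[OF bc_hopf[OF N(1)]])
  note \<theta>i' = hopf_isoD[OF \<theta>i]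
  obtain g where g: "g \<in> mod_hom B N N'" "\<And>n. n \<in> carrier N \<Longrightarrow> \<theta> (nu N n \<one>\<^bsub>A\<^esub>) = nu N' (g n) \<one>\<^bsub>A\<^esub>"
    by (rule descend_hom[OF N(1) N' mod_iso_hom[OF \<theta>'(1)] \<theta>'(2)]) blast+
  obtain h where h: "h \<in> mod_hom B N' N" "\<And>n. n \<in> carrier N' \<Longrightarrow> ?\<theta>i (nu N' n \<one>\<^bsub>A\<^esub>) = nu N (h n) \<one>\<^bsub>A\<^esub>"
    by (rule descend_hom[OF N'(1) N mod_iso_hom[OF \<theta>i'(1)] \<theta>i'(2)]) blast+
  note gc = mod_hom_closed[OF g(1)] and hc = mod_hom_closed[OF h(1)]
  have nc: "n \<in> carrier M \<Longrightarrow> nu M n \<one>\<^bsub>A\<^esub> \<in> carrier (bc M)" for M :: "('a, 'z) module" and n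
    by (simp add: pure_closed)
  have "g \<in> mod_iso B N N'"
  proof (rule mod_isoI[OF g(1), where g = h])
    show "h \<in> carrier N' \<rightarrow> carrier N" using hc by blast
    fix n assume n: "n \<in> carrier N"
    have "nu N (h (g n)) \<one>\<^bsub>A\<^esub> = ?\<theta>i (\<theta> (nu N n \<one>\<^bsub>A\<^esub>))" by (simp add: h(2) gc n g(2) del: bc_simps)
    also have "\<dots> = nu N n \<one>\<^bsub>A\<^esub>" by (rule mod_iso_inv_left[OF \<theta>'(1) nc[OF n]])
    finally show "h (g n) = n" by (intro nu_one_inj[OF N]) (simp_all add: n gc hc)
  next
    fix n assume n: "n \<in> carrier N'"
    have nc': "nu N' n \<one>\<^bsub>A\<^esub> \<in> carrier (bc N')" using n by (simp add: pure_closed)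
    have "nu N' (g (h n)) \<one>\<^bsub>A\<^esub> = \<theta> (?\<theta>i (nu N' n \<one>\<^bsub>A\<^esub>))" by (simp add: h(2) hc n g(2)[symmetric] del: bc_simps)
    also have "\<dots> = nu N' n \<one>\<^bsub>A\<^esub>" by (rule mod_iso_inv_right[OF \<theta>'(1) nc'])
    finally show "g (h n) = n" by (intro nu_one_inj[OF N']) (simp_all add: n gc hc)
  qed
  moreover have "\<theta> x = mapA N' g x" if "x \<in> carrier (bc N)" for x
  proof -
    note \<theta>s = mod_hom_simps[OF mod_iso_hom[OF \<theta>'(1)], simplified]
    note Gs = mod_hom_simps[OF tensor_map_hom[OF N(1) modBA N'(1) modBA g(1) mod_hom_id]]
    from that have "x \<in> carrier (NA N)" by simp
    with N(1) modBA show ?thesis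
    proof (induction rule: tensor_induct)
      case (pure n a)
      hence a: "a \<in> carrier A" by simp
      have "\<theta> (nu N n a) = \<theta> (a \<odot>\<^bsub>bc N\<^esub> nu N n \<one>\<^bsub>A\<^esub>)"
        using a pure by (simp add: bc_smult_pure[OF N(1)])
      also have "\<dots> = a \<odot>\<^bsub>bc N'\<^esub> nu N' (g n) \<one>\<^bsub>A\<^esub>"
        using a pure by (simp add: \<theta>s pure_closed g(2))
      finally show ?case using a pure
        by (simp add: bc_smult_pure[OF N'(1)] gc tensor_map_pure_id[OF N(1) modBA N'(1) modBA g(1)])
    next
      case (add x y)
      then show ?case by (simp add: \<theta>s Gs)
    qed
  qed
  ultimately show thesis by (rule that)
qed

section \<open>The map from \<open>Pic(B)\<close>\<close>

lemma bc_coset_iso: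
  assumes N: "module B N" and ds: "dual_basis B N ds"
  shows "\<exists>(M :: ('a, 'a coset) module) f. module A M \<and> f \<in> mod_iso A (bc N) M"
proof (rule finitely_generated_coset_iso[OF bc_module[OF N], where ds = ds and p = "\<lambda>d. nu N (snd d) \<one>\<^bsub>A\<^esub>"])
  fix x assume x: "x \<in> carrier (bc N)"
  let ?c = "\<lambda>d. extend (fst d) x"
  note d = dual_basisD[OF ds]
  have c: "?c d \<in> carrier A" if "d \<in> set ds" for d
    using mod_hom_closed[OF extend_hom[OF N d(1)] x, of "fst d" "snd d"] that by simp
  have "lsum (bc N) (\<lambda>d. ?c d \<odot>\<^bsub>bc N\<^esub> nu N (snd d) \<one>\<^bsub>A\<^esub>) ds =
    lsum (bc N) (\<lambda>(f, p). nu N p (extend f x)) ds"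
  proof (rule lsum_cong)
    fix z assume z: "z \<in> set ds"
    have "snd z \<in> carrier N" using d(2)[of "fst z" "snd z"] z by simp
    thus "?c z \<odot>\<^bsub>bc N\<^esub> nu N (snd z) \<one>\<^bsub>A\<^esub> = (case z of (f, p) \<Rightarrow> nu N p (extend f x))"
      using c[OF z] by (simp add: bc_smult_pure[OF N] case_prod_beta)
  qed
  with c bc_expansion[OF N ds x]
  show "\<exists>c. (\<forall>d\<in>set ds. c d \<in> carrier A) \<and> x = lsum (bc N) (\<lambda>d. c d \<odot>\<^bsub>bc N\<^esub> nu N (snd d) \<one>\<^bsub>A\<^esub>) ds"
    by (intro exI[of _ ?c]) auto
qed

text \<open>The map \<open>(n \<otimes> a) \<otimes> (n' \<otimes> a') \<mapsto> \<phi>(n \<otimes> n') a a'\<close> is colinear because the values of \<open>\<phi>\<close>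
  are coinvariants.  Its inverse is \<open>a \<mapsto> a E\<close>, with \<open>E\<close> the image of the tensor of \<open>N\<close> and \<open>N'\<close>
  that \<open>\<phi>\<close> sends to \<open>1\<close>.\<close>

lemma bc_pairing:
  assumes N: "module B N" and N': "module B N'"
    and \<phi>: "\<phi> \<in> mod_iso B (tensor B N N') (regular B)"
  shows "\<exists>F. F \<in> hopf_iso (rel_hopf_tensor K H A (bc N, bco N) (bc N', bco N')) (rel_hopf_unit A \<rho>)"
proof -
  interpret N: module B N by fact
  interpret N': module B N' by fact
  note m = bc_module[OF N] and m' = bc_module[OF N']
  interpret bc: module A "bc N" by (rule m)
  interpret bc': module A "bc N'" by (rule m')
  define b where "b n n' = \<phi> (pure B N N' n n')" for n n'
  note h = mod_hom_simps[OF mod_iso_hom[OF \<phi>], simplified]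
  have bB: "n \<in> carrier N \<Longrightarrow> n' \<in> carrier N' \<Longrightarrow> b n n' \<in> carrier B" for n n'
    by (simp add: b_def h pure_closed)
  note bA = B_in_A[OF bB]
  have b: "n \<in> carrier N \<Longrightarrow> k \<in> carrier N \<Longrightarrow> n' \<in> carrier N' \<Longrightarrow> b (n \<oplus>\<^bsub>N\<^esub> k) n' = b n n' \<oplus>\<^bsub>A\<^esub> b k n'"
    "n \<in> carrier N \<Longrightarrow> n' \<in> carrier N' \<Longrightarrow> k' \<in> carrier N' \<Longrightarrow> b n (n' \<oplus>\<^bsub>N'\<^esub> k') = b n n' \<oplus>\<^bsub>A\<^esub> b n k'"
    "r \<in> carrier B \<Longrightarrow> n \<in> carrier N \<Longrightarrow> n' \<in> carrier N' \<Longrightarrow> b (r \<odot>\<^bsub>N\<^esub> n) n' = r \<otimes>\<^bsub>A\<^esub> b n n'"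
    "r \<in> carrier B \<Longrightarrow> n \<in> carrier N \<Longrightarrow> n' \<in> carrier N' \<Longrightarrow> b n (r \<odot>\<^bsub>N'\<^esub> n') = r \<otimes>\<^bsub>A\<^esub> b n n'" for n n' k k' r
    by (simp_all add: b_def h pure_closed pure_add_left[OF N N'] pure_add_right[OF N N'] pure_smult[OF N N', symmetric]
        pure_balanced[OF N N', symmetric])
  define q where "q n a n' a' = b n n' \<otimes>\<^bsub>A\<^esub> (a \<otimes>\<^bsub>A\<^esub> a')" for n a n' a'
  have qb: "bibalanced B N (regular A) N' (regular A) A q"
    unfolding bibalanced_def q_def
    by (intro conjI ballI balanced_mapI) (simp_all add: b bA A.l_distr A.r_distr A.m_ac B_in_A)
  note q = N modBA N' modBA A.abelian_group_axioms qb
  let ?P = "bilift A q"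
  note Ps = bilift_closed[OF q] bilift_add_left[OF q] bilift_add_right[OF q]
  have Pp: "?P (nu N n a) (nu N' n' a') = b n n' \<otimes>\<^bsub>A\<^esub> (a \<otimes>\<^bsub>A\<^esub> a')"
    if "n \<in> carrier N" "a \<in> carrier A" "n' \<in> carrier N'" "a' \<in> carrier A" for n a n' a'
    using that by (subst bilift_pure[OF q]) (simp_all add: q_def)
  note ss = bc_smult_pure[OF N] bc_smult_pure[OF N'] mod_hom_simps[OF bc_smult_hom[OF N]] mod_hom_simps[OF bc_smult_hom[OF N']]
  have PA: "?P (c \<odot>\<^bsub>bc N\<^esub> x) y = c \<otimes>\<^bsub>A\<^esub> ?P x y" "?P x (c \<odot>\<^bsub>bc N'\<^esub> y) = c \<otimes>\<^bsub>A\<^esub> ?P x y"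
    if c: "c \<in> carrier A" and x: "x \<in> carrier (NA N)" and y: "y \<in> carrier (NA N')" for c x y
  proof -
    have "?P (c \<odot>\<^bsub>bc N\<^esub> x) y = c \<otimes>\<^bsub>A\<^esub> ?P x y \<and> ?P x (c \<odot>\<^bsub>bc N'\<^esub> y) = c \<otimes>\<^bsub>A\<^esub> ?P x y"
      using N modBA x
    proof (induction rule: tensor_induct)
      case x: (pure n a)
      show ?case using N' modBA y
      proof (induction rule: tensor_induct)
        case (pure n' a')
        then show ?case using x c by (simp add: ss Ps Pp A.m_ac bA)
      next
        case (add x y)
        then show ?case using x c by (simp add: ss Ps pure_closed A.r_distr)
      qed
    next
      case (add x y')
      then show ?case using y c by (simp add: ss Ps A.r_distr)
    qed
    thus "?P (c \<odot>\<^bsub>bc N\<^esub> x) y = c \<otimes>\<^bsub>A\<^esub> ?P x y" "?P x (c \<odot>\<^bsub>bc N'\<^esub> y) = c \<otimes>\<^bsub>A\<^esub> ?P x y" by simp_all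
  qed
  have Pbal: "balanced_map A (bc N) (bc N') (regular A) ?P"
    by (rule balanced_mapI) (simp_all add: Ps PA)
  let ?T = "tensor A (bc N) (bc N')"
  note Tm = tensor_module[OF m m']
  interpret T: module A ?T by (rule Tm)
  let ?F = "tensor_lift (regular A) ?P"
  have F: "?F \<in> mod_hom A ?T (regular A)"
    by (rule tensor_lift_hom[OF m m' modReg Pbal]) (simp add: PA)
  have Fp: "x \<in> carrier (bc N) \<Longrightarrow> y \<in> carrier (bc N') \<Longrightarrow> ?F (pure A (bc N) (bc N') x y) = ?P x y" for x y
    by (rule tensor_lift_pure[OF m m' module_abelian_group[OF modReg] Pbal])
  note Fs = mod_hom_simps[OF F, simplified]
  obtain es where es: "es \<in> tensor_words N N'" "\<phi> (tensor_class B N N' es) = \<one>\<^bsub>B\<^esub>"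
    by (rule pairing_unit[OF N N' \<phi>])
  let ?g = "\<lambda>n n'. pure A (bc N) (bc N') (nu N n \<one>\<^bsub>A\<^esub>) (nu N' n' \<one>\<^bsub>A\<^esub>)"
  let ?E = "lsum ?T (\<lambda>(n, n'). ?g n n') es"
  have nuB: "nu M (r \<odot>\<^bsub>M\<^esub> n) \<one>\<^bsub>A\<^esub> = r \<odot>\<^bsub>bc M\<^esub> nu M n \<one>\<^bsub>A\<^esub>"
    if "module B M" "r \<in> carrier B" "n \<in> carrier M" for r n and M :: "('a, 'z) module"
    using that by (simp add: bc_smult_pure B_in_A pure_balanced[OF that(1) modBA, simplified])
  have nuadd: "nu M (n \<oplus>\<^bsub>M\<^esub> k) \<one>\<^bsub>A\<^esub> = nu M n \<one>\<^bsub>A\<^esub> \<oplus>\<^bsub>bc M\<^esub> nu M k \<one>\<^bsub>A\<^esub>"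
    if "module B M" "k \<in> carrier M" "n \<in> carrier M" for k n and M :: "('a, 'z) module"
    using that by (simp add: pure_add_left[OF that(1) modBA])
  have nuc: "n \<in> carrier M \<Longrightarrow> a \<in> carrier A \<Longrightarrow> nu M n a \<in> carrier (bc M)" for M :: "('a, 'z) module" and n a
    by (simp add: pure_closed)
  have gbal: "balanced_map B N N' ?T ?g"
    by (rule balanced_mapI)
      (simp_all add: nuB[OF N] nuB[OF N'] nuadd[OF N] nuadd[OF N'] nuc pure_closed pure_add_left[OF m m']
        pure_add_right[OF m m'] pure_balanced[OF m m'] B_in_A del: bc_simps)
  \<comment> \<open>The target is an \<open>A\<close>-module, but the universal property is used over \<open>B\<close>.\<close>
  have gE: "?g n n' = b n n' \<odot>\<^bsub>?T\<^esub> ?E" if "n \<in> carrier N" "n' \<in> carrier N'" for n n'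
    unfolding b_def
    by (rule pairing_universal[OF N N' module_B[OF Tm] \<phi> es gbal _ that])
      (simp add: nuB[OF N] nuc pure_smult[OF m m'] B_in_A del: bc_simps)
  have E: "?E \<in> carrier ?T"
    by (rule lsum_closed[OF T.M.abelian_group_axioms]) (use es in \<open>auto simp: nuc pure_closed simp del: bc_simps\<close>)
  have FE: "?F ?E = \<one>\<^bsub>A\<^esub>"
  proof -
    have "?F ?E = lsum A (\<lambda>z. ?F (case z of (n, n') \<Rightarrow> ?g n n')) es"
      by (rule additive_maps_lsum[OF _ T.M.abelian_group_axioms A.abelian_group_axioms])
        (use Fs es in \<open>auto simp: nuc pure_closed simp del: bc_simps intro!: additive_mapsI\<close>)
    also have "\<dots> = lsum B (\<lambda>(n, n'). \<phi> (pure B N N' n n')) es"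
      unfolding lsum_def[of B] B_simps lsum_def[symmetric]
    proof (rule lsum_cong)
      fix z assume "z \<in> set es"
      then obtain n n' where z: "z = (n, n')" "n \<in> carrier N" "n' \<in> carrier N'"
        using es(1) by auto
      have "?F (?g n n') = b n n'"
        using z by (subst Fp) (simp_all add: pure_closed Ps Pp bA)
      thus "?F (case z of (n, n') \<Rightarrow> ?g n n') = (case z of (n, n') \<Rightarrow> \<phi> (pure B N N' n n'))"
        by (simp add: z b_def)
    qed
    also have "\<dots> = \<one>\<^bsub>B\<^esub>" by (rule pairing_lsum_unit[OF N N' \<phi> es])
    finally show ?thesis by simp
  qed
  have pureE: "pure A (bc N) (bc N') x y = ?P x y \<odot>\<^bsub>?T\<^esub> ?E"
    if x: "x \<in> carrier (NA N)" and y: "y \<in> carrier (NA N')" for x y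
    using N modBA x
  proof (induction rule: tensor_induct)
    case x: (pure n a)
    show ?case using N' modBA y
    proof (induction rule: tensor_induct)
      case (pure n' a')
      have a: "a \<in> carrier A" "a' \<in> carrier A" using x pure by simp_all
      have nu: "nu N n a = a \<odot>\<^bsub>bc N\<^esub> nu N n \<one>\<^bsub>A\<^esub>" "nu N' n' a' = a' \<odot>\<^bsub>bc N'\<^esub> nu N' n' \<one>\<^bsub>A\<^esub>"
        using x pure a by (simp_all add: bc_smult_pure[OF N] bc_smult_pure[OF N'])
      have "pure A (bc N) (bc N') (nu N n a) (nu N' n' a') = a' \<odot>\<^bsub>?T\<^esub> (a \<odot>\<^bsub>?T\<^esub> ?g n n')"
        unfolding nu using a x pure
        by (simp add: nuc pure_smult[OF m m'] pure_balanced[OF m m', symmetric] del: bc_simps)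
      also have "\<dots> = ?P (nu N n a) (nu N' n' a') \<odot>\<^bsub>?T\<^esub> ?E"
        using a x pure E by (simp add: gE Ps Pp bA T.smult_assoc1[symmetric] A.m_ac)
      finally show ?case .
    next
      case (add y y')
      then show ?case using x E
        by (simp add: pure_add_right[OF m m', simplified] pure_closed Ps T.smult_l_distr)
    qed
  next
    case (add x x')
    then show ?case using y E by (simp add: pure_add_left[OF m m', simplified] Ps T.smult_l_distr)
  qed
  have zE: "z = ?F z \<odot>\<^bsub>?T\<^esub> ?E" if "z \<in> carrier ?T" for z
    using m m' that
  proof (induction rule: tensor_induct)
    case (pure x y)
    then show ?case using pureE Fp by simp
  next
    case (add x y)
    then show ?case using E by (simp add: Fs T.smult_l_distr)
  qed
  have iso: "?F \<in> mod_iso A ?T (regular A)"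
    by (rule mod_isoI[OF F, where g = "\<lambda>a. a \<odot>\<^bsub>?T\<^esub> ?E"]) (use zE in \<open>auto simp: E Fs FE\<close>)
  let ?FH = "tensor_map K A H ?F id"
  note FK = mod_hom_to_regular[OF algA Tm F]
  note FHs = mod_hom_simps[OF tensor_map_hom[OF modMK[OF Tm] modH modA modH FK mod_hom_id]]
    and FHp = tensor_map_pure_id[OF modMK[OF Tm] modH modA modH FK, simplified]
  note nus = mod_hom_simps[OF nu_map_hom[OF N]] nu_map_pure[OF N] mod_hom_simps[OF nu_map_hom[OF N']] nu_map_pure[OF N']
  note dg = diag_simps[OF m m', simplified]
  interpret AHr: cring "tensor_alg K A H" by (rule tensor_alg_cring)
  \<comment> \<open>Along the maps \<open>a \<mapsto> n \<otimes> a\<close> and \<open>a \<mapsto> n' \<otimes> a\<close> the coaction becomes the product of \<open>A \<otimes> H\<close>.\<close>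
  have key: "?FH (diag (bc N) (bc N') (mapH (bc N) (nu N n) Z) (mapH (bc N') (nu N' n') W)) =
      pure K A H (b n n') \<one>\<^bsub>H\<^esub> \<star> (Z \<star> W)"
    if n: "n \<in> carrier N" "n' \<in> carrier N'" and Z: "Z \<in> carrier AH" and W: "W \<in> carrier AH" for n n' Z W
    using modA modH Z
  proof (induction rule: tensor_induct)
    case Z: (pure a h)
    show ?case using modA modH W
    proof (induction rule: tensor_induct)
      case (pure a' h')
      then show ?case using n Z
        by (simp add: nus dg FHp pure_closed Fp Ps Pp amult_simps bA)
    next
      case (add x y)
      then show ?case using n Z by (simp add: nus dg FHs pure_closed amult_simps bA)
    qed
  next
    case (add x y)
    then show ?case using n W by (simp add: nus dg FHs pure_closed amult_simps bA)
  qed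
  note hN = bc_hopf[OF N] and hN' = bc_hopf[OF N']
  let ?c = "tensor_coaction (bc N) (bco N) (bc N') (bco N')"
  note cp = tensor_coaction_pure[OF hN hN'] and ca = tensor_coaction_additive[OF hN hN']
  note hs = coaction_simps[OF hN, simplified] coaction_simps[OF hN', simplified]
  have colp: "\<rho> (?P x y) = ?FH (diag (bc N) (bc N') (bco N x) (bco N' y))"
    if x: "x \<in> carrier (NA N)" and y: "y \<in> carrier (NA N')" for x y
    using N modBA x
  proof (induction rule: tensor_induct)
    case x: (pure n a)
    show ?case using N' modBA y
    proof (induction rule: tensor_induct)
      case (pure n' a')
      have "\<rho> (b n n') = pure K A H (b n n') \<one>\<^bsub>H\<^esub>" using bB x pure by (simp add: B_iff)
      then show ?case using x pure
        by (simp add: Ps Pp bco_pure[OF N] bco_pure[OF N'] key rho_simps rho_mult bA)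
    next
      case (add y y')
      then show ?case using x by (simp add: Ps hs dg FHs pure_closed rho_simps)
    qed
  next
    case (add x x')
    then show ?case using y by (simp add: Ps hs dg FHs rho_simps)
  qed
  have "?F \<in> hopf_iso (?T, ?c) (regular A, \<rho>)"
  proof (rule hopf_isoI[OF iso])
    fix z assume "z \<in> carrier ?T"
    with m m' have "\<rho> (?F z) = ?FH (?c z)"
    proof (induction rule: tensor_induct)
      case (pure x y)
      then show ?case using colp cp Fp by simp
    next
      case (add x y)
      then show ?case
        by (simp add: Fs rho_simps additive_maps_add[OF ca] additive_maps_closed[OF ca] FHs)
    qed
    thus "\<rho> (?F z) = mapH (regular A) ?F (?c z)"
      by (simp add: regular_restrict_tensor[OF algA])
  qed
  thus ?thesis by (auto simp: rel_hopf_tensor_eq rel_hopf_unit_def)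
qed

text \<open>Both \<open>N \<otimes>\<^sub>B A\<close> and its dual are moved to coset modules, where classes and inverses are formed; the
  pairing is composed with the inverse of the resulting isomorphism of tensor products.\<close>

lemma bc_invertible:
  fixes N :: "('a, 'n) module" and N' :: "('a, 'l) module"
  assumes N: "module B N" and N': "module B N'"
    and \<phi>: "\<phi> \<in> mod_iso B (tensor B N N') (regular B)"
  obtains M :: "('a, 'a coset) module" and \<rho>M f where "hopf (M, \<rho>M)" "f \<in> hopf_iso (bc N, bco N) (M, \<rho>M)"
    "invertible_rel_hopf K H \<Delta> \<epsilon> A \<rho> (M, \<rho>M)"
proof -
  note hN = bc_hopf[OF N] and hN' = bc_hopf[OF N']
  note m = bc_module[OF N] and m' = bc_module[OF N']
  obtain ds where ds: "dual_basis B N ds" using dual_basis_left[OF N N' \<phi>] by blast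
  obtain ds' where ds': "dual_basis B N' ds'" using dual_basis_right[OF N N' \<phi>] by blast
  obtain M :: "('a, 'a coset) module" and f where M: "module A M" "f \<in> mod_iso A (bc N) M"
    using bc_coset_iso[OF N ds] by blast
  obtain M' :: "('a, 'a coset) module" and f' where M': "module A M'" "f' \<in> mod_iso A (bc N') M'"
    using bc_coset_iso[OF N' ds'] by blast
  obtain \<rho>M where hM: "hopf (M, \<rho>M)" and f: "f \<in> hopf_iso (bc N, bco N) (M, \<rho>M)"
    using hopf_transport[OF hN M] by blast
  obtain \<rho>M' where hM': "hopf (M', \<rho>M')" and f': "f' \<in> hopf_iso (bc N', bco N') (M', \<rho>M')"
    using hopf_transport[OF hN' M'] by blast
  obtain F where F: "F \<in> hopf_iso (rel_hopf_tensor K H A (bc N, bco N) (bc N', bco N')) (rel_hopf_unit A \<rho>)"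
    using bc_pairing[OF N N' \<phi>] by blast
  note G = hopf_tensor_iso[OF hN hN' hM hM' f f']
  note c = additive_maps_closed[OF tensor_coaction_additive[OF hN hN']]
    and c' = additive_maps_closed[OF tensor_coaction_additive[OF hM hM']]
  note T = tensor_module[OF m m'] and T' = tensor_module[OF M(1) M'(1)]
  note Gi = hopf_iso_inv[OF T T' c G[unfolded rel_hopf_tensor_eq]]
  have "hopf_iso (rel_hopf_tensor K H A (M, \<rho>M) (M', \<rho>M')) (rel_hopf_unit A \<rho>) \<noteq> {}"
    using hopf_iso_comp[OF T' T modReg c' Gi F[unfolded rel_hopf_tensor_eq rel_hopf_unit_def]]
    by (auto simp: rel_hopf_tensor_eq rel_hopf_unit_def)
  with hM hM' have "invertible_rel_hopf K H \<Delta> \<epsilon> A \<rho> (M, \<rho>M)"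
    unfolding invertible_rel_hopf_def by blast
  with hM f show thesis by (rule that)
qed

lemma pic_j_class:
  fixes N :: "('a, 'a coset) module"
  assumes N: "module B N"
  shows "jmap (mod_class B N) = hopf_class (bc N, bco N)"
proof -
  have "hopf_class (bc N', bco N') = hopf_class (bc N, bco N)"
    if "N' \<in> mod_class B N" for N'
  proof -
    from that obtain g where N': "module B N'" and g: "g \<in> mod_iso B N N'"
      by (auto simp: mod_class_def)
    from rel_hopf_class_eq[OF bc_hopf[OF N] bc_hopf[OF N'] bc_map_iso[OF N N' g]] show ?thesis ..
  qed
  moreover have "N \<in> mod_class B N"
    using N mod_iso_id by (auto simp: mod_class_def)
  ultimately have "(\<lambda>N. hopf_class (bc N, bco N)) ` mod_class B N =
      {hopf_class (bc N, bco N)}"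
    by blast
  thus ?thesis by (simp add: pic_j_def Let_def)
qed

lemma invertible_moduleE:
  fixes R :: "('r, 'x) ring_scheme"
  assumes "invertible_module R N"
  obtains N' :: "('r, 'r coset) module" and \<phi> where "module R N" "module R N'" "\<phi> \<in> mod_iso R (tensor R N N') (regular R)"
  using assms by (auto simp: invertible_module_def)

lemma pic_j_closed:
  assumes "C \<in> carrier (Pic B)"
  shows "jmap C \<in> carrier (PicH K H \<Delta> \<epsilon> A \<rho>)"
proof -
  obtain N :: "('a, 'a coset) module" where C: "C = mod_class B N" and "invertible_module B N"
    using assms by (auto simp: Pic_def)
  then obtain N' :: "('a, 'a coset) module" and \<phi> where N: "module B N" "module B N'" "\<phi> \<in> mod_iso B (tensor B N N') (regular B)"
    by (elim invertible_moduleE)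
  obtain M :: "('a, 'a coset) module" and \<rho>M f where M: "hopf (M, \<rho>M)" "f \<in> hopf_iso (bc N, bco N) (M, \<rho>M)"
    "invertible_rel_hopf K H \<Delta> \<epsilon> A \<rho> (M, \<rho>M)"
    by (rule bc_invertible[OF N])
  have "jmap C = hopf_class (M, \<rho>M)"
    using rel_hopf_class_eq[OF bc_hopf[OF N(1)] M(1,2)] by (simp add: C pic_j_class[OF N(1)])
  with M(3) show ?thesis by (auto simp: PicH_def)
qed

text \<open>Equal classes give colinear isomorphisms from both base changes to a common module: the class of a base
  change of an invertible module has a member carried by cosets.\<close>

lemma pic_j_inj: "inj_on jmap (carrier (Pic B))"
proof (rule inj_onI)
  fix C D assume "C \<in> carrier (Pic B)" "D \<in> carrier (Pic B)"
    and eq: "jmap C = jmap D"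
  then obtain N L :: "('a, 'a coset) module" where C: "C = mod_class B N" and D: "D = mod_class B L"
    and inv: "invertible_module B N" "invertible_module B L"
    by (auto simp: Pic_def)
  obtain N' :: "('a, 'a coset) module" and \<phi> where N: "module B N" "module B N'" "\<phi> \<in> mod_iso B (tensor B N N') (regular B)"
    using inv(1) by (rule invertible_moduleE)
  obtain L' :: "('a, 'a coset) module" and \<psi> where L: "module B L" "module B L'" "\<psi> \<in> mod_iso B (tensor B L L') (regular B)"
    using inv(2) by (rule invertible_moduleE)
  obtain ds where ds: "dual_basis B N ds" using dual_basis_left[OF N] by blast
  obtain ds' where ds': "dual_basis B L ds'" using dual_basis_left[OF L] by blast
  note hN = bc_hopf[OF N(1)] and hL = bc_hopf[OF L(1)]
  obtain M :: "('a, 'a coset) module" and \<rho>M f where M: "hopf (M, \<rho>M)" "f \<in> hopf_iso (bc N, bco N) (M, \<rho>M)"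
    by (rule bc_invertible[OF N])
  have "(M, \<rho>M) \<in> hopf_class (bc N, bco N)"
    using M by (auto simp: rel_hopf_class_def)
  also have "\<dots> = hopf_class (bc L, bco L)"
    using eq by (simp add: C D pic_j_class[OF N(1)] pic_j_class[OF L(1)])
  finally obtain f' where f': "f' \<in> hopf_iso (bc L, bco L) (M, \<rho>M)"
    by (auto simp: rel_hopf_class_def)
  note mods = bc_module[OF N(1)] hopfD(1)[OF M(1)] bc_module[OF L(1)]
  note \<theta> = hopf_iso_comp[OF mods coaction_simps(1)[OF hN] M(2)
      hopf_iso_inv[OF mods(3,2) coaction_simps(1)[OF hL] f']]
  obtain g where "g \<in> mod_iso B N L"
    by (rule descend_iso[OF N(1) ds L(1) ds' \<theta>]) blast+
  from mod_class_eq[OF N(1) this] show "C = D" by (simp add: C D)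
qed

section \<open>The map from \<open>K\<^sub>1\<close>\<close>

text \<open>The value of \<open>i\<close> at the class of \<open>(N, \<alpha>)\<close>, which the comments call \<open>X\<close>.\<close>

definition grouplike_of where
  "grouplike_of N \<alpha> =
    tensor_map K A H \<alpha> id (bco N (inv_into (carrier (bc N)) \<alpha> \<one>\<^bsub>A\<^esub>))"

text \<open>Each \<open>x\<close> equals \<open>\<alpha>(x) \<alpha>\<inverse>(1)\<close>, and the coaction of \<open>N \<otimes>\<^sub>B A\<close> sends it to \<open>\<rho>(\<alpha>(x))\<close> times
  that of \<open>\<alpha>\<inverse>(1)\<close>; now apply \<open>\<alpha> \<otimes> H\<close>.\<close>

lemma
  assumes N: "module B N" and \<alpha>: "\<alpha> \<in> mod_iso A (bc N) (regular A)"
  shows grouplike_of_closed: "grouplike_of N \<alpha> \<in> carrier AH"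
    and trivialization_colinear: "\<alpha> \<in> hopf_iso (bc N, bco N) (regular A, \<lambda>a. grouplike_of N \<alpha> \<star> \<rho> a)"
proof -
  note m = bc_module[OF N] and hN = bc_hopf[OF N]
  interpret bc: module A "bc N" by (rule m)
  note \<alpha>h = mod_iso_hom[OF \<alpha>]
  note \<alpha>K = mod_hom_to_regular[OF algA m \<alpha>h]
  note \<alpha>H = mod_hom_simps[OF tensor_map_hom[OF modMK[OF m] modH modA modH \<alpha>K mod_hom_id]]
  interpret AHr: cring "tensor_alg K A H" by (rule tensor_alg_cring)
  define x0 where "x0 = inv_into (carrier (bc N)) \<alpha> \<one>\<^bsub>A\<^esub>"
  have x0: "x0 \<in> carrier (bc N)" "\<alpha> x0 = \<one>\<^bsub>A\<^esub>"
    using mod_iso_inv_closed[OF \<alpha>, of "\<one>\<^bsub>A\<^esub>"] mod_iso_inv_right[OF \<alpha>, of "\<one>\<^bsub>A\<^esub>"] by (simp_all add: x0_def)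
  note b0 = coaction_simps(1)[OF hN x0(1)]
  have X: "grouplike_of N \<alpha> = tensor_map K A H \<alpha> id (bco N x0)"
    by (simp add: grouplike_of_def x0_def)
  show Xc: "grouplike_of N \<alpha> \<in> carrier AH"
    unfolding X by (rule \<alpha>H(1)[OF b0])
  show "\<alpha> \<in> hopf_iso (bc N, bco N) (regular A, \<lambda>a. grouplike_of N \<alpha> \<star> \<rho> a)"
  proof (rule hopf_isoI[OF \<alpha>])
    fix x assume x: "x \<in> carrier (bc N)"
    have a: "\<alpha> x \<in> carrier A" using mod_hom_closed[OF \<alpha>h x] by simp
    have "\<alpha> (\<alpha> x \<odot>\<^bsub>bc N\<^esub> x0) = \<alpha> x"
      using mod_hom_smult[OF \<alpha>h a x0(1)] a by (simp add: x0(2))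
    hence "x = \<alpha> x \<odot>\<^bsub>bc N\<^esub> x0"
      using mod_iso_bij[OF \<alpha>] x bc.smult_closed[OF a x0(1)] by (auto simp only: bij_betw_def inj_on_def)
    hence "bco N x = tensor_act K H A (bc N) (\<rho> (\<alpha> x)) (bco N x0)"
      using hopfD(4)[OF hN a x0(1)] by simp
    hence "tensor_map K A H \<alpha> id (bco N x) = \<rho> (\<alpha> x) \<star> grouplike_of N \<alpha>"
      using act_to_A[OF m \<alpha>h rho_simps(1)[OF a] b0] by (simp add: X)
    also have "\<dots> = grouplike_of N \<alpha> \<star> \<rho> (\<alpha> x)"
      using AHr.m_comm[of "\<rho> (\<alpha> x)" "grouplike_of N \<alpha>"] Xc a by (simp add: rho_simps)
    finally show "grouplike_of N \<alpha> \<star> \<rho> (\<alpha> x) = mapH (regular A) \<alpha> (bco N x)"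
      by (simp add: regular_restrict_tensor[OF algA])
  qed
qed

text \<open>The grouplike condition on \<open>X\<close> is the pair of comodule axioms at \<open>1\<close> for \<open>a \<mapsto> X \<rho>(a)\<close>, and
  \<open>\<alpha>\<close> carries them over from \<open>\<alpha>\<inverse>(1)\<close>.\<close>

lemma trivialization_is_grouplike:
  assumes N: "module B N" and \<alpha>: "\<alpha> \<in> mod_iso A (bc N) (regular A)"
  shows "grouplike K H \<Delta> \<epsilon> A \<rho> (grouplike_of N \<alpha>)"
proof -
  note m = bc_module[OF N] and hN = bc_hopf[OF N]
  note X = grouplike_of_closed[OF N \<alpha>]
  let ?X = "grouplike_of N \<alpha>"
  interpret AHr: cring "tensor_alg K A H" by (rule tensor_alg_cring)
  note \<alpha>K = mod_hom_to_regular[OF algA m mod_iso_hom[OF \<alpha>]]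
  have hom: "(\<lambda>a. ?X \<star> \<rho> a) \<in> mod_hom K A AH"
    by (rule mod_homI) (simp_all add: rho_simps amult_simps X amult_smult_right)
  have col: "?X \<star> \<rho> (\<alpha> x) = tensor_map K A H \<alpha> id (bco N x)" if "x \<in> carrier (MK (bc N))" for x
    using hopf_isoD(2)[OF trivialization_colinear[OF N \<alpha>], of x] that
    by (simp add: regular_restrict_tensor[OF algA])
  define x0 where "x0 = inv_into (carrier (bc N)) \<alpha> \<one>\<^bsub>A\<^esub>"
  have x0: "x0 \<in> carrier (bc N)" "\<alpha> x0 = \<one>\<^bsub>A\<^esub>"
    using mod_iso_inv_closed[OF \<alpha>, of "\<one>\<^bsub>A\<^esub>"] mod_iso_inv_right[OF \<alpha>, of "\<one>\<^bsub>A\<^esub>"] by (simp_all add: x0_def)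
  have x0': "x0 \<in> carrier (MK (bc N))" using x0(1) by simp
  have one: "?X \<star> \<rho> \<one>\<^bsub>A\<^esub> = ?X"
    using AHr.r_one[of ?X] X by (simp add: rho_one)
  have "comodule_at K H \<Delta> \<epsilon> A (\<lambda>a. ?X \<star> \<rho> a) \<one>\<^bsub>A\<^esub>"
    using comodule_at_image[OF modMK[OF m] modA modH \<alpha>K hopfD(2)[OF hN] hom comult_hom epsilon_hom col x0' hopfD(3)[OF hN x0(1)]]
    by (simp add: x0(2))
  thus ?thesis using X by (simp add: grouplike_def comodule_at_def one)
qed

text \<open>Put \<open>a(n) = \<alpha>(n \<otimes> 1)\<close> and \<open>e\<^sub>j = F\<^sub>j(\<alpha>\<inverse>(1))\<close>, where \<open>F\<^sub>j\<close> extends \<open>f\<^sub>j\<close>.  As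
  \<open>n \<otimes> 1 = a(n) \<alpha>\<inverse>(1)\<close>, applying \<open>F\<^sub>j\<close> shows \<open>a(n) e\<^sub>j = f\<^sub>j(n) \<in> B\<close>.  Expanding
  \<open>\<alpha>\<inverse>(1) = \<Sum> p\<^sub>j \<otimes> e\<^sub>j\<close> gives \<open>\<Sum> a(p\<^sub>j) e\<^sub>j = 1\<close> and \<open>X = \<Sum> (a(p\<^sub>j) \<otimes> 1) \<rho>(e\<^sub>j)\<close>.
  The inverse is \<open>Y = \<Sum> \<rho>(a(p\<^sub>j)) (e\<^sub>j \<otimes> 1)\<close>: in \<open>X Y\<close> the middle factors \<open>\<rho>(e\<^sub>j a(p\<^sub>k))\<close> are
  \<open>e\<^sub>j a(p\<^sub>k) \<otimes> 1\<close>, so \<open>X Y\<close> is the square of \<open>\<Sum> a(p\<^sub>j) e\<^sub>j \<otimes> 1 = 1\<close>.\<close>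

lemma grouplike_of_unit:
  assumes N: "module B N" and ds: "dual_basis B N ds" and \<alpha>: "\<alpha> \<in> mod_iso A (bc N) (regular A)"
  shows "grouplike_of N \<alpha> \<in> Units (tensor_alg K A H)"
proof -
  note m = bc_module[OF N] and hN = bc_hopf[OF N]
  interpret bc: module A "bc N" by (rule m)
  note \<alpha>h = mod_iso_hom[OF \<alpha>]
  note \<alpha>s = mod_hom_simps[OF \<alpha>h, simplified]
  interpret AHr: cring "tensor_alg K A H" by (rule tensor_alg_cring)
  define x0 where "x0 = inv_into (carrier (bc N)) \<alpha> \<one>\<^bsub>A\<^esub>"
  have x0: "x0 \<in> carrier (bc N)" "\<alpha> x0 = \<one>\<^bsub>A\<^esub>"
    using mod_iso_inv_closed[OF \<alpha>, of "\<one>\<^bsub>A\<^esub>"] mod_iso_inv_right[OF \<alpha>, of "\<one>\<^bsub>A\<^esub>"] by (simp_all add: x0_def)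
  let ?X = "grouplike_of N \<alpha>"
  define s where "s z = \<alpha> (nu N (snd z) \<one>\<^bsub>A\<^esub>)" for z :: "('b \<Rightarrow> 'a) \<times> 'b"
  define e where "e z = extend (fst z) x0" for z :: "('b \<Rightarrow> 'a) \<times> 'b"
  have d: "fst z \<in> mod_hom B N (regular B)" "snd z \<in> carrier N" if "z \<in> set ds" for z
    using dual_basisD(1,2)[OF ds, of "fst z" "snd z"] that by simp_all
  have sc: "s z \<in> carrier A" if "z \<in> set ds" for z
    using d(2)[OF that] by (simp add: s_def \<alpha>s pure_closed)
  have ec: "e z \<in> carrier A" if "z \<in> set ds" for z
    using mod_hom_closed[OF extend_hom[OF N d(1)[OF that]] x0(1)] by (simp add: e_def)
  have nuc: "nu N (snd z) a \<in> carrier (bc N)" if "z \<in> set ds" "a \<in> carrier A" for z a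
    using d(2) that by (simp add: pure_closed)
  have \<alpha>nu: "\<alpha> (nu N (snd z) a) = s z \<otimes>\<^bsub>A\<^esub> a" if z: "z \<in> set ds" and a: "a \<in> carrier A" for z a
  proof -
    have "\<alpha> (a \<odot>\<^bsub>bc N\<^esub> nu N (snd z) \<one>\<^bsub>A\<^esub>) = a \<otimes>\<^bsub>A\<^esub> s z"
      using nuc[OF z A.one_closed] a mod_hom_smult[OF \<alpha>h a] by (simp add: s_def)
    thus ?thesis using a d(2)[OF z] sc[OF z] by (simp add: bc_smult_pure[OF N] A.m_comm)
  qed
  have B: "e z \<otimes>\<^bsub>A\<^esub> s w \<in> carrier B" if z: "z \<in> set ds" and w: "w \<in> set ds" for z w
  proof -
    note nw = nuc[OF w A.one_closed] and F = extend_hom[OF N d(1)[OF z]]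
    have "\<alpha> (s w \<odot>\<^bsub>bc N\<^esub> x0) = \<alpha> (nu N (snd w) \<one>\<^bsub>A\<^esub>)"
      using mod_hom_smult[OF \<alpha>h sc[OF w] x0(1)] sc[OF w] by (simp add: x0(2) s_def)
    hence "nu N (snd w) \<one>\<^bsub>A\<^esub> = s w \<odot>\<^bsub>bc N\<^esub> x0"
      using mod_iso_bij[OF \<alpha>] nw bc.smult_closed[OF sc[OF w] x0(1)] by (auto simp only: bij_betw_def inj_on_def)
    hence "extend (fst z) (nu N (snd w) \<one>\<^bsub>A\<^esub>) = s w \<otimes>\<^bsub>A\<^esub> e z"
      using mod_hom_smult[OF F sc[OF w] x0(1)] by (simp add: e_def)
    moreover have "fst z (snd w) \<in> carrier B"
      using mod_hom_closed[OF d(1)[OF z] d(2)[OF w]] by simp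
    ultimately show ?thesis
      using d(2)[OF w] B_in_A by (simp add: extend_pure[OF N d(1)[OF z]] A.m_comm sc[OF w] ec[OF z])
  qed
  have x0sum: "lsum (bc N) (\<lambda>z. nu N (snd z) (e z)) ds = x0"
    using bc_expansion[OF N ds x0(1)] by (simp add: e_def case_prod_beta')
  have "\<alpha> \<in> additive_maps (bc N) A" using \<alpha>s by (intro additive_mapsI) simp_all
  from additive_maps_lsum[OF this bc.M.abelian_group_axioms A.abelian_group_axioms, of ds "\<lambda>z. nu N (snd z) (e z)"]
  have "\<one>\<^bsub>A\<^esub> = lsum A (\<lambda>z. \<alpha> (nu N (snd z) (e z))) ds"
    using nuc ec by (simp add: x0sum x0(2) del: bc_simps)
  also have "\<dots> = lsum A (\<lambda>z. s z \<otimes>\<^bsub>A\<^esub> e z) ds"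
    by (rule lsum_cong) (simp add: \<alpha>nu ec)
  finally have one: "lsum A (\<lambda>z. s z \<otimes>\<^bsub>A\<^esub> e z) ds = \<one>\<^bsub>A\<^esub>" ..
  let ?p = "\<lambda>a. pure K A H a \<one>\<^bsub>H\<^esub>"
  let ?T = "tensor_alg K A H"
  have T: "lsum AH f zs = lsum ?T f zs" for f :: "_ \<Rightarrow> _" and zs by (simp add: lsum_def)
  define g where "g z = ?p (s z \<otimes>\<^bsub>A\<^esub> e z)" for z
  have gone: "lsum ?T g ds = \<one>\<^bsub>?T\<^esub>"
  proof -
    have "?p \<in> additive_maps A ?T"
      by (rule additive_mapsI) (simp_all add: pure_closed pure_add_left[OF modA modH])
    from additive_maps_lsum[OF this A.abelian_group_axioms AHr.abelian_group_axioms, of ds "\<lambda>z. s z \<otimes>\<^bsub>A\<^esub> e z"]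
    show ?thesis using sc ec by (simp add: one g_def[abs_def])
  qed
  \<comment> \<open>The terms of \<open>X\<close> and of its inverse.\<close>
  define x where "x z = ?p (s z) \<star> \<rho> (e z)" for z
  define y where "y z = \<rho> (s z) \<star> ?p (e z)" for z
  have xc: "x z \<in> carrier ?T" if "z \<in> set ds" for z
    using that sc ec by (simp add: x_def amult_simps pure_closed rho_simps)
  have yc: "y z \<in> carrier ?T" if "z \<in> set ds" for z
    using that sc ec by (simp add: y_def amult_simps pure_closed rho_simps)
  have gc: "g z \<in> carrier ?T" if "z \<in> set ds" for z
    using that sc ec by (simp add: g_def pure_closed)
  have X: "?X = lsum ?T x ds"
  proof -
    note \<alpha>K = mod_hom_to_regular[OF algA m \<alpha>h]
    note \<alpha>H = mod_hom_simps[OF tensor_map_hom[OF modMK[OF m] modH modA modH \<alpha>K mod_hom_id]]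
    have add: "(\<lambda>x. tensor_map K A H \<alpha> id (bco N x)) \<in> additive_maps (bc N) ?T"
      by (rule additive_mapsI) (use \<alpha>H coaction_simps[OF hN] in simp_all)
    have "?X = tensor_map K A H \<alpha> id (bco N (lsum (bc N) (\<lambda>z. nu N (snd z) (e z)) ds))"
      by (simp add: grouplike_of_def x0sum) (simp add: x0_def)
    also have "\<dots> = lsum ?T (\<lambda>z. tensor_map K A H \<alpha> id (bco N (nu N (snd z) (e z)))) ds"
      by (rule additive_maps_lsum[OF add bc.M.abelian_group_axioms AHr.abelian_group_axioms]) (rule nuc[OF _ ec])
    also have "\<dots> = lsum ?T x ds"
    proof (rule lsum_cong)
      fix z assume z: "z \<in> set ds"
      note re = rho_simps(1)[OF ec[OF z]]
      have "tensor_map K A H \<alpha> id (bco N (nu N (snd z) (e z))) =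
        tensor_map K A H (\<alpha> \<circ> nu N (snd z)) (id \<circ> id) (\<rho> (e z))"
        using tensor_map_comp[OF modA modH modMK[OF m] modH modA modH nu_hom_K[OF N d(2)[OF z]] mod_hom_id \<alpha>K mod_hom_id re]
        by (simp add: bco_pure[OF N d(2)[OF z] ec[OF z]])
      also have "\<dots> = tensor_map K A H (\<lambda>a. s z \<otimes>\<^bsub>A\<^esub> a) id (\<rho> (e z))"
        by (rule tensor_map_cong[OF modA modH re]) (simp_all add: comp_apply \<alpha>nu z)
      also have "\<dots> = x z" by (simp add: x_def mult_pure_one sc[OF z] re)
      finally show "tensor_map K A H \<alpha> id (bco N (nu N (snd z) (e z))) = x z" .
    qed
    finally show ?thesis .
  qed
  have xy: "x z \<star> y w = g z \<star> g w" if z: "z \<in> set ds" and w: "w \<in> set ds" for z w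
  proof -
    note c = sc[OF z] sc[OF w] ec[OF z] ec[OF w]
    have "x z \<star> y w = ?p (s z) \<star> (\<rho> (e z) \<star> \<rho> (s w)) \<star> ?p (e w)"
      using c AHr.m_assoc by (simp add: x_def y_def amult_simps pure_closed rho_simps)
    also have "\<rho> (e z) \<star> \<rho> (s w) = ?p (e z \<otimes>\<^bsub>A\<^esub> s w)"
      using B[OF z w] c by (simp add: B_iff rho_mult)
    finally show ?thesis using c by (simp add: g_def amult_simps A.m_ac)
  qed
  have Yc: "lsum ?T y ds \<in> carrier ?T" by (rule lsum_closed[OF AHr.abelian_group_axioms yc])
  have Xc: "?X \<in> carrier ?T" using grouplike_of_closed[OF N \<alpha>] by simp
  have "?X \<star> lsum ?T y ds = lsum ?T (\<lambda>z. lsum ?T (\<lambda>w. x z \<star> y w) ds) ds"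
    unfolding X by (rule lsum_mult[OF AHr.is_cring xc yc])
  also have "\<dots> = lsum ?T (\<lambda>z. lsum ?T (\<lambda>w. g z \<star> g w) ds) ds"
    by (intro lsum_cong) (rule xy)
  also have "\<dots> = \<one>\<^bsub>?T\<^esub> \<star> \<one>\<^bsub>?T\<^esub>"
    using lsum_mult[OF AHr.is_cring gc gc, of ds "\<lambda>z. z" ds "\<lambda>z. z"] gone by simp
  finally have "?X \<star> lsum ?T y ds = \<one>\<^bsub>?T\<^esub>" using AHr.l_one[OF AHr.one_closed] by (simp only:)
  moreover from this have "lsum ?T y ds \<star> ?X = \<one>\<^bsub>?T\<^esub>" using AHr.m_comm[OF Xc Yc] by (simp only:)
  ultimately show ?thesis using Xc Yc unfolding Units_def by blast
qed

lemma K1_class_mono: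
  assumes N: "module B N" and N': "module B N'"
    and g: "g \<in> mod_iso B N N'" "\<And>x. x \<in> carrier (bc N) \<Longrightarrow> \<alpha> x = \<alpha>' (mapA N' g x)"
  shows "K1_class B A (N', \<alpha>') \<subseteq> K1_class B A (N, \<alpha>)"
proof
  fix p assume "p \<in> K1_class B A (N', \<alpha>')"
  then obtain L \<gamma> f where p: "p = (L, \<gamma>)" "trivialized_module B A (L, \<gamma>)" and f: "f \<in> mod_iso B N' L"
    "\<And>x. x \<in> carrier (bc N') \<Longrightarrow> \<alpha>' x = \<gamma> (mapA L f x)"
    by (auto simp: K1_class_def)
  have L: "module B L" using p(2) by (simp add: trivialized_module_def invertible_module_def)
  note gh = mod_iso_hom[OF g(1)] and fh = mod_iso_hom[OF f(1)]
  have "\<alpha> x = \<gamma> (mapA L (f \<circ> g) x)" if x: "x \<in> carrier (bc N)" for x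
    using g(2)[OF x] f(2) x mod_hom_closed[OF tensor_map_hom[OF N modBA N' modBA gh mod_hom_id]]
      tensor_map_comp[OF N modBA N' modBA L modBA gh mod_hom_id fh mod_hom_id]
    by simp
  with p mod_iso_comp[OF g(1) f(1)] show "p \<in> K1_class B A (N, \<alpha>)"
    by (auto simp: K1_class_def)
qed

lemma K1_class_eq:
  assumes N: "module B N" and N': "module B N'"
    and g: "g \<in> mod_iso B N N'" "\<And>x. x \<in> carrier (bc N) \<Longrightarrow> \<alpha> x = \<alpha>' (mapA N' g x)"
  shows "K1_class B A (N, \<alpha>) = K1_class B A (N', \<alpha>')"
proof
  show "K1_class B A (N', \<alpha>') \<subseteq> K1_class B A (N, \<alpha>)" by (rule K1_class_mono[OF N N' g(1)]) (rule g(2))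
  let ?h = "inv_into (carrier N) g"
  note h = mod_iso_inv[OF g(1) N]
  note gh = mod_iso_hom[OF g(1)] and hh = mod_iso_hom[OF h]
  show "K1_class B A (N, \<alpha>) \<subseteq> K1_class B A (N', \<alpha>')"
  proof (rule K1_class_mono[OF N' N h])
    fix x assume "x \<in> carrier (bc N')"
    hence x: "x \<in> carrier (NA N')" by simp
    have "tensor_map B N' (regular A) (g \<circ> ?h) (id \<circ> id) x = mapA N' id x"
      by (rule tensor_map_cong[OF N' modBA x]) (simp_all add: comp_apply id_apply mod_iso_inv_right[OF g(1)])
    hence "mapA N' g (mapA N ?h x) = x"
      by (simp add: tensor_map_comp[OF N' modBA N modBA N' modBA hh mod_hom_id gh mod_hom_id x] tensor_map_id[OF N' modBA x])
    thus "\<alpha>' x = \<alpha> (mapA N ?h x)"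
      using g(2) mod_hom_closed[OF tensor_map_hom[OF N' modBA N modBA hh mod_hom_id] x] by simp
  qed
qed

text \<open>The map \<open>g \<otimes>\<^sub>B A\<close> is colinear and carries \<open>\<alpha>\<inverse>(1)\<close> to \<open>\<alpha>'\<inverse>(1)\<close>.\<close>

lemma grouplike_of_cong:
  assumes N: "module B N" and N': "module B N'"
    and \<alpha>: "\<alpha> \<in> mod_iso A (bc N) (regular A)" and \<alpha>': "\<alpha>' \<in> mod_iso A (bc N') (regular A)"
    and g: "g \<in> mod_iso B N N'" "\<And>x. x \<in> carrier (bc N) \<Longrightarrow> \<alpha> x = \<alpha>' (mapA N' g x)"
  shows "grouplike_of N' \<alpha>' = grouplike_of N \<alpha>"
proof -
  note m = bc_module[OF N] and m' = bc_module[OF N'] and hN = bc_hopf[OF N]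
  let ?G = "mapA N' g"
  let ?x = "inv_into (carrier (bc N)) \<alpha> \<one>\<^bsub>A\<^esub>"
  note G = hopf_isoD[OF bc_map_iso[OF N N' g(1)]]
  have x: "?x \<in> carrier (bc N)" "\<alpha> ?x = \<one>\<^bsub>A\<^esub>"
    using mod_iso_inv_closed[OF \<alpha>, of "\<one>\<^bsub>A\<^esub>"] mod_iso_inv_right[OF \<alpha>, of "\<one>\<^bsub>A\<^esub>"] by simp_all
  have "?G ?x \<in> carrier (bc N')" by (rule mod_hom_closed[OF mod_iso_hom[OF G(1)] x(1)])
  moreover have "\<alpha>' (?G ?x) = \<one>\<^bsub>A\<^esub>" using g(2)[OF x(1)] x(2) by simp
  ultimately have "inv_into (carrier (bc N')) \<alpha>' \<one>\<^bsub>A\<^esub> = ?G ?x"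
    using mod_iso_inv_left[OF \<alpha>'] by metis
  hence "grouplike_of N' \<alpha>' =
      tensor_map K A H \<alpha>' id (mapH (bc N') ?G (bco N ?x))"
    unfolding grouplike_of_def by (simp only: G(2)[OF x(1)])
  also have "\<dots> = tensor_map K A H (\<alpha>' \<circ> ?G) (id \<circ> id) (bco N ?x)"
    by (rule tensor_map_comp[OF modMK[OF m] modH modMK[OF m'] modH modA modH
          mod_hom_restrict_scalars[OF algA mod_iso_hom[OF G(1)]] mod_hom_id
          mod_hom_to_regular[OF algA m' mod_iso_hom[OF \<alpha>']] mod_hom_id coaction_simps(1)[OF hN x(1)]])
  also have "\<dots> = grouplike_of N \<alpha>"
    unfolding grouplike_of_def
    by (rule tensor_map_cong[OF modMK[OF m] modH coaction_simps(1)[OF hN x(1)]])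
      (use g(2) in \<open>simp_all add: comp_apply\<close>)
  finally show ?thesis .
qed

lemma trivialized_moduleD:
  assumes "trivialized_module B A (N, \<alpha>)"
  shows "module B N" "invertible_module B N" "\<alpha> \<in> mod_iso A (bc N) (regular A)"
  using assms by (simp_all add: trivialized_module_def invertible_module_def)

lemma k1_i_class:
  fixes N :: "('a, 'a coset) module"
  assumes "trivialized_module B A (N, \<alpha>)"
  shows "imap (K1_class B A (N, \<alpha>)) = grouplike_of N \<alpha>"
proof -
  note t = trivialized_moduleD[OF assms]
  let ?i = "\<lambda>(N, \<alpha>). grouplike_of N \<alpha>"
  have "?i p = grouplike_of N \<alpha>" if "p \<in> K1_class B A (N, \<alpha>)" for p
  proof -
    from that obtain L \<gamma> f where p: "p = (L, \<gamma>)" "trivialized_module B A (L, \<gamma>)" and f: "f \<in> mod_iso B N L"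
      "\<And>x. x \<in> carrier (bc N) \<Longrightarrow> \<alpha> x = \<gamma> (mapA L f x)"
      by (auto simp: K1_class_def)
    note t' = trivialized_moduleD[OF p(2)]
    show ?thesis
      using grouplike_of_cong[OF t(1) t'(1) t(3) t'(3) f] by (simp add: p(1))
  qed
  moreover have "(N, \<alpha>) \<in> K1_class B A (N, \<alpha>)"
    using assms tensor_map_id[OF t(1) modBA] mod_iso_id[of B N] by (simp add: K1_class_def) metis
  ultimately have "?i ` K1_class B A (N, \<alpha>) = {grouplike_of N \<alpha>}"
    using image_cong[OF HOL.refl, of "K1_class B A (N, \<alpha>)" ?i "\<lambda>_. grouplike_of N \<alpha>"]
      image_constant[of "(N, \<alpha>)" "K1_class B A (N, \<alpha>)"] by simp
  thus ?thesis by (simp add: k1_i_def Let_def grouplike_of_def)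
qed

lemma k1_i_closed:
  assumes "C \<in> carrier (K1 B A)"
  shows "imap C \<in> carrier (Gi K H \<Delta> \<epsilon> A \<rho>)"
proof -
  obtain N :: "('a, 'a coset) module" and \<alpha> where C: "C = K1_class B A (N, \<alpha>)" and t: "trivialized_module B A (N, \<alpha>)"
    using assms by (auto simp: K1_def)
  note t' = trivialized_moduleD[OF t]
  obtain N' :: "('a, 'a coset) module" and \<phi> where N: "module B N" "module B N'" "\<phi> \<in> mod_iso B (tensor B N N') (regular B)"
    using t'(2) by (rule invertible_moduleE)
  obtain ds where ds: "dual_basis B N ds" using dual_basis_left[OF N] by blast
  show ?thesis
    using trivialization_is_grouplike[OF t'(1,3)] grouplike_of_unit[OF t'(1) ds t'(3)]
    by (simp add: C k1_i_class[OF t] Gi_def)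
qed

text \<open>If both trivializations have the value \<open>X\<close>, they are colinear for the same coaction on \<open>A\<close>, and
  \<open>\<beta>\<inverse> \<alpha>\<close> descends.\<close>

lemma k1_i_inj: "inj_on imap (carrier (K1 B A))"
proof (rule inj_onI)
  fix C D assume "C \<in> carrier (K1 B A)" "D \<in> carrier (K1 B A)"
    and eq: "imap C = imap D"
  then obtain N L :: "('a, 'a coset) module" and \<alpha> \<beta> where
    C: "C = K1_class B A (N, \<alpha>)" and N: "trivialized_module B A (N, \<alpha>)" and
    D: "D = K1_class B A (L, \<beta>)" and L: "trivialized_module B A (L, \<beta>)"
    by (auto simp: K1_def)
  note N' = trivialized_moduleD[OF N] and L' = trivialized_moduleD[OF L]
  obtain N'' :: "('a, 'a coset) module" and \<phi> where "module B N" "module B N''" "\<phi> \<in> mod_iso B (tensor B N N'') (regular B)"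
    using N'(2) by (rule invertible_moduleE)
  from dual_basis_left[OF this] obtain ds where ds: "dual_basis B N ds" by blast
  obtain L'' :: "('a, 'a coset) module" and \<psi> where "module B L" "module B L''" "\<psi> \<in> mod_iso B (tensor B L L'') (regular B)"
    using L'(2) by (rule invertible_moduleE)
  from dual_basis_left[OF this] obtain ds' where ds': "dual_basis B L ds'" by blast
  note hN = bc_hopf[OF N'(1)] and hL = bc_hopf[OF L'(1)]
  note mods = bc_module[OF N'(1)] modReg bc_module[OF L'(1)]
  have X: "grouplike_of N \<alpha> = grouplike_of L \<beta>"
    using eq by (simp add: C D k1_i_class[OF N] k1_i_class[OF L])
  note \<theta> = hopf_iso_comp[OF mods coaction_simps(1)[OF hN] trivialization_colinear[OF N'(1,3), unfolded X]
      hopf_iso_inv[OF mods(3,2) coaction_simps(1)[OF hL] trivialization_colinear[OF L'(1,3)]]]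
  obtain g where g: "g \<in> mod_iso B N L"
    "\<And>x. x \<in> carrier (bc N) \<Longrightarrow> (inv_into (carrier (bc L)) \<beta> \<circ> \<alpha>) x = mapA L g x"
    by (rule descend_iso[OF N'(1) ds L'(1) ds' \<theta>]) blast+
  have "\<alpha> x = \<beta> (mapA L g x)" if x: "x \<in> carrier (bc N)" for x
    using g(2)[OF x, symmetric] mod_iso_inv_right[OF L'(3) mod_hom_closed[OF mod_iso_hom[OF N'(3)] x]]
    by (simp add: comp_apply)
  hence "K1_class B A (N, \<alpha>) = K1_class B A (L, \<beta>)"
    by (rule K1_class_eq[OF N'(1) L'(1) g(1)])
  thus "C = D" by (simp add: C D)
qed

end

theorem lemma2p5:
  fixes K :: "'k ring" and H :: "('k, 'h) module" and A :: "('k, 'a) module"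
    and \<Delta> :: "'h \<Rightarrow> ('h, 'h) tens" and \<epsilon> :: "'h \<Rightarrow> 'k" and \<rho> :: "'a \<Rightarrow> ('a, 'h) tens"
    and B :: "('k, 'a) module"
  assumes "comm_bialgebra K H \<Delta> \<epsilon>"
    and "comm_comodule_algebra K H \<Delta> \<epsilon> A \<rho>"
    and "B = coinvariants K H A \<rho>"
  shows "pic_j K H \<Delta> \<epsilon> A \<rho> \<in> carrier (Pic B) \<rightarrow> carrier (PicH K H \<Delta> \<epsilon> A \<rho>)
    \<and> inj_on (pic_j K H \<Delta> \<epsilon> A \<rho>) (carrier (Pic B))
    \<and> k1_i K H A \<rho> \<in> carrier (K1 B A) \<rightarrow> carrier (Gi K H \<Delta> \<epsilon> A \<rho>)
    \<and> inj_on (k1_i K H A \<rho>) (carrier (K1 B A))"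
proof -
  interpret comm_comodule_algebra K H \<Delta> \<epsilon> A \<rho> by fact
  show ?thesis
    unfolding assms(3) using pic_j_closed pic_j_inj k1_i_closed k1_i_inj by blast
qed

end
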